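(* Let $0<\alpha<1$, $1<p<1/\alpha$ and $q=\frac{p}{1-\alpha p}$. Put $\beta=(1-\alpha)\max\{1,p'/q\}$. (a) There is a constant $c>0$ depending only on $p$ and $\alpha$ such that for every $w\in A_{p,q}^-(\mathbb{R})$, $$\|\mathcal{R}_{\alpha}\|_{L^{p}_{w^p}(\mathbb{R})\to L^{q}_{w^q}(\mathbb{R})}\le c\,\|w\|_{A_{p,q}^{-}(\mathbb{R})}^{\beta}.$$ This estimate is sharp: there is no positive non-decreasing function $\psi$ on $[1,\infty)$ with $\psi(t)/t^{\beta}\to0$ as $t\to\infty$ such that $\|\mathcal{R}_\alpha\|_{L^p_{w^p}\to L^q_{w^q}}\le\psi(\|w\|_{A_{p,q}^-(\mathbb{R})})$ for all $w\in A_{p,q}^-(\mathbb{R})$. (b) There is a constant $c>0$ depending only on $p$ and $\alpha$ such that for every $w\in A_{p,q}^+(\mathbb{R})$, $$\|\mathcal{W}_{\alpha}\|_{L^{p}_{w^p}(\mathbb{R})\to L^{q}_{w^q}(\mathbb{R})}\le c\,\|w\|_{A_{p,q}^{+}(\mathbb{R})}^{\beta}.$$ This estimate is sharp in the same sense (with $\mathcal{W}_\alpha$ and $A_{p,q}^+$ in place of $\mathcal{R}_\alpha$ and $A_{p,q}^-$).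
   Context: A weight on $\mathbb{R}$ is an a.e. positive locally integrable function. $p'=p/(p-1)$. $\|f\|_{L^r_u(\mathbb{R})}=\big(\int_{\mathbb{R}}|f|^r u\,dx\big)^{1/r}$, and $\|T\|_{X\to Y}=\sup_{\|f\|_X\le1}\|Tf\|_Y$. The one-sided fractional integrals (Weyl and Riemann--Liouville type) are $$\mathcal{W}_{\alpha}f(x)=\int_{x}^{\infty}\frac{f(t)}{(t-x)^{1-\alpha}}dt,\qquad \mathcal{R}_{\alpha}f(x)=\int_{-\infty}^{x}\frac{f(t)}{(x-t)^{1-\alpha}}dt,\qquad x\in\mathbb{R}.$$ For $1<p,q<\infty$, a weight $w$ belongs to $A_{p,q}^{\pm}(\mathbb{R})$ if the corresponding characteristic is finite: $$\|w\|_{A_{p,q}^+(\mathbb{R})}=\sup_{x\in\mathbb{R},h>0}\Big(\frac1h\int_{x-h}^x w^q\,dt\Big)\Big(\frac1h\int_x^{x+h}w^{-p'}dt\Big)^{q/p'},$$ $$\|w\|_{A_{p,q}^-(\mathbb{R})}=\sup_{x\in\mathbb{R},h>0}\Big(\frac1h\int_x^{x+h} w^q\,dt\Big)\Big(\frac1h\int_{x-h}^{x}w^{-p'}dt\Big)^{q/p'}.$$ *)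

theory Defs
  imports "HOL-Analysis.Analysis"
begin

text \<open>
  Norms, averages and operator norms take values in the extended nonnegative reals, so that
  infinite values are not confused with finite ones.  Functions on the line are
  Lebesgue measurable and real-valued.
\<close>

definition conj_exp :: "real \<Rightarrow> real" where
  "conj_exp p = p / (p - 1)"

text \<open>Real powers of extended nonnegative reals; only used with exponent \<open>a > 0\<close>.\<close>

definition ennpowr :: "ennreal \<Rightarrow> real \<Rightarrow> ennreal" where
  "ennpowr x a = (if x = \<infinity> then \<infinity> else ennreal (enn2real x powr a))"

definition weight :: "(real \<Rightarrow> real) \<Rightarrow> bool" where
  "weight w \<longleftrightarrow> (AE x in lebesgue. 0 < w x) \<and> (\<forall>a b. w absolutely_integrable_on {a..b})"

definition Lnorm :: "real \<Rightarrow> (real \<Rightarrow> real) \<Rightarrow> (real \<Rightarrow> real) \<Rightarrow> ennreal" where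
  "Lnorm r u f = ennpowr (\<integral>\<^sup>+ x. ennreal (\<bar>f x\<bar> powr r * u x) \<partial>lebesgue) (1 / r)"

definition Apq_plus_char :: "real \<Rightarrow> real \<Rightarrow> (real \<Rightarrow> real) \<Rightarrow> ennreal" where
  "Apq_plus_char p q w =
    (SUP (x, h) \<in> UNIV \<times> {0<..}.
       (ennreal (1 / h) * (\<integral>\<^sup>+ t\<in>{x - h..x}. ennreal (w t powr q) \<partial>lebesgue)) *
       ennpowr (ennreal (1 / h) * (\<integral>\<^sup>+ t\<in>{x..x + h}. ennreal (w t powr (- conj_exp p)) \<partial>lebesgue))
         (q / conj_exp p))"

definition Apq_minus_char :: "real \<Rightarrow> real \<Rightarrow> (real \<Rightarrow> real) \<Rightarrow> ennreal" where
  "Apq_minus_char p q w =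
    (SUP (x, h) \<in> UNIV \<times> {0<..}.
       (ennreal (1 / h) * (\<integral>\<^sup>+ t\<in>{x..x + h}. ennreal (w t powr q) \<partial>lebesgue)) *
       ennpowr (ennreal (1 / h) * (\<integral>\<^sup>+ t\<in>{x - h..x}. ennreal (w t powr (- conj_exp p)) \<partial>lebesgue))
         (q / conj_exp p))"

definition Apq_plus :: "real \<Rightarrow> real \<Rightarrow> (real \<Rightarrow> real) set" where
  "Apq_plus p q = {w. weight w \<and> Apq_plus_char p q w < \<infinity>}"

definition Apq_minus :: "real \<Rightarrow> real \<Rightarrow> (real \<Rightarrow> real) set" where
  "Apq_minus p q = {w. weight w \<and> Apq_minus_char p q w < \<infinity>}"

text \<open>
  The integrals defining the fractional operators need not converge, in which case the Lebesgue
  integral of the library is 0 by convention.  The set of points at which the integral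
  converges absolutely is therefore recorded separately.
\<close>

definition weyl :: "real \<Rightarrow> (real \<Rightarrow> real) \<Rightarrow> real \<Rightarrow> real" where
  "weyl \<alpha> f x = (LINT t:{x<..}|lebesgue. f t / (t - x) powr (1 - \<alpha>))"

definition weyl_dom :: "real \<Rightarrow> (real \<Rightarrow> real) \<Rightarrow> real set" where
  "weyl_dom \<alpha> f = {x. set_integrable lebesgue {x<..} (\<lambda>t. f t / (t - x) powr (1 - \<alpha>))}"

definition riemann_liouville :: "real \<Rightarrow> (real \<Rightarrow> real) \<Rightarrow> real \<Rightarrow> real" where
  "riemann_liouville \<alpha> f x = (LINT t:{..<x}|lebesgue. f t / (x - t) powr (1 - \<alpha>))"

definition riemann_liouville_dom :: "real \<Rightarrow> (real \<Rightarrow> real) \<Rightarrow> real set" where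
  "riemann_liouville_dom \<alpha> f =
     {x. set_integrable lebesgue {..<x} (\<lambda>t. f t / (x - t) powr (1 - \<alpha>))}"

text \<open>
  Operator norm from \<open>L\<^sup>p\<close> with weight \<open>u\<close> to \<open>L\<^sup>q\<close> with weight \<open>v\<close> of an operator \<open>T\<close> such that
  \<open>T f x\<close> is meaningful for \<open>x \<in> D f\<close>.  If \<open>T f\<close> is not defined almost everywhere
  for some \<open>f\<close> in the unit ball, the norm is infinite; so finiteness of the norm includes the
  assertion that \<open>T\<close> is well defined on the whole space.
\<close>

definition op_norm ::
  "((real \<Rightarrow> real) \<Rightarrow> real set) \<Rightarrow> ((real \<Rightarrow> real) \<Rightarrow> real \<Rightarrow> real) \<Rightarrow>
   real \<Rightarrow> (real \<Rightarrow> real) \<Rightarrow> real \<Rightarrow> (real \<Rightarrow> real) \<Rightarrow> ennreal" where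
  "op_norm D T p u q v =
    (SUP f \<in> {f \<in> borel_measurable lebesgue. Lnorm p u f \<le> 1}.
       if AE x in lebesgue. x \<in> D f then Lnorm q v (T f) else \<infinity>)"

definition weyl_norm :: "real \<Rightarrow> real \<Rightarrow> real \<Rightarrow> (real \<Rightarrow> real) \<Rightarrow> ennreal" where
  "weyl_norm \<alpha> p q w =
     op_norm (weyl_dom \<alpha>) (weyl \<alpha>) p (\<lambda>x. w x powr p) q (\<lambda>x. w x powr q)"

definition riemann_liouville_norm :: "real \<Rightarrow> real \<Rightarrow> real \<Rightarrow> (real \<Rightarrow> real) \<Rightarrow> ennreal" where
  "riemann_liouville_norm \<alpha> p q w =
     op_norm (riemann_liouville_dom \<alpha>) (riemann_liouville \<alpha>) p (\<lambda>x. w x powr p) q (\<lambda>x. w x powr q)"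

end

(*
The upper bound is proved for the Weyl operator; the reflection x -> -x turns it into the
Riemann-Liouville one.  Put u = w^q and sigma = w^(-p').  Cutting the line into cells of length
2^(-n) and letting n tend to infinity reduces the claim to an inequality for sequences, and two
grids (the standard one and a shift of it by a third) reduce that to the bilinear form

  sum over dyadic I of |I|^(alpha-1) (sum of f sigma over I+) (sum of g u over I-),

where I- and I+ are the halves of I.  Freeze the averages of f and of g on the stopping intervals
above I+ and I- on which they have essentially doubled.  If the stopping interval of f lies in the
one of g, say Q, then only the function

  h(t) = sum of |I|^(alpha-1) u(I-) over the I inside Q with t in I+

has to be controlled.  Splitting this sum at the scale u(Q)/A, as Hedberg does, gives
h <= C u(Q)^alpha A^(1-alpha) as soon as u(I-) <= A(t) |I| for all these I, and the one-sided
A_{p,q} condition provides A = K M(1/sigma)^(q/p') with M the sigma-weighted dyadic maximal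
operator.  Doob's inequality for M, whose constant does not depend on sigma, then bounds the
L^{p'}(sigma) norm of h by C K^(1-alpha) u(Q)^(1/q').  The opposite inclusion is the same
statement for the dual exponents and yields K^((1-alpha)p'/q).

Sharpness is tested on u = |x|^(d-1) if p' <= q and on sigma = |x|^(d-1) otherwise, with d -> 0.
*)
theory Submission
  imports Defs
begin

subsection \<open>Inequalities for finite sums\<close>

text \<open>Neither u nor sigma need be doubling: every increasing w, for instance exp, has
  one-sided characteristic at most 1. Hence averages and maximal functions are taken with respect to
  u and sigma themselves, where Doob's constant is free of the weight. The condition is used in the
  root form u(I-)^(1/q) sigma(I+)^(1/p') <= kappa |I+|^(1 - alpha) with kappa = K^(1/q). It is
  invariant under exchanging u with sigma and q with p', so the opposite inclusion is a mirror
  image. The two powers of kappa can be compared because K >= 1; the larger one gives beta.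
  Averaging over cells destroys the identity u^(1/q) sigma^(1/p') = 1, but Hoelder keeps the product
  of the averages at least 1, the direction needed after Doob's inequality. The bounds for single Q
  are summed by Hoelder with the exponents 1/p and 1 - 1/q, whose sum is 1 + alpha > 1. This works
  because a stopping interval of f occurs under at most two stopping intervals of g. A third case,
  in which the stopping intervals are I+ and I- themselves, falls outside both inclusions and costs
  only kappa.\<close>

lemma sum_powr_mult_powr_le:
  fixes x y :: "'a \<Rightarrow> real"
  assumes fin: "finite I" and x: "\<And>i. i \<in> I \<Longrightarrow> 0 \<le> x i" and y: "\<And>i. i \<in> I \<Longrightarrow> 0 \<le> y i"
    and a: "0 < a" and b: "0 < b" and ab: "1 \<le> a + b"
  shows "(\<Sum>i\<in>I. x i powr a * y i powr b) \<le> (\<Sum>i\<in>I. x i) powr a * (\<Sum>i\<in>I. y i) powr b"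
proof -
  define X where "X = (\<Sum>i\<in>I. x i)"
  define Y where "Y = (\<Sum>i\<in>I. y i)"
  show ?thesis
  proof (cases "X = 0 \<or> Y = 0")
    case True
    then have "x i powr a * y i powr b = 0" if "i \<in> I" for i
      using that fin x y sum_nonneg_eq_0_iff[of I x] sum_nonneg_eq_0_iff[of I y]
      by (auto simp: X_def Y_def)
    then have "(\<Sum>i\<in>I. x i powr a * y i powr b) = 0" by (intro sum.neutral) blast
    then show ?thesis by (metis mult_nonneg_nonneg powr_ge_zero)
  next
    case False
    then have X: "X > 0" and Y: "Y > 0"
      using sum_nonneg[of I x] sum_nonneg[of I y] x y by (auto simp: X_def Y_def less_le)
    \<comment> \<open>After division by the totals all ratios are at most 1, so shrinking the
      exponents to \<open>a'\<close> and \<open>b'\<close>, which add up to 1, only increases the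
      powers. The surplus in a + b matters later: in \<open>nested_part\<close> and
      \<open>edge_part\<close> the exponents add up to 1 + \<alpha>.\<close>
    define a' where "a' = a / (a + b)"
    define b' where "b' = b / (a + b)"
    have ab': "0 < a'" "0 < b'" "a' + b' = 1" "a' \<le> a" "b' \<le> b"
      using a b mult_left_mono[OF ab, of a] mult_left_mono[OF ab, of b]
      by (auto simp: a'_def b'_def add_divide_distrib[symmetric] divide_le_eq)
    have key: "x i powr a * y i powr b \<le> X powr a * Y powr b * (a' * (x i / X) + b' * (y i / Y))"
      if i: "i \<in> I" for i
    proof -
      have nn: "0 \<le> x i / X" "0 \<le> y i / Y" using x y i X Y by auto
      have le1: "x i / X \<le> 1" "y i / Y \<le> 1"
        using member_le_sum[OF i, of x] member_le_sum[OF i, of y] fin x y X Y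
        by (auto simp: X_def[symmetric] Y_def[symmetric])
      have "(x i / X) powr a * (y i / Y) powr b \<le> (x i / X) powr a' * (y i / Y) powr b'"
        using nn le1 ab' by (intro mult_mono powr_mono') auto
      also have "\<dots> \<le> a' * (x i / X) + b' * (y i / Y)"
      proof (cases "x i = 0 \<or> y i = 0")
        case True
        moreover have "0 \<le> a' * (x i / X) + b' * (y i / Y)"
            using nn ab' by (intro add_nonneg_nonneg mult_nonneg_nonneg) auto
          ultimately show ?thesis by auto
      next
        case False
        then show ?thesis using nn ab' X Y by (intro Youngs_inequality_0) (auto simp: less_le)
      qed
      finally have "X powr a * Y powr b * ((x i / X) powr a * (y i / Y) powr b)
          \<le> X powr a * Y powr b * (a' * (x i / X) + b' * (y i / Y))"
        by (intro mult_left_mono) auto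
      moreover have "X powr a * Y powr b * ((x i / X) powr a * (y i / Y) powr b) = x i powr a * y i powr b"
        using X Y x[OF i] y[OF i] by (simp add: powr_divide)
      ultimately show ?thesis by simp
    qed
    have "(\<Sum>i\<in>I. x i powr a * y i powr b) \<le>
        (\<Sum>i\<in>I. X powr a * Y powr b * (a' * (x i / X) + b' * (y i / Y)))"
      by (intro sum_mono key)
    also have "\<dots> = X powr a * Y powr b * (a' * (X / X) + b' * (Y / Y))"
      by (simp add: sum_distrib_left[symmetric] sum.distrib sum_divide_distrib[symmetric] X_def Y_def)
    also have "\<dots> = X powr a * Y powr b" using X Y ab' by simp
    finally show ?thesis by (simp add: X_def Y_def)
  qed
qed

text \<open>Peeling off the largest index \<open>b\<close> leaves integers at most
  \<open>b - 1\<close>, so the rest costs an extra factor 2 powr (- a), and x + x d / (1 - d) = x /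
  (1 - d) closes the induction.\<close>

lemma sum_geometric_le:
  fixes N :: "int set" and a :: real
  assumes "finite N" and "0 < a" and "\<And>m. m \<in> N \<Longrightarrow> m \<le> M"
  shows "(\<Sum>m\<in>N. 2 powr (a * of_int m)) \<le> 2 powr (a * of_int M) / (1 - 2 powr (- a))"
  using assms(1,3)
proof (induction N arbitrary: M rule: finite_linorder_max_induct)
  case empty
  have "2 powr (- a) < 1" using assms(2) by (simp add: powr_minus_divide)
  then show ?case by (simp add: divide_simps)
next
  case (insert b A)
  have c: "2 powr (- a) < 1" using assms(2) by (simp add: powr_minus_divide)
  have "(\<Sum>m\<in>A. 2 powr (a * of_int m)) \<le> 2 powr (a * of_int (b - 1)) / (1 - 2 powr (- a))"
    using insert.hyps by (intro insert.IH) auto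
  then have "(\<Sum>m\<in>insert b A. 2 powr (a * of_int m)) \<le>
      2 powr (a * of_int b) + 2 powr (a * of_int (b - 1)) / (1 - 2 powr (- a))"
    using insert.hyps by auto
  also have "2 powr (a * of_int (b - 1)) = 2 powr (a * of_int b) * 2 powr (- a)"
    by (simp add: powr_add[symmetric] algebra_simps)
  also have "2 powr (a * of_int b) + 2 powr (a * of_int b) * 2 powr (- a) / (1 - 2 powr (- a)) =
      2 powr (a * of_int b) / (1 - 2 powr (- a))"
  proof -
    have "x + x * d / (1 - d) = x / (1 - d)" if "d < 1" for x d :: real
      using that by (simp add: field_simps)
    then show ?thesis using c by blast
  qed
  also have "\<dots> \<le> 2 powr (a * of_int M) / (1 - 2 powr (- a))"
    using insert.prems assms(2) c by (intro divide_right_mono) auto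
  finally show ?case .
qed

lemma sum_geometric_powr_le:
  fixes N :: "int set" and a x :: real
  assumes fin: "finite N" and a: "0 < a" and x: "0 < x" and N: "\<And>m. m \<in> N \<Longrightarrow> 2 powr of_int m \<le> x"
  shows "(\<Sum>m\<in>N. 2 powr (a * of_int m)) \<le> x powr a / (1 - 2 powr (- a))"
proof -
  have c: "2 powr (- a) < 1" using a by (simp add: powr_minus_divide)
  have "(\<Sum>m\<in>N. 2 powr (a * of_int m)) \<le> 2 powr (a * of_int \<lfloor>log 2 x\<rfloor>) / (1 - 2 powr (- a))"
    using N x by (intro sum_geometric_le fin a) (auto simp: le_floor_iff le_log_iff)
  also have "2 powr (a * of_int \<lfloor>log 2 x\<rfloor>) \<le> x powr a"
  proof -
    have "2 powr (of_int \<lfloor>log 2 x\<rfloor>) \<le> x" using x by (simp add: le_log_iff[symmetric])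
    then have "(2 powr (of_int \<lfloor>log 2 x\<rfloor>)) powr a \<le> x powr a" using a by (intro powr_mono2) auto
    then show ?thesis by (simp add: powr_powr mult.commute)
  qed
  finally show ?thesis using c by (simp add: divide_right_mono)
qed

text \<open>The two bounds cross where 2^m = V / A. Below the crossing the first is an increasing
  geometric progression, above it the second is a decreasing one, and both have the value V^\<alpha>
  A^(1 - \<alpha>) at the crossing.\<close>

lemma sum_hedberg_le:
  fixes N :: "int set" and z :: "int \<Rightarrow> real"
  assumes fin: "finite N" and \<alpha>: "0 < \<alpha>" "\<alpha> < 1" and A: "0 < A" and V: "0 < V"
    and t1: "\<And>m. m \<in> N \<Longrightarrow> z m \<le> A * 2 powr (\<alpha> * of_int m)"
    and t2: "\<And>m. m \<in> N \<Longrightarrow> z m \<le> V * 2 powr ((\<alpha> - 1) * of_int m)"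
  shows "(\<Sum>m\<in>N. z m) \<le>
    (1 / (1 - 2 powr (- \<alpha>)) + 1 / (1 - 2 powr (\<alpha> - 1))) * (V powr \<alpha> * A powr (1 - \<alpha>))"
proof -
  define N1 where "N1 = {m\<in>N. 2 powr of_int m \<le> V / A}"
  define N2 where "N2 = {m\<in>N. \<not> 2 powr of_int m \<le> V / A}"
  have "(\<Sum>m\<in>N. z m) = (\<Sum>m\<in>N1. z m) + (\<Sum>m\<in>N2. z m)"
    by (subst sum.union_disjoint[symmetric]) (auto simp: N1_def N2_def fin intro!: sum.cong)
  also have "(\<Sum>m\<in>N1. z m) \<le> (\<Sum>m\<in>N1. A * 2 powr (\<alpha> * of_int m))"
    by (intro sum_mono t1) (auto simp: N1_def)
  also have "\<dots> \<le> A * ((V / A) powr \<alpha> / (1 - 2 powr (- \<alpha>)))"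
    unfolding sum_distrib_left[symmetric] using A V fin \<alpha>
    by (intro mult_left_mono sum_geometric_powr_le) (auto simp: N1_def)
  also have "\<dots> = 1 / (1 - 2 powr (- \<alpha>)) * (V powr \<alpha> * A powr (1 - \<alpha>))"
    using A V by (simp add: powr_divide powr_diff mult_ac)
  also have "(\<Sum>m\<in>N2. z m) \<le> (\<Sum>m\<in>N2. V * 2 powr ((\<alpha> - 1) * of_int m))"
    by (intro sum_mono t2) (auto simp: N2_def)
  also have "\<dots> = V * (\<Sum>m\<in>uminus ` N2. 2 powr ((1 - \<alpha>) * of_int m))"
    unfolding sum_distrib_left[symmetric]
    by (subst sum.reindex) (auto simp: inj_on_def o_def algebra_simps)
  also have "\<dots> \<le> V * ((A / V) powr (1 - \<alpha>) / (1 - 2 powr (- (1 - \<alpha>))))"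
  proof (intro mult_left_mono sum_geometric_powr_le)
    fix m assume "m \<in> uminus ` N2"
    then have "V / A < 2 powr (- of_int m)" by (auto simp: N2_def)
    then show "2 powr of_int m \<le> A / V" using A V by (simp add: powr_minus field_simps)
  qed (use A V fin \<alpha> in \<open>auto simp: N2_def\<close>)
  also have "\<dots> = 1 / (1 - 2 powr (\<alpha> - 1)) * (V powr \<alpha> * A powr (1 - \<alpha>))"
    using A V by (simp add: powr_divide powr_diff mult_ac)
  finally show ?thesis by (simp add: algebra_simps)
qed

text \<open>With x = b / a this is r x^(r - 1) <= (r - 1) x^r + 1, an instance of Young's
  inequality. It is the difference form of d(a^r) = r / (r - 1) * a * d(a^(r - 1)), which is where
  Doob's constant comes from.\<close>

lemma powr_diff_le_doob:
  fixes a b r :: real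
  assumes "0 \<le> b" and "b \<le> a" and "1 < r"
  shows "a powr r - b powr r \<le> r / (r - 1) * a * (a powr (r - 1) - b powr (r - 1))"
proof (cases "b = 0")
  case True
  show ?thesis
  proof (cases "a = 0")
    case False
    then have "a powr r = a * a powr (r - 1)" using assms by (simp add: powr_diff)
    moreover have "1 \<le> r / (r - 1)" using assms by (simp add: field_simps)
    moreover have "0 \<le> a * a powr (r - 1)" using assms by simp
    ultimately show ?thesis using True assms
      using mult_right_mono[of 1 "r / (r - 1)" "a * a powr (r - 1)"] by (simp add: mult.assoc)
  qed (use True in auto)
next
  case False
  then have b: "0 < b" "0 < a" using assms by auto
  define x where "x = b / a"
  have x: "0 < x" "x \<le> 1" using b assms by (auto simp: x_def)
  have "x powr (r - 1) = (x powr r) powr ((r - 1) / r) * 1 powr (1 / r)"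
    using assms by (simp add: powr_powr)
  also have "\<dots> \<le> (r - 1) / r * x powr r + 1 / r * 1"
    using assms x by (intro Youngs_inequality_0) (auto simp: field_simps)
  finally have "r * x powr (r - 1) \<le> r * ((r - 1) / r * x powr r + 1 / r * 1)"
    using assms by (intro mult_left_mono) auto
  also have "\<dots> = (r - 1) * x powr r + 1"
    using assms by (simp add: field_simps)
  finally have "(r - 1) * (1 - x powr r) \<le> r * (1 - x powr (r - 1))" by (simp add: algebra_simps)
  then have 1: "(1 - x powr r) \<le> r / (r - 1) * (1 - x powr (r - 1))"
    using assms by (simp add: field_simps)
  have "a powr r - b powr r = a powr r * (1 - x powr r)"
    using b by (simp add: x_def powr_divide field_simps)
  also have "\<dots> \<le> a powr r * (r / (r - 1) * (1 - x powr (r - 1)))"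
    by (intro mult_left_mono 1) auto
  also have "\<dots> = r / (r - 1) * (a powr r * (1 - x powr (r - 1)))" by simp
  also have "a powr r * (1 - x powr (r - 1)) = a * (a powr (r - 1) - b powr (r - 1))"
    using b by (simp add: x_def powr_divide powr_diff field_simps)
  finally show ?thesis by (simp only: mult.assoc)
qed

subsection \<open>Maximal functions and stopping sets of laminar families\<close>

definition wavg :: "('a \<Rightarrow> real) \<Rightarrow> ('a \<Rightarrow> real) \<Rightarrow> 'a set \<Rightarrow> real" where
  "wavg S v A = (\<Sum>t\<in>A. S t * v t) / (\<Sum>t\<in>A. S t)"

text \<open>The inserted 0 keeps \<open>Max\<close> meaningful at points covered by no member of
  \<open>D\<close>.\<close>

definition wmax :: "'a set set \<Rightarrow> ('a \<Rightarrow> real) \<Rightarrow> ('a \<Rightarrow> real) \<Rightarrow> 'a \<Rightarrow> real" where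
  "wmax D S v t = Max (insert 0 (wavg S v ` {A\<in>D. t \<in> A}))"

definition laminar :: "'a set set \<Rightarrow> bool" where
  "laminar D \<longleftrightarrow> (\<forall>A\<in>D. \<forall>B\<in>D. A \<subseteq> B \<or> B \<subseteq> A \<or> A \<inter> B = {})"

lemma laminar_subset: "laminar D \<Longrightarrow> D' \<subseteq> D \<Longrightarrow> laminar D'"
  unfolding laminar_def by blast

lemma wmax_nonneg: "finite D \<Longrightarrow> 0 \<le> wmax D S v t"
  by (simp add: wmax_def)

lemma wavg_le_wmax: "finite D \<Longrightarrow> A \<in> D \<Longrightarrow> t \<in> A \<Longrightarrow> wavg S v A \<le> wmax D S v t"
  by (simp add: wmax_def)

lemma wmax_insert:
  assumes "finite D"
  shows "wmax (insert A D) S v t = (if t \<in> A then max (wavg S v A) (wmax D S v t) else wmax D S v t)"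
proof -
  have "{B \<in> insert A D. t \<in> B} = (if t \<in> A then insert A {B\<in>D. t \<in> B} else {B\<in>D. t \<in> B})" by auto
  then show ?thesis using assms
    by (auto simp: wmax_def insert_commute[of 0])
qed

text \<open>
  Adding a minimal set \<open>A\<close> to the family changes the maximal function only on \<open>A\<close>, where both the old
  and the new one are constant; this replaces the usual integration over level sets.
\<close>

lemma doob_weak:
  fixes S v :: "'a \<Rightarrow> real"
  assumes "finite D" and "laminar D" and "finite X" and "\<And>A. A \<in> D \<Longrightarrow> A \<subseteq> X"
    and S: "\<And>t. t \<in> X \<Longrightarrow> 0 < S t" and v: "\<And>t. t \<in> X \<Longrightarrow> 0 \<le> v t" and r: "1 < r"
  shows "(\<Sum>t\<in>X. S t * wmax D S v t powr r) \<le> r / (r - 1) * (\<Sum>t\<in>X. S t * v t * wmax D S v t powr (r - 1))"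
  using assms(1,2,4)
proof (induction "card D" arbitrary: D)
  case 0
  then have "D = {}" by simp
  then show ?case using r by (simp add: wmax_def)
next
  case (Suc n)
  then have "D \<noteq> {}" by auto
  then obtain A where A: "A \<in> D" "\<And>B. B \<in> D \<Longrightarrow> B \<subseteq> A \<Longrightarrow> B = A"
    using finite_has_minimal[OF Suc.prems(1)] by metis
  define D' where "D' = D - {A}"
  have D': "finite D'" "laminar D'" "D = insert A D'" "A \<notin> D'" "D' \<subseteq> D"
    using Suc.prems A laminar_subset[of D "D - {A}"] by (auto simp: D'_def)
  have IH: "(\<Sum>t\<in>X. S t * wmax D' S v t powr r) \<le>
      r / (r - 1) * (\<Sum>t\<in>X. S t * v t * wmax D' S v t powr (r - 1))"
  proof (rule Suc.hyps(1))
    show "n = card D'" using Suc.hyps(2) Suc.prems(1) A(1) by (simp add: D'_def)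
    show "B \<subseteq> X" if "B \<in> D'" for B using that D'(5) Suc.prems(3) by blast
  qed (fact D'(1) D'(2))+
  have AX: "A \<subseteq> X" by (rule Suc.prems(3)[OF A(1)])
  then have finA: "finite A" using assms(3) finite_subset by blast
  \<comment> \<open>By laminarity and minimality of \<open>A\<close>, a member of \<open>D'\<close>
    that meets \<open>A\<close> contains it. So the old maximal function has a single value
    \<open>b\<close> on \<open>A\<close>.\<close>
  define b where "b = Max (insert 0 (wavg S v ` {B\<in>D'. A \<subseteq> B}))"
  have b: "wmax D' S v t = b" if "t \<in> A" for t
  proof -
    have "t \<in> B \<longleftrightarrow> A \<subseteq> B" if B: "B \<in> D'" for B
    proof -
      have "B \<in> D" "B \<noteq> A" using B by (auto simp: D'_def)
      then have "A \<subseteq> B \<or> A \<inter> B = {}"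
        using A Suc.prems(2) unfolding laminar_def by metis
      then show ?thesis using \<open>t \<in> A\<close> by auto
    qed
    then have "{B\<in>D'. t \<in> B} = {B\<in>D'. A \<subseteq> B}" by auto
    then show ?thesis by (simp add: wmax_def b_def)
  qed
  have b0: "0 \<le> b" unfolding b_def using D' by auto
  define a where "a = max (wavg S v A) b"
  have a: "wmax D S v t = (if t \<in> A then a else wmax D' S v t)" for t
    by (simp add: D'(3) wmax_insert D'(1) b a_def)
  have split: "(\<Sum>t\<in>X. S t * \<phi> t * wmax D S v t powr e) =
      (\<Sum>t\<in>X. S t * \<phi> t * wmax D' S v t powr e) + (\<Sum>t\<in>A. S t * \<phi> t) * (a powr e - b powr e)" for e \<phi>
  proof -
    have "(\<Sum>t\<in>X. S t * \<phi> t * wmax D S v t powr e) - (\<Sum>t\<in>X. S t * \<phi> t * wmax D' S v t powr e) =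
        (\<Sum>t\<in>X. if t \<in> A then S t * \<phi> t * (a powr e - b powr e) else 0)"
      unfolding sum_subtractf[symmetric] by (intro sum.cong) (auto simp: a b algebra_simps)
    also have "\<dots> = (\<Sum>t\<in>A. S t * \<phi> t * (a powr e - b powr e))"
      using AX assms(3) by (simp add: sum.inter_restrict[symmetric] Int_absorb1)
    finally show ?thesis by (simp add: sum_distrib_right)
  qed
  \<comment> \<open>Either the average of \<open>A\<close> does not exceed \<open>b\<close> and
    nothing changes, or it becomes the new value \<open>a\<close>; then the sum of S v over
    \<open>A\<close> is exactly \<open>a\<close> times the mass of \<open>A\<close>, and
    \<open>powr_diff_le_doob\<close> applies.\<close>
  have inc: "(\<Sum>t\<in>A. S t) * (a powr r - b powr r) \<le>
      r / (r - 1) * ((\<Sum>t\<in>A. S t * v t) * (a powr (r - 1) - b powr (r - 1)))"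
  proof (cases "wavg S v A \<le> b")
    case True
    then show ?thesis by (simp add: a_def)
  next
    case False
    then have "A \<noteq> {}" using b0 by (auto simp: wavg_def)
    then have S0: "0 < (\<Sum>t\<in>A. S t)" using AX finA S by (intro sum_pos) auto
    have "(\<Sum>t\<in>A. S t * v t) = (\<Sum>t\<in>A. S t) * a" using False S0 by (simp add: a_def wavg_def)
    moreover have "(\<Sum>t\<in>A. S t) * (a powr r - b powr r) \<le>
        (\<Sum>t\<in>A. S t) * (r / (r - 1) * a * (a powr (r - 1) - b powr (r - 1)))"
      using S0 b0 r by (intro mult_left_mono powr_diff_le_doob) (auto simp: a_def)
    ultimately show ?thesis by (simp add: mult_ac)
  qed
  show ?case using IH inc split[of "\<lambda>_. 1" r] split[of v "r - 1"] by (simp add: distrib_left)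
qed

text \<open>Hoelder on the right side of \<open>doob_weak\<close> produces the power (r - 1) / r of
  the left side \<open>Y\<close>, which can be divided out unless \<open>Y\<close> is 0. The
  constant depends on \<open>r\<close> alone, so \<open>S\<close> may be arbitrarily
  irregular.\<close>

lemma doob_maximal:
  fixes S v :: "'a \<Rightarrow> real"
  assumes D: "finite D" "laminar D" and X: "finite X" "\<And>A. A \<in> D \<Longrightarrow> A \<subseteq> X"
    and S: "\<And>t. t \<in> X \<Longrightarrow> 0 < S t" and v: "\<And>t. t \<in> X \<Longrightarrow> 0 \<le> v t" and r: "1 < r"
  shows "(\<Sum>t\<in>X. S t * wmax D S v t powr r) \<le> (r / (r - 1)) powr r * (\<Sum>t\<in>X. S t * v t powr r)"
proof -
  define Y where "Y = (\<Sum>t\<in>X. S t * wmax D S v t powr r)"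
  define V where "V = (\<Sum>t\<in>X. S t * v t powr r)"
  have Y0: "0 \<le> Y" unfolding Y_def using S by (intro sum_nonneg mult_nonneg_nonneg) (auto intro: less_imp_le)
  have V0: "0 \<le> V" unfolding V_def using S by (intro sum_nonneg mult_nonneg_nonneg) (auto intro: less_imp_le)
  have weak: "Y \<le> r / (r - 1) * (\<Sum>t\<in>X. S t * v t * wmax D S v t powr (r - 1))"
    unfolding Y_def by (rule doob_weak) (use assms in auto)
  have "(\<Sum>t\<in>X. S t * v t * wmax D S v t powr (r - 1)) =
      (\<Sum>t\<in>X. (S t * v t powr r) powr (1 / r) * (S t * wmax D S v t powr r) powr ((r - 1) / r))"
  proof (intro sum.cong refl)
    fix t assume t: "t \<in> X"
    have "S t = S t powr (1 / r) * S t powr ((r - 1) / r)"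
      using S[OF t] r by (simp add: powr_add[symmetric] add_divide_distrib[symmetric])
    then show "S t * v t * wmax D S v t powr (r - 1) =
        (S t * v t powr r) powr (1 / r) * (S t * wmax D S v t powr r) powr ((r - 1) / r)"
      using S[OF t] v[OF t] r by (simp add: powr_mult powr_powr)
  qed
  also have "\<dots> \<le> V powr (1 / r) * Y powr ((r - 1) / r)"
    unfolding V_def Y_def using S r X
    by (intro sum_powr_mult_powr_le mult_nonneg_nonneg) (auto simp: add_divide_distrib[symmetric] intro: less_imp_le)
  finally have "r / (r - 1) * (\<Sum>t\<in>X. S t * v t * wmax D S v t powr (r - 1)) \<le>
      r / (r - 1) * (V powr (1 / r) * Y powr ((r - 1) / r))"
    using r by (intro mult_left_mono) auto
  with weak have main: "Y \<le> r / (r - 1) * (V powr (1 / r) * Y powr ((r - 1) / r))" by simp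
  show ?thesis
  proof (cases "Y = 0")
    case True
    then show ?thesis using V0 by (simp add: Y_def V_def)
  next
    case False
    then have Y: "0 < Y" using Y0 by simp
    have "Y = Y powr (1 / r) * Y powr ((r - 1) / r)"
      using Y r by (simp add: powr_add[symmetric] add_divide_distrib[symmetric])
    with main have "Y powr (1 / r) * Y powr ((r - 1) / r) \<le> (r / (r - 1) * V powr (1 / r)) * Y powr ((r - 1) / r)"
      by (simp add: mult_ac)
    then have "Y powr (1 / r) \<le> r / (r - 1) * V powr (1 / r)"
      by (rule mult_right_le_imp_le) (use Y in simp)
    then have "(Y powr (1 / r)) powr r \<le> (r / (r - 1) * V powr (1 / r)) powr r"
      using r by (intro powr_mono2) auto
    also have "\<dots> = (r / (r - 1)) powr r * V"
      using r V0 by (subst powr_mult) (auto simp: powr_powr)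
    finally show ?thesis using Y r by (simp add: powr_powr Y_def V_def)
  qed
qed

section \<open>Stopping sets and their Carleson sums\<close>

definition ancestor_max :: "'a set set \<Rightarrow> ('a \<Rightarrow> real) \<Rightarrow> ('a \<Rightarrow> real) \<Rightarrow> 'a set \<Rightarrow> real" where
  "ancestor_max D S f A = Max (wavg S f ` {B\<in>D. A \<subseteq> B})"

text \<open>
  The stopping set of \<open>A\<close> is the largest member above \<open>A\<close> whose average reaches the dyadic level of the
  largest average above \<open>A\<close>. The level is junk if that largest average is not positive.
\<close>

definition stopping_level :: "'a set set \<Rightarrow> ('a \<Rightarrow> real) \<Rightarrow> ('a \<Rightarrow> real) \<Rightarrow> 'a set \<Rightarrow> int" where
  "stopping_level D S f A = \<lfloor>log 2 (ancestor_max D S f A)\<rfloor>"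

definition stopping_set :: "'a set set \<Rightarrow> ('a \<Rightarrow> real) \<Rightarrow> ('a \<Rightarrow> real) \<Rightarrow> 'a set \<Rightarrow> 'a set" where
  "stopping_set D S f A = \<Union>{B\<in>D. A \<subseteq> B \<and> 2 powr of_int (stopping_level D S f A) \<le> wavg S f B}"

text \<open>The level is carried along so that sums over keys can read off 2^level. When the largest
  average is positive, it is also the dyadic level of the stopping set's own average.\<close>

definition stopping_key :: "'a set set \<Rightarrow> ('a \<Rightarrow> real) \<Rightarrow> ('a \<Rightarrow> real) \<Rightarrow> 'a set \<Rightarrow> int \<times> 'a set" where
  "stopping_key D S f A = (stopping_level D S f A, stopping_set D S f A)"

text \<open>Makes the union in \<open>stopping_set\<close> a genuine member of the family: the
  members above a nonempty set of a laminar family form a chain.\<close>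

lemma Union_chain_mem:
  assumes "finite C" and "C \<noteq> {}" and "\<And>A B. A \<in> C \<Longrightarrow> B \<in> C \<Longrightarrow> A \<subseteq> B \<or> B \<subseteq> A"
  shows "\<Union>C \<in> C"
proof -
  obtain M where M: "M \<in> C" "\<And>B. B \<in> C \<Longrightarrow> M \<subseteq> B \<Longrightarrow> M = B"
    using finite_has_maximal[OF assms(1,2)] by metis
  then have "\<Union>C = M" using assms(3) by blast
  then show ?thesis using M by simp
qed

context
  fixes D :: "'a set set" and S f :: "'a \<Rightarrow> real"
  assumes D: "finite D" "laminar D"
begin

lemma wavg_le_ancestor_max: "B \<in> D \<Longrightarrow> A \<subseteq> B \<Longrightarrow> wavg S f B \<le> ancestor_max D S f A"
  using D by (auto simp: ancestor_max_def)

lemma ancestor_max_attained: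
  assumes "A \<in> D" obtains B where "B \<in> D" "A \<subseteq> B" "ancestor_max D S f A = wavg S f B"
proof -
  have "ancestor_max D S f A \<in> wavg S f ` {B\<in>D. A \<subseteq> B}"
    unfolding ancestor_max_def using D assms by (intro Max_in) auto
  then show ?thesis using that by auto
qed

lemma ancestor_max_antimono: "A \<in> D \<Longrightarrow> B \<in> D \<Longrightarrow> A \<subseteq> B \<Longrightarrow> ancestor_max D S f B \<le> ancestor_max D S f A"
  using ancestor_max_attained wavg_le_ancestor_max by (metis subset_trans)

lemma stopping_level_bounds:
  assumes "0 < ancestor_max D S f A"
  shows "2 powr of_int (stopping_level D S f A) \<le> ancestor_max D S f A"
    and "ancestor_max D S f A < 2 * 2 powr of_int (stopping_level D S f A)"
proof -
  show "2 powr of_int (stopping_level D S f A) \<le> ancestor_max D S f A"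
    using assms by (simp add: stopping_level_def le_log_iff[symmetric])
  have "log 2 (ancestor_max D S f A) < of_int (stopping_level D S f A) + 1"
    by (simp add: stopping_level_def)
  then have "ancestor_max D S f A < 2 powr (of_int (stopping_level D S f A) + 1)"
    using assms by (simp add: log_less_iff)
  then show "ancestor_max D S f A < 2 * 2 powr of_int (stopping_level D S f A)"
    by (simp add: powr_add)
qed

lemma stopping_set_mem:
  assumes A: "A \<in> D" "A \<noteq> {}" "0 < ancestor_max D S f A"
  shows "stopping_set D S f A \<in> D" and "A \<subseteq> stopping_set D S f A"
    and "2 powr of_int (stopping_level D S f A) \<le> wavg S f (stopping_set D S f A)"
proof -
  define C where "C = {B\<in>D. A \<subseteq> B \<and> 2 powr of_int (stopping_level D S f A) \<le> wavg S f B}"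
  obtain B where "B \<in> D" "A \<subseteq> B" "ancestor_max D S f A = wavg S f B" using ancestor_max_attained A(1) by blast
  then have "B \<in> C" using stopping_level_bounds(1)[OF A(3)] by (simp add: C_def)
  then have "\<Union>C \<in> C"
    using D A(2) by (intro Union_chain_mem) (auto simp: C_def laminar_def, blast)
  then show "stopping_set D S f A \<in> D" "A \<subseteq> stopping_set D S f A"
    "2 powr of_int (stopping_level D S f A) \<le> wavg S f (stopping_set D S f A)"
    by (auto simp: C_def stopping_set_def)
qed

lemma stopping_set_greatest:
  "B \<in> D \<Longrightarrow> A \<subseteq> B \<Longrightarrow> 2 powr of_int (stopping_level D S f A) \<le> wavg S f B \<Longrightarrow> B \<subseteq> stopping_set D S f A"
  unfolding stopping_set_def by blast

text \<open>The level of \<open>B\<close> is squeezed: it is at most that of \<open>A\<close>, since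
  fewer sets lie above \<open>B\<close>, and at least that of \<open>A\<close>, since the stopping
  set still lies above \<open>B\<close>. Thus a key can be recovered from any intermediate set,
  which is what the counting in \<open>nested_part\<close> rests on.\<close>

lemma stopping_eq_between:
  assumes A: "A \<in> D" "A \<noteq> {}" "0 < ancestor_max D S f A"
    and B: "B \<in> D" "A \<subseteq> B" "B \<subseteq> stopping_set D S f A"
  shows "stopping_key D S f B = stopping_key D S f A" and "0 < ancestor_max D S f B"
proof -
  let ?l = "stopping_level D S f A" and ?P = "stopping_set D S f A"
  note P = stopping_set_mem[OF A]
  have ge: "2 powr of_int ?l \<le> ancestor_max D S f B"
    using P B wavg_le_ancestor_max by (meson order_trans)
  show pos: "0 < ancestor_max D S f B" by (rule less_le_trans[OF _ ge]) simp
  have lev: "stopping_level D S f B = ?l"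
  proof (rule antisym)
    show "stopping_level D S f B \<le> ?l"
      unfolding stopping_level_def using pos ancestor_max_antimono[OF A(1) B(1,2)] by (intro floor_mono) auto
    show "?l \<le> stopping_level D S f B"
      using ge pos by (simp add: stopping_level_def[of D S f B] le_floor_iff le_log_iff)
  qed
  have "stopping_set D S f B \<subseteq> ?P"
    unfolding stopping_set_def lev using B(2) by blast
  moreover have "?P \<subseteq> stopping_set D S f B"
    by (rule stopping_set_greatest) (use P B lev in auto)
  ultimately show "stopping_key D S f B = stopping_key D S f A" by (simp add: stopping_key_def lev)
qed

text \<open>Intersecting stopping sets are nested by laminarity. As the thresholds agree, the larger
  of the two competes for both sets and wins.\<close>

lemma stopping_set_unique:
  assumes A: "A \<in> D" "A \<noteq> {}" "0 < ancestor_max D S f A" and B: "B \<in> D" "B \<noteq> {}" "0 < ancestor_max D S f B"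
    and lev: "stopping_level D S f A = stopping_level D S f B"
    and int: "stopping_set D S f A \<inter> stopping_set D S f B \<noteq> {}"
  shows "stopping_set D S f A = stopping_set D S f B"
proof -
  note PA = stopping_set_mem[OF A] and PB = stopping_set_mem[OF B]
  have "stopping_set D S f B \<subseteq> stopping_set D S f A" if "stopping_set D S f A \<subseteq> stopping_set D S f B"
    by (rule stopping_set_greatest) (use PA PB that lev in auto)
  moreover have "stopping_set D S f A \<subseteq> stopping_set D S f B" if "stopping_set D S f B \<subseteq> stopping_set D S f A"
    by (rule stopping_set_greatest) (use PA PB that lev in auto)
  ultimately show ?thesis using D(2) PA(1) PB(1) int unfolding laminar_def by blast
qed

text \<open>At a point t the keys whose set contains t have different levels, by
  \<open>stopping_set_unique\<close>, and each 2^level is at most \<open>wmax\<close> at t. Their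
  p-th powers form a geometric series dominated by the p-th power of \<open>wmax\<close>; summing
  over t against \<open>S\<close> leaves Doob's inequality.\<close>

lemma stopping_carleson:
  assumes X: "finite X" "\<And>A. A \<in> D \<Longrightarrow> A \<subseteq> X" "\<And>A. A \<in> D \<Longrightarrow> A \<noteq> {}"
    and S: "\<And>t. t \<in> X \<Longrightarrow> 0 < S t" and f: "\<And>t. t \<in> X \<Longrightarrow> 0 \<le> f t" and p: "1 < p"
    and \<A>: "\<And>A. A \<in> \<A> \<Longrightarrow> A \<in> D \<and> 0 < ancestor_max D S f A"
  shows "(\<Sum>z\<in>stopping_key D S f ` \<A>. 2 powr (p * of_int (fst z)) * sum S (snd z)) \<le>
      (p / (p - 1)) powr p / (1 - 2 powr (- p)) * (\<Sum>t\<in>X. S t * f t powr p)"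
proof -
  let ?K = "stopping_key D S f ` \<A>"
  have "\<A> \<subseteq> D" using \<A> by auto
  then have finK: "finite ?K" using D finite_subset by auto
  have KX: "snd z \<subseteq> X" if "z \<in> ?K" for z
  proof -
    obtain A where "A \<in> \<A>" "z = stopping_key D S f A" using \<open>z \<in> ?K\<close> by auto
    then show ?thesis using \<A>[of A] X(2)[OF stopping_set_mem(1)] X(3) by (simp add: stopping_key_def)
  qed
  have c: "2 powr (- p) < 1" using p by (simp add: powr_minus_divide)
  have inner: "(\<Sum>z\<in>{z\<in>?K. t \<in> snd z}. 2 powr (p * of_int (fst z))) \<le> wmax D S f t powr p / (1 - 2 powr (- p))" for t
  proof (cases "{z\<in>?K. t \<in> snd z} = {}")
    case True
    then show ?thesis using c by (simp only: sum.empty) simp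
  next
    case False
    have le: "2 powr of_int (fst z) \<le> wmax D S f t" if "z \<in> ?K" "t \<in> snd z" for z
    proof -
      obtain A where A: "A \<in> \<A>" "z = stopping_key D S f A" using \<open>z \<in> ?K\<close> by auto
      then have "A \<in> D" "A \<noteq> {}" "0 < ancestor_max D S f A" using \<A> X by auto
      note P = stopping_set_mem[OF this]
      have "t \<in> stopping_set D S f A" using A that by (simp add: stopping_key_def)
      then show ?thesis using A(2) P(3) wavg_le_wmax[OF D(1) P(1), of t S f] by (simp add: stopping_key_def)
    qed
    have "inj_on fst {z\<in>?K. t \<in> snd z}"
    proof (rule inj_onI)
      fix z z' assume z: "z \<in> {z\<in>?K. t \<in> snd z}" and z': "z' \<in> {z\<in>?K. t \<in> snd z}" and eq: "fst z = fst z'"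
      obtain A where A: "A \<in> \<A>" "z = stopping_key D S f A" using z by auto
      obtain B where B: "B \<in> \<A>" "z' = stopping_key D S f B" using z' by auto
      have "stopping_set D S f A = stopping_set D S f B"
        using A B \<A> X z z' eq by (intro stopping_set_unique) (auto simp: stopping_key_def)
      then show "z = z'" using A B eq by (simp add: stopping_key_def)
    qed
    then have "(\<Sum>z\<in>{z\<in>?K. t \<in> snd z}. 2 powr (p * of_int (fst z))) =
        (\<Sum>m\<in>fst ` {z\<in>?K. t \<in> snd z}. 2 powr (p * of_int m))"
      by (simp add: sum.reindex)
    also have "\<dots> \<le> wmax D S f t powr p / (1 - 2 powr (- p))"
    proof (rule sum_geometric_powr_le)
      obtain z where "z \<in> ?K" "t \<in> snd z" using False by blast
      then have "2 powr of_int (fst z) \<le> wmax D S f t" by (rule le)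
      then show "0 < wmax D S f t" by (rule less_le_trans[rotated]) simp
    qed (use p finK le in auto)
    finally show ?thesis .
  qed
  have "(\<Sum>z\<in>?K. 2 powr (p * of_int (fst z)) * sum S (snd z)) =
      (\<Sum>z\<in>?K. \<Sum>t\<in>X. if t \<in> snd z then 2 powr (p * of_int (fst z)) * S t else 0)"
  proof (rule sum.cong[OF refl])
    fix z assume "z \<in> ?K"
    then have "X \<inter> snd z = snd z" using KX by blast
    then show "2 powr (p * of_int (fst z)) * sum S (snd z) = 
        (\<Sum>t\<in>X. if t \<in> snd z then 2 powr (p * of_int (fst z)) * S t else 0)"
      using X by (simp add: sum.inter_restrict[symmetric] sum_distrib_left)
  qed
  also have "\<dots> = (\<Sum>t\<in>X. \<Sum>z\<in>?K. if t \<in> snd z then 2 powr (p * of_int (fst z)) * S t else 0)"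
    by (rule sum.swap)
  also have "\<dots> = (\<Sum>t\<in>X. S t * (\<Sum>z\<in>{z\<in>?K. t \<in> snd z}. 2 powr (p * of_int (fst z))))"
    using finK by (simp add: sum.inter_filter sum_distrib_left if_distrib mult.commute cong: if_cong)
  also have "\<dots> \<le> (\<Sum>t\<in>X. S t * (wmax D S f t powr p / (1 - 2 powr (- p))))"
    using S by (intro sum_mono mult_left_mono inner) (auto intro: less_imp_le)
  also have "\<dots> = (\<Sum>t\<in>X. S t * wmax D S f t powr p) / (1 - 2 powr (- p))"
    by (simp add: sum_divide_distrib)
  also have "\<dots> \<le> (p / (p - 1)) powr p * (\<Sum>t\<in>X. S t * f t powr p) / (1 - 2 powr (- p))"
    using c by (intro divide_right_mono doob_maximal D X S f p) auto
  finally show ?thesis by simp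
qed

end

subsection \<open>The bilinear form of a system of dyadic pairs\<close>

definition hedberg_const :: "real \<Rightarrow> real" where
  "hedberg_const \<alpha> = 1 / (1 - 2 powr (- \<alpha>)) + 1 / (1 - 2 powr (\<alpha> - 1))"

text \<open>The Hedberg factor times the r-th root of Doob's constant for the exponent q (1 -
  \<alpha>).\<close>

definition testing_const :: "real \<Rightarrow> real \<Rightarrow> real \<Rightarrow> real" where
  "testing_const \<alpha> q r = hedberg_const \<alpha> *
     ((q * (1 - \<alpha>) / (q * (1 - \<alpha>) - 1)) powr (q * (1 - \<alpha>))) powr (1 / r)"

lemma hedberg_const_positive:
  assumes "0 < \<alpha>" and "\<alpha> < 1" shows "0 < hedberg_const \<alpha>"
proof -
  have "2 powr (- \<alpha>) < 1" "2 powr (\<alpha> - 1) < 1"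
    using assms powr_less_mono[of "- \<alpha>" 0 "2::real"] powr_less_mono[of "\<alpha> - 1" 0 "2::real"] by auto
  then show ?thesis unfolding hedberg_const_def by (intro add_pos_pos) auto
qed

lemma testing_const_nonneg: "0 < \<alpha> \<Longrightarrow> \<alpha> < 1 \<Longrightarrow> 0 \<le> testing_const \<alpha> q r"
  using hedberg_const_positive[of \<alpha>] by (simp add: testing_const_def)

text \<open>The axioms are symmetric in \<open>L\<close> and \<open>R\<close>, so each result has a
  mirror image through \<open>swap\<close>. \<open>splitL\<close> and \<open>splitR\<close> encode
  that no member of the family fits strictly between a half and its parent, which decides where
  stopping sets can lie.\<close>

locale dyadic_pairs =
  fixes D :: "'a set set" and J :: "'i set" and L R :: "'i \<Rightarrow> 'a set" and n :: "'i \<Rightarrow> int" and X :: "'a set"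
  assumes finX: "finite X" and finJ: "finite J"
    and D_sub: "A \<in> D \<Longrightarrow> A \<subseteq> X" and D_ne: "A \<in> D \<Longrightarrow> A \<noteq> {}" and lam: "laminar D"
    and LD: "i \<in> J \<Longrightarrow> L i \<in> D" and RD: "i \<in> J \<Longrightarrow> R i \<in> D" and UD: "i \<in> J \<Longrightarrow> L i \<union> R i \<in> D"
    and disj: "i \<in> J \<Longrightarrow> L i \<inter> R i = {}"
    and splitL: "i \<in> J \<Longrightarrow> Q \<in> D \<Longrightarrow> L i \<subseteq> Q \<Longrightarrow> Q = L i \<or> L i \<union> R i \<subseteq> Q"
    and splitR: "i \<in> J \<Longrightarrow> Q \<in> D \<Longrightarrow> R i \<subseteq> Q \<Longrightarrow> Q = R i \<or> L i \<union> R i \<subseteq> Q"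
    and injL: "inj_on L J" and injR: "inj_on R J"
    and levL: "i \<in> J \<Longrightarrow> j \<in> J \<Longrightarrow> n i = n j \<Longrightarrow> t \<in> L i \<Longrightarrow> t \<in> L j \<Longrightarrow> i = j"
    and levR: "i \<in> J \<Longrightarrow> j \<in> J \<Longrightarrow> n i = n j \<Longrightarrow> t \<in> R i \<Longrightarrow> t \<in> R j \<Longrightarrow> i = j"
    and cardL: "i \<in> J \<Longrightarrow> real (card (L i)) = 2 powr of_int (n i)"
    and cardR: "i \<in> J \<Longrightarrow> real (card (R i)) = 2 powr of_int (n i)"
begin

lemma finD: "finite D"
proof -
  have "D \<subseteq> Pow X" using D_sub by blast
  then show ?thesis using finX finite_subset by blast
qed

lemma finite_mem: "A \<in> D \<Longrightarrow> finite A"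
  using D_sub finX finite_subset by blast

lemma swap: "dyadic_pairs D J R L n X"
  by unfold_locales
    (use finX finJ D_sub D_ne lam LD RD UD disj splitL splitR injL injR levL levR cardL cardR in
      \<open>auto simp: Un_commute Int_commute\<close>)

end

text \<open>\<open>U\<close> and \<open>S\<close> will be averages of u and \<sigma> over grid
  cells, \<open>r\<close> is p' and \<kappa> is K^(1/q). \<open>balance\<close> is what Hoelder
  leaves of u^(1/q) \<sigma>^(1/p') = 1 after averaging. The q-th root in \<open>char\<close> makes
  it invariant under exchanging \<open>U\<close>, \<open>q\<close>, \<open>L\<close> with
  \<open>S\<close>, \<open>r\<close>, \<open>R\<close>.\<close>

locale weighted_pairs = dyadic_pairs D J L R n X
  for D :: "'a set set" and J :: "'i set" and L R :: "'i \<Rightarrow> 'a set" and n :: "'i \<Rightarrow> int" and X :: "'a set" +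
  fixes U S :: "'a \<Rightarrow> real" and \<alpha> q r \<kappa> :: real
  assumes \<alpha>: "0 < \<alpha>" and q: "1 < q" and r: "1 < r" and qr: "1 / q + 1 / r = 1 - \<alpha>"
    and U: "t \<in> X \<Longrightarrow> 0 < U t" and S: "t \<in> X \<Longrightarrow> 0 < S t"
    and balance: "t \<in> X \<Longrightarrow> 1 \<le> U t powr (1 / q) * S t powr (1 / r)"
    and char: "i \<in> J \<Longrightarrow>
      sum U (L i) powr (1 / q) * sum S (R i) powr (1 / r) \<le> \<kappa> * (2 powr of_int (n i)) powr (1 - \<alpha>)"
    and \<kappa>: "0 < \<kappa>"
begin

lemma swap_weighted: "weighted_pairs D J R L n X S U \<alpha> r q \<kappa>"
proof -
  interpret sw: dyadic_pairs D J R L n X by (rule swap)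
  show ?thesis
    by unfold_locales (use \<alpha> q r qr U S balance char \<kappa> in \<open>auto simp: mult.commute add.commute\<close>)
qed

lemma sum_pos_mem: "A \<in> D \<Longrightarrow> 0 < sum U A" "A \<in> D \<Longrightarrow> 0 < sum S A"
  by (rule sum_pos; use U S D_sub[of A] D_ne[of A] finite_mem[of A] in blast)+

definition rho :: real where "rho = q * (1 - \<alpha>)"

lemma rho: "rho = 1 + q / r" "1 < rho" "\<alpha> < 1"
proof -
  show *: "rho = 1 + q / r" using q r by (simp add: rho_def qr[symmetric] field_simps)
  show "1 < rho" using q r by (simp add: *)
  then have "0 < q * (1 - \<alpha>)" unfolding rho_def by simp
  then show "\<alpha> < 1" using q by (simp add: zero_less_mult_iff)
qed

lemma hedberg_const_pos: "0 < hedberg_const \<alpha>"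
  using \<alpha> rho(3) by (rule hedberg_const_positive)

text \<open>The inner sum is the function h of the overview. The exponent \<open>rho\<close> in
  Doob's inequality is forced: A^(1 - \<alpha>) contains M^((q / r) (1 - \<alpha>)), whose r-th
  power is M^rho. After an r-th root the mass of \<open>Q\<close> has the exponent \<alpha> + 1 / r
  = 1 - 1 / q, the one dual to \<open>q\<close>.\<close>

lemma testing:
  assumes Q: "Q \<in> D" and K: "\<K> \<subseteq> J" "\<And>i. i \<in> \<K> \<Longrightarrow> L i \<union> R i \<subseteq> Q"
  shows "(\<Sum>t\<in>Q. S t * (\<Sum>i\<in>{i\<in>\<K>. t \<in> R i}. 2 powr ((\<alpha> - 1) * of_int (n i)) * sum U (L i)) powr r) \<le>
     (testing_const \<alpha> q r * \<kappa> powr rho) powr r * sum U Q powr (\<alpha> * r + 1)"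
proof -
  define DQ where "DQ = {A\<in>D. A \<subseteq> Q}"
  have DQ: "finite DQ" "laminar DQ" using finD lam laminar_subset[of D DQ] by (auto simp: DQ_def)
  define M where "M = wmax DQ S (\<lambda>t. 1 / S t)"
  define h where "h t = (\<Sum>i\<in>{i\<in>\<K>. t \<in> R i}. 2 powr ((\<alpha> - 1) * of_int (n i)) * sum U (L i))" for t
  have finK: "finite \<K>" using K finJ finite_subset by blast
  have QX: "Q \<subseteq> X" using D_sub Q by blast
  have UQ: "0 < sum U Q" using sum_pos_mem Q by blast
  have U_le: "sum U (L i) \<le> \<kappa> powr q * 2 powr of_int (n i) * M t powr (q / r)"
    if i: "i \<in> \<K>" "t \<in> R i" for i t
  proof -
    have iJ: "i \<in> J" using i K by blast
    have Up: "0 < sum U (L i)" and Sp: "0 < sum S (R i)" using sum_pos_mem LD RD iJ by auto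
    let ?N = "2 powr real_of_int (n i)"
    \<comment> \<open>Averaging 1 / S against \<open>S\<close> counts points, and R i has 2^(n i) of
      them. Hence \<open>char\<close> bounds the mass of L i by the maximal function at every point
      of R i.\<close>
    have avg: "wavg S (\<lambda>t. 1 / S t) (R i) = ?N / sum S (R i)"
    proof -
      have "(\<Sum>t\<in>R i. S t * (1 / S t)) = (\<Sum>t\<in>R i. 1)"
        using S D_sub[OF RD[OF iJ]] by (intro sum.cong) (auto simp: less_imp_neq[symmetric] dest!: subsetD)
      then show ?thesis using cardR[OF iJ] by (simp add: wavg_def)
    qed
    have "?N / sum S (R i) \<le> M t"
      unfolding M_def avg[symmetric] using i iJ RD K DQ(1) by (intro wavg_le_wmax) (auto simp: DQ_def)
    then have Mle: "(?N / sum S (R i)) powr (q / r) \<le> M t powr (q / r)"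
      using Sp q r by (intro powr_mono2) auto
    have "sum U (L i) = (sum U (L i) powr (1 / q)) powr q" using Up q by (simp add: powr_powr)
    also have "\<dots> \<le> (\<kappa> * ?N powr (1 - \<alpha>) / sum S (R i) powr (1 / r)) powr q"
      using char[OF iJ] Sp q by (intro powr_mono2) (auto simp: pos_le_divide_eq)
    also have "\<dots> = \<kappa> powr q * ?N * (?N / sum S (R i)) powr (q / r)"
    proof -
      have "(?N powr (1 - \<alpha>)) powr q = ?N * ?N powr (q / r)"
      proof -
        have "(?N powr (1 - \<alpha>)) powr q = ?N powr rho" by (simp add: powr_powr rho_def mult_ac)
        also have "\<dots> = ?N powr 1 * ?N powr (q / r)" by (simp only: rho(1) powr_add)
        finally show ?thesis by simp
      qed
      then show ?thesis using \<kappa> Sp by (simp add: powr_divide powr_mult powr_powr)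
    qed
    also have "\<dots> \<le> \<kappa> powr q * ?N * M t powr (q / r)" by (intro mult_left_mono Mle) auto
    finally show ?thesis .
  qed
  have h_le: "h t \<le> hedberg_const \<alpha> * (sum U Q powr \<alpha> * (\<kappa> powr q * M t powr (q / r)) powr (1 - \<alpha>))"
    if t: "t \<in> Q" for t
  proof (cases "{i\<in>\<K>. t \<in> R i} = {}")
    case True
    then have "h t = 0" unfolding h_def by (simp only: sum.empty)
    then show ?thesis using hedberg_const_pos by simp
  next
    case False
    let ?I = "{i\<in>\<K>. t \<in> R i}"
    define A where "A = \<kappa> powr q * M t powr (q / r)"
    have A: "0 < A"
    proof -
      obtain i where i: "i \<in> \<K>" "t \<in> R i" using False by blast
      then have "0 < sum U (L i)" using sum_pos_mem LD K by blast
      with U_le[OF i] have "0 < A * 2 powr of_int (n i)" by (simp add: A_def mult_ac)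
      then show ?thesis by (simp add: zero_less_mult_iff)
    qed
    \<comment> \<open>For fixed t there is at most one pair of each scale, so the sum can be indexed
      by scales, as \<open>sum_hedberg_le\<close> requires.\<close>
    have inj: "inj_on n ?I" using levR K by (auto simp: inj_on_def)
    define z where "z m = (\<Sum>i\<in>{i\<in>?I. n i = m}. 2 powr ((\<alpha> - 1) * of_int (n i)) * sum U (L i))" for m
    have z: "z (n i) = 2 powr ((\<alpha> - 1) * of_int (n i)) * sum U (L i)" if "i \<in> ?I" for i
    proof -
      have "{j\<in>?I. n j = n i} = {i}" using inj that by (auto simp: inj_on_def)
      then show ?thesis by (simp add: z_def)
    qed
    have "h t = (\<Sum>m\<in>n ` ?I. z m)"
      unfolding h_def by (subst sum.reindex[OF inj]) (auto intro!: sum.cong simp: z)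
    also have "\<dots> \<le> hedberg_const \<alpha> * (sum U Q powr \<alpha> * A powr (1 - \<alpha>))"
      unfolding hedberg_const_def
    proof (rule sum_hedberg_le)
      fix m assume "m \<in> n ` ?I"
      then obtain i where i: "i \<in> ?I" "m = n i" by auto
      have "sum U (L i) \<le> A * 2 powr of_int m" using U_le i by (simp add: A_def mult_ac)
      then have "z m \<le> 2 powr ((\<alpha> - 1) * of_int m) * (A * 2 powr of_int m)"
        unfolding i(2) z[OF i(1)] by (intro mult_left_mono) auto
      then show "z m \<le> A * 2 powr (\<alpha> * of_int m)" by (simp add: powr_add[symmetric] algebra_simps)
      have "sum U (L i) \<le> sum U Q"
        using i K finite_mem[OF Q] U QX by (intro sum_mono2) (auto intro!: less_imp_le dest: subsetD)
      then have "2 powr ((\<alpha> - 1) * of_int m) * sum U (L i) \<le> 2 powr ((\<alpha> - 1) * of_int m) * sum U Q"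
        by (intro mult_left_mono) auto
      then show "z m \<le> sum U Q * 2 powr ((\<alpha> - 1) * of_int m)"
        unfolding i(2) z[OF i(1)] by (simp add: mult.commute)
    qed (use finK \<alpha> rho A UQ in auto)
    finally show ?thesis by (simp add: A_def)
  qed
  define B where "B = hedberg_const \<alpha> powr r * sum U Q powr (\<alpha> * r) * \<kappa> powr (rho * r)"
  have B0: "0 \<le> B" by (simp add: B_def)
  have UL: "0 \<le> sum U (L i)" if "i \<in> \<K>" for i
    using sum_pos_mem(1)[OF LD[OF subsetD[OF K(1) that]]] by simp
  have h0: "0 \<le> h t" for t unfolding h_def
    by (rule sum_nonneg, rule mult_nonneg_nonneg) (use UL in auto)
  have "(\<Sum>t\<in>Q. S t * h t powr r) \<le> (\<Sum>t\<in>Q. B * (S t * M t powr rho))"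
  proof (rule sum_mono)
    fix t assume t: "t \<in> Q"
    have "h t powr r \<le> (hedberg_const \<alpha> * (sum U Q powr \<alpha> * (\<kappa> powr q * M t powr (q / r)) powr (1 - \<alpha>))) powr r"
      using h_le[OF t] h0 r by (intro powr_mono2) auto
    also have "\<dots> = hedberg_const \<alpha> powr r * (sum U Q powr (\<alpha> * r) *
        (\<kappa> powr (q * (1 - \<alpha>) * r) * M t powr (q / r * (1 - \<alpha>) * r)))"
      using hedberg_const_pos \<kappa> by (simp add: powr_mult powr_powr)
    also have "\<dots> = B * M t powr rho"
      using r by (simp add: B_def rho_def)
    finally have "S t * h t powr r \<le> S t * (B * M t powr rho)"
      using S t QX by (intro mult_left_mono) (auto intro: less_imp_le)
    then show "S t * h t powr r \<le> B * (S t * M t powr rho)" by (simp add: mult_ac)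
  qed
  also have "\<dots> = B * (\<Sum>t\<in>Q. S t * M t powr rho)" by (simp add: sum_distrib_left)
  also have "\<dots> \<le> B * ((rho / (rho - 1)) powr rho * (\<Sum>t\<in>Q. S t * (1 / S t) powr rho))"
    unfolding M_def using S QX Q
    by (intro mult_left_mono doob_maximal DQ finite_mem rho B0) (auto simp: DQ_def intro!: less_imp_le)
  also have "\<dots> \<le> B * ((rho / (rho - 1)) powr rho * sum U Q)"
  proof (intro mult_left_mono sum_mono)
    fix t assume "t \<in> Q"
    then have pos: "0 < S t" "0 < U t" and bal: "1 \<le> U t powr (1 / q) * S t powr (1 / r)"
      using S U balance QX by auto
    \<comment> \<open>Since 1 - rho = - q / r, \<open>balance\<close> bounds this power of S by U.
      So Doob's inequality returns the mass of \<open>Q\<close> under \<open>U\<close>.\<close>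
    have "S t * (1 / S t) powr rho = S t powr (1 - rho)"
      using pos by (simp add: powr_divide powr_diff)
    also have "\<dots> = (1 / S t powr (1 / r)) powr q"
      using pos by (simp add: rho(1) powr_minus_divide powr_divide powr_powr)
    also have "\<dots> \<le> (U t powr (1 / q)) powr q"
      using bal pos q by (intro powr_mono2) (auto simp: divide_le_eq)
    also have "\<dots> = U t" using pos q by (simp add: powr_powr)
    finally show "S t * (1 / S t) powr rho \<le> U t" .
  qed (use B0 in auto)
  also have "\<dots> = (testing_const \<alpha> q r * \<kappa> powr rho) powr r * sum U Q powr (\<alpha> * r + 1)"
  proof -
    have "(testing_const \<alpha> q r * \<kappa> powr rho) powr r =
        hedberg_const \<alpha> powr r * (rho / (rho - 1)) powr rho * \<kappa> powr (rho * r)"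
      using hedberg_const_pos r unfolding testing_const_def rho_def[symmetric] by (simp add: powr_mult powr_powr)
    then show ?thesis using UQ by (simp add: B_def powr_add)
  qed
  finally show ?thesis unfolding h_def .
qed

end

definition carleson_const :: "real \<Rightarrow> real" where
  "carleson_const p = (p / (p - 1)) powr p / (1 - 2 powr (- p))"

lemma carleson_const_pos: "1 < p \<Longrightarrow> 0 < carleson_const p"
  unfolding carleson_const_def
  using powr_less_mono[of "- p" 0 "2::real"] by (intro divide_pos_pos) auto

text \<open>Applied with \<open>\<zeta> i\<close> and \<open>\<eta> i\<close> the stopping keys of \<open>f\<close> and of \<open>g\<close> at the pair \<open>i\<close>.\<close>

lemma sum_fibre_le:
  fixes c :: "'b \<Rightarrow> real"
  assumes fin: "finite I" and c: "\<And>z. z \<in> \<zeta> ` I \<Longrightarrow> 0 \<le> c z"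
    and cand: "\<And>i. i \<in> I \<Longrightarrow> \<eta> i = a (\<zeta> i) \<or> \<eta> i = b (\<zeta> i)"
  shows "(\<Sum>y\<in>\<eta> ` I. \<Sum>z\<in>\<zeta> ` {i\<in>I. \<eta> i = y}. c z) \<le> 2 * (\<Sum>z\<in>\<zeta> ` I. c z)"
proof -
  have "(\<Sum>y\<in>\<eta> ` I. \<Sum>z\<in>\<zeta> ` {i\<in>I. \<eta> i = y}. c z) =
      (\<Sum>y\<in>\<eta> ` I. \<Sum>z\<in>\<zeta> ` I. if z \<in> \<zeta> ` {i\<in>I. \<eta> i = y} then c z else 0)"
    using fin by (intro sum.cong refl sum.mono_neutral_cong_left) auto
  also have "\<dots> = (\<Sum>z\<in>\<zeta> ` I. \<Sum>y\<in>\<eta> ` I. if z \<in> \<zeta> ` {i\<in>I. \<eta> i = y} then c z else 0)"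
    by (rule sum.swap)
  also have "\<dots> \<le> (\<Sum>z\<in>\<zeta> ` I. 2 * c z)"
  proof (rule sum_mono)
    fix z assume z: "z \<in> \<zeta> ` I"
    let ?Y = "{y\<in>\<eta> ` I. z \<in> \<zeta> ` {i\<in>I. \<eta> i = y}}"
    \<comment> \<open>A key \<open>z\<close> leaves only two choices for y, so in the exchanged
      double sum c z is counted at most twice.\<close>
    have "?Y \<subseteq> {a z, b z}"
    proof
      fix y assume "y \<in> ?Y"
      then obtain i where "i \<in> I" "\<eta> i = y" "\<zeta> i = z" by auto
      then show "y \<in> {a z, b z}" using cand[of i] by auto
    qed
    then have "card ?Y \<le> card {a z, b z}" by (intro card_mono) auto
    also have "\<dots> \<le> 2" by (simp add: card_insert_if)
    finally have "real (card ?Y) \<le> 2" by simp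
    then have "real (card ?Y) * c z \<le> 2 * c z" using c[OF z] by (intro mult_right_mono)
    moreover have "(\<Sum>y\<in>\<eta> ` I. if z \<in> \<zeta> ` {i\<in>I. \<eta> i = y} then c z else 0) = real (card ?Y) * c z"
      using fin by (simp add: sum.inter_filter[symmetric])
    ultimately show "(\<Sum>y\<in>\<eta> ` I. if z \<in> \<zeta> ` {i\<in>I. \<eta> i = y} then c z else 0) \<le> 2 * c z" by simp
  qed
  finally show ?thesis by (simp add: sum_distrib_left)
qed

section \<open>Pairs whose stopping sets are nested\<close>

context weighted_pairs
begin

abbreviation pair_term :: "('a \<Rightarrow> real) \<Rightarrow> ('a \<Rightarrow> real) \<Rightarrow> 'i \<Rightarrow> real" where
  "pair_term f g i \<equiv> 2 powr ((\<alpha> - 1) * of_int (n i)) * (\<Sum>t\<in>R i. S t * f t) * (\<Sum>t\<in>L i. U t * g t)"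

lemma sum_le_stopping:
  assumes A: "A \<in> D" and pos: "0 < ancestor_max D W f A" and W: "\<And>t. t \<in> X \<Longrightarrow> 0 < W t"
  shows "(\<Sum>t\<in>A. W t * f t) \<le> 2 * 2 powr of_int (stopping_level D W f A) * sum W A"
proof -
  have "0 < sum W A" using W D_sub[OF A] D_ne[OF A] finite_mem[OF A] by (intro sum_pos) auto
  moreover have "wavg W f A \<le> 2 * 2 powr of_int (stopping_level D W f A)"
    using wavg_le_ancestor_max[OF finD lam A, of A W f] stopping_level_bounds(2)[OF finD lam pos] by simp
  ultimately show ?thesis by (simp add: wavg_def divide_le_eq)
qed

text \<open>Pairs are grouped by the key y of \<open>g\<close>. Within a group the level of
  \<open>g\<close> is constant, and Hoelder with \<open>r\<close> and \<open>p\<close> separates the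
  function controlled by \<open>testing\<close> from the levels of \<open>f\<close>. A second
  Hoelder inequality sums over the groups. The 2 next to \<open>carleson_const p\<close> is there
  because a key of \<open>f\<close> belongs to at most two groups.\<close>

lemma nested_part:
  fixes f g :: "'a \<Rightarrow> real"
  defines "p \<equiv> r / (r - 1)" and "s \<equiv> q / (q - 1)"
  defines "\<eta> \<equiv> \<lambda>i. stopping_key D U g (L i)" and "\<zeta> \<equiv> \<lambda>i. stopping_key D S f (R i)"
  assumes f: "\<And>t. t \<in> X \<Longrightarrow> 0 \<le> f t" and g: "\<And>t. t \<in> X \<Longrightarrow> 0 \<le> g t"
    and K: "\<K> \<subseteq> J" "\<And>i. i \<in> \<K> \<Longrightarrow> 0 < ancestor_max D S f (R i) \<and> 0 < ancestor_max D U g (L i)"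
    and sub: "\<And>i. i \<in> \<K> \<Longrightarrow> L i \<union> R i \<subseteq> snd (\<eta> i)" "\<And>i. i \<in> \<K> \<Longrightarrow> snd (\<zeta> i) \<subseteq> snd (\<eta> i)"
  shows "(\<Sum>i\<in>\<K>. pair_term f g i) \<le>
     4 * testing_const \<alpha> q r * \<kappa> powr rho * (2 * carleson_const p) powr (1 / p) * carleson_const s powr (1 / s) *
     (\<Sum>t\<in>X. S t * f t powr p) powr (1 / p) * (\<Sum>t\<in>X. U t * g t powr s) powr (1 / s)"
proof -
  have ps: "1 < p" "1 < s" using q r by (auto simp: p_def s_def less_divide_eq)
  have inv_p: "1 / p = 1 - 1 / r" and inv_s: "1 / s = 1 - 1 / q"
    using q r by (auto simp: p_def s_def field_simps)
  have finK: "finite \<K>" using K finJ finite_subset by blast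
  have stopf: "stopping_set D S f (R i) \<in> D" "R i \<subseteq> stopping_set D S f (R i)"
    and stopg: "stopping_set D U g (L i) \<in> D" "L i \<subseteq> stopping_set D U g (L i)" if i: "i \<in> \<K>" for i
  proof -
    have iJ: "i \<in> J" using i K by blast
    show "stopping_set D S f (R i) \<in> D" "R i \<subseteq> stopping_set D S f (R i)"
      using stopping_set_mem[OF finD lam RD[OF iJ] D_ne[OF RD[OF iJ]]] K(2)[OF i] by auto
    show "stopping_set D U g (L i) \<in> D" "L i \<subseteq> stopping_set D U g (L i)"
      using stopping_set_mem[OF finD lam LD[OF iJ] D_ne[OF LD[OF iJ]]] K(2)[OF i] by auto
  qed
  define T where "T = testing_const \<alpha> q r * \<kappa> powr rho"
  have T0: "0 \<le> T" using hedberg_const_pos by (simp add: T_def testing_const_def)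
  define W where "W y = (\<Sum>z\<in>\<zeta> ` {i\<in>\<K>. \<eta> i = y}. 2 powr (p * of_int (fst z)) * sum S (snd z))" for y
  have S0: "0 \<le> sum S A" "0 \<le> sum U A" if "A \<in> D" for A
    using sum_pos_mem[OF that] by auto
  have c0: "0 \<le> 2 powr (p * of_int (fst z)) * sum S (snd z)" if "z \<in> \<zeta> ` \<K>" for z
    using that S0 stopf by (auto simp: \<zeta>_def stopping_key_def)
  have fibre: "(\<Sum>i\<in>{i\<in>\<K>. \<eta> i = y}. pair_term f g i) \<le>
      4 * T * ((2 powr (s * of_int (fst y)) * sum U (snd y)) powr (1 / s) * W y powr (1 / p))"
    if y: "y \<in> \<eta> ` \<K>" for y
  proof -
    define l where "l = fst y"
    define Q where "Q = snd y"
    let ?Ky = "{i\<in>\<K>. \<eta> i = y}"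
    have Q: "Q \<in> D" using y stopg by (auto simp: Q_def \<eta>_def stopping_key_def)
    have finQ: "finite Q" by (rule finite_mem[OF Q])
    have subQ: "L i \<union> R i \<subseteq> Q" "snd (\<zeta> i) \<subseteq> Q" if "i \<in> ?Ky" for i
      using that sub[of i] by (auto simp: Q_def)
    define h where "h t = (\<Sum>i\<in>{i\<in>?Ky. t \<in> R i}. 2 powr ((\<alpha> - 1) * of_int (n i)) * sum U (L i))" for t
    \<comment> \<open>Its p-th root dominates 2^level for every key of \<open>f\<close> attached to
      a pair with t in R i, and it no longer depends on the pair, so it can be taken out of the sum
      over i.\<close>
    define \<Phi> where "\<Phi> t = (\<Sum>z\<in>{z\<in>\<zeta> ` ?Ky. t \<in> snd z}. 2 powr (p * of_int (fst z)))" for t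
    have \<Phi>_ge: "2 powr of_int (fst (\<zeta> i)) \<le> \<Phi> t powr (1 / p)" if i: "i \<in> ?Ky" "t \<in> R i" for i t
    proof -
      have "\<zeta> i \<in> {z\<in>\<zeta> ` ?Ky. t \<in> snd z}" using i stopf by (auto simp: \<zeta>_def stopping_key_def)
      then have "2 powr (p * of_int (fst (\<zeta> i))) \<le> \<Phi> t"
        unfolding \<Phi>_def using finK by (intro member_le_sum) auto
      then have "(2 powr (p * of_int (fst (\<zeta> i)))) powr (1 / p) \<le> \<Phi> t powr (1 / p)"
        using ps by (intro powr_mono2) auto
      then show ?thesis using ps by (simp add: powr_powr)
    qed
    have h0: "0 \<le> h t" for t
      unfolding h_def by (rule sum_nonneg, rule mult_nonneg_nonneg) (use S0 LD K in auto)
    have \<Phi>0: "0 \<le> \<Phi> t" for t unfolding \<Phi>_def by (intro sum_nonneg) auto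
    have SQ: "0 < S t" "0 < U t" if "t \<in> Q" for t using that S U D_sub[OF Q] by auto
    have "(\<Sum>i\<in>?Ky. pair_term f g i) \<le>
        (\<Sum>i\<in>?Ky. 2 powr ((\<alpha> - 1) * of_int (n i)) * (2 * 2 powr of_int (fst (\<zeta> i)) * sum S (R i)) *
           (2 * 2 powr of_int l * sum U (L i)))"
    proof (rule sum_mono)
      fix i assume i: "i \<in> ?Ky"
      then have iK: "i \<in> \<K>" and iJ: "i \<in> J" using K by auto
      have "fst (\<eta> i) = l" using i by (simp add: l_def)
      then have 1: "(\<Sum>t\<in>L i. U t * g t) \<le> 2 * 2 powr of_int l * sum U (L i)"
        using sum_le_stopping[OF LD[OF iJ], of U g] K(2)[OF iK] U by (auto simp: \<eta>_def stopping_key_def)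
      have 2: "(\<Sum>t\<in>R i. S t * f t) \<le> 2 * 2 powr of_int (fst (\<zeta> i)) * sum S (R i)"
        using sum_le_stopping[OF RD[OF iJ], of S f] K(2)[OF iK] S by (auto simp: \<zeta>_def stopping_key_def)
      have UgSf: "0 \<le> U t * g t" "0 \<le> S t * f t" if "t \<in> X" for t
        using U[OF that] S[OF that] f[OF that] g[OF that] by simp_all
      have 3: "0 \<le> (\<Sum>t\<in>L i. U t * g t)" "0 \<le> (\<Sum>t\<in>R i. S t * f t)"
        using subQ[OF i] D_sub[OF Q] by (intro sum_nonneg UgSf; blast)+
      show "pair_term f g i \<le>
          2 powr ((\<alpha> - 1) * of_int (n i)) * (2 * 2 powr of_int (fst (\<zeta> i)) * sum S (R i)) *
           (2 * 2 powr of_int l * sum U (L i))"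
        using S0(1)[OF RD[OF iJ]] by (intro mult_mono 1 2 3) auto
    qed
    also have "\<dots> = 4 * 2 powr of_int l * (\<Sum>i\<in>?Ky. \<Sum>t\<in>R i. 
        S t * (2 powr ((\<alpha> - 1) * of_int (n i)) * sum U (L i) * 2 powr of_int (fst (\<zeta> i))))"
      by (simp add: sum_distrib_left sum_distrib_right mult_ac)
    also have "(\<Sum>i\<in>?Ky. \<Sum>t\<in>R i. 
        S t * (2 powr ((\<alpha> - 1) * of_int (n i)) * sum U (L i) * 2 powr of_int (fst (\<zeta> i)))) =
        (\<Sum>i\<in>?Ky. \<Sum>t\<in>{t\<in>Q. t \<in> R i}. 
        S t * (2 powr ((\<alpha> - 1) * of_int (n i)) * sum U (L i) * 2 powr of_int (fst (\<zeta> i))))"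
      using subQ by (intro sum.cong refl) auto
    also have "\<dots> = (\<Sum>t\<in>Q. \<Sum>i\<in>{i\<in>?Ky. t \<in> R i}.
        S t * (2 powr ((\<alpha> - 1) * of_int (n i)) * sum U (L i) * 2 powr of_int (fst (\<zeta> i))))"
      using finK finQ by (intro sum.swap_restrict) auto
    also have "\<dots> \<le> (\<Sum>t\<in>Q. \<Sum>i\<in>{i\<in>?Ky. t \<in> R i}.
        S t * (2 powr ((\<alpha> - 1) * of_int (n i)) * sum U (L i) * \<Phi> t powr (1 / p)))"
    proof (intro sum_mono mult_left_mono)
      fix t i assume t: "t \<in> Q" and i: "i \<in> {i\<in>?Ky. t \<in> R i}"
      show "2 powr of_int (fst (\<zeta> i)) \<le> \<Phi> t powr (1 / p)" using \<Phi>_ge i by blast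
      show "0 \<le> S t" using SQ t by (simp add: less_imp_le)
      show "0 \<le> 2 powr ((\<alpha> - 1) * of_int (n i)) * sum U (L i)" using S0 LD K i by auto
    qed
    also have "\<dots> = (\<Sum>t\<in>Q. S t * h t * \<Phi> t powr (1 / p))"
      by (simp add: h_def sum_distrib_left sum_distrib_right mult_ac)
    also have "\<dots> = (\<Sum>t\<in>Q. (S t * h t powr r) powr (1 / r) * (S t * \<Phi> t) powr (1 / p))"
    proof (intro sum.cong refl)
      fix t assume t: "t \<in> Q"
      have "S t = S t powr (1 / r) * S t powr (1 / p)"
        using SQ[OF t] by (simp add: powr_add[symmetric] inv_p)
      then show "S t * h t * \<Phi> t powr (1 / p) = (S t * h t powr r) powr (1 / r) * (S t * \<Phi> t) powr (1 / p)"
        using SQ[OF t] h0 \<Phi>0 r ps by (simp add: powr_mult powr_powr)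
    qed
    also have "\<dots> \<le> (\<Sum>t\<in>Q. S t * h t powr r) powr (1 / r) * (\<Sum>t\<in>Q. S t * \<Phi> t) powr (1 / p)"
      using SQ \<Phi>0 r ps finQ inv_p
      by (intro sum_powr_mult_powr_le mult_nonneg_nonneg) (auto intro: less_imp_le)
    also have "(\<Sum>t\<in>Q. S t * \<Phi> t) = W y"
    proof -
      have "W y = (\<Sum>z\<in>\<zeta> ` ?Ky. \<Sum>t\<in>{t\<in>Q. t \<in> snd z}. S t * 2 powr (p * of_int (fst z)))"
        unfolding W_def
      proof (rule sum.cong[OF refl])
        fix z assume "z \<in> \<zeta> ` ?Ky"
        then obtain i where "i \<in> ?Ky" "z = \<zeta> i" by blast
        then have "{t\<in>Q. t \<in> snd z} = snd z" using subQ(2)[of i] by blast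
        then show "2 powr (p * of_int (fst z)) * sum S (snd z) =
            (\<Sum>t\<in>{t\<in>Q. t \<in> snd z}. S t * 2 powr (p * of_int (fst z)))"
          by (simp add: sum_distrib_right mult.commute)
      qed
      also have "\<dots> = (\<Sum>t\<in>Q. \<Sum>z\<in>{z\<in>\<zeta> ` ?Ky. t \<in> snd z}. S t * 2 powr (p * of_int (fst z)))"
        using finK finQ by (intro sum.swap_restrict) auto
      finally show ?thesis by (simp add: \<Phi>_def sum_distrib_left)
    qed
    also have "(\<Sum>t\<in>Q. S t * h t powr r) powr (1 / r) \<le> (T powr r * sum U Q powr (\<alpha> * r + 1)) powr (1 / r)"
    proof (rule powr_mono2)
      show "(\<Sum>t\<in>Q. S t * h t powr r) \<le> T powr r * sum U Q powr (\<alpha> * r + 1)"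
        unfolding h_def T_def
      proof (rule testing[OF Q])
        show "?Ky \<subseteq> J" using K(1) by blast
      qed (rule subQ(1))
      show "0 \<le> (\<Sum>t\<in>Q. S t * h t powr r)"
        using SQ by (intro sum_nonneg mult_nonneg_nonneg) (auto intro: less_imp_le)
    qed (use r in auto)
    also have "(T powr r * sum U Q powr (\<alpha> * r + 1)) powr (1 / r) = T * sum U Q powr (1 / s)"
    proof -
      have "(\<alpha> * r + 1) * (1 / r) = 1 / s" using r qr by (simp add: inv_s field_simps)
      then show ?thesis using T0 r by (simp add: powr_mult powr_powr)
    qed
    finally have "(\<Sum>i\<in>?Ky. pair_term f g i) \<le>
        4 * 2 powr of_int l * (T * sum U Q powr (1 / s) * W y powr (1 / p))"
      by (simp add: mult_right_mono)
    also have "\<dots> = 4 * T * ((2 powr (s * of_int (fst y)) * sum U (snd y)) powr (1 / s) * W y powr (1 / p))"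
      using S0(2)[OF Q] ps by (simp add: powr_mult powr_powr l_def Q_def mult_ac)
    finally show ?thesis .
  qed
  have "(\<Sum>i\<in>\<K>. pair_term f g i) =
      (\<Sum>y\<in>\<eta> ` \<K>. \<Sum>i\<in>{i\<in>\<K>. \<eta> i = y}.
         pair_term f g i)"
    by (rule sum.image_gen[OF finK])
  also have "\<dots> \<le> (\<Sum>y\<in>\<eta> ` \<K>. 4 * T * ((2 powr (s * of_int (fst y)) * sum U (snd y)) powr (1 / s) * W y powr (1 / p)))"
    by (intro sum_mono fibre)
  also have "\<dots> = 4 * T * (\<Sum>y\<in>\<eta> ` \<K>. (2 powr (s * of_int (fst y)) * sum U (snd y)) powr (1 / s) * W y powr (1 / p))"
    by (simp add: sum_distrib_left)
  also have "\<dots> \<le> 4 * T * ((\<Sum>y\<in>\<eta> ` \<K>. 2 powr (s * of_int (fst y)) * sum U (snd y)) powr (1 / s) *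
      (\<Sum>y\<in>\<eta> ` \<K>. W y) powr (1 / p))"
  proof (intro mult_left_mono sum_powr_mult_powr_le)
    show "1 \<le> 1 / s + 1 / p" using qr \<alpha> by (simp add: inv_s inv_p)
    show "0 \<le> 2 powr (s * of_int (fst y)) * sum U (snd y)" if "y \<in> \<eta> ` \<K>" for y
      using that S0 stopg by (auto simp: \<eta>_def stopping_key_def)
    show "0 \<le> W y" for y unfolding W_def using c0 by (intro sum_nonneg) auto
  qed (use finK ps T0 in auto)
  also have "\<dots> \<le> 4 * T * ((carleson_const s * (\<Sum>t\<in>X. U t * g t powr s)) powr (1 / s) *
      (2 * (carleson_const p * (\<Sum>t\<in>X. S t * f t powr p))) powr (1 / p))"
  proof (intro mult_left_mono mult_mono powr_mono2)
    show "(\<Sum>y\<in>\<eta> ` \<K>. 2 powr (s * of_int (fst y)) * sum U (snd y)) \<le> carleson_const s * (\<Sum>t\<in>X. U t * g t powr s)"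
    proof -
      have "\<eta> ` \<K> = stopping_key D U g ` L ` \<K>" by (auto simp: \<eta>_def)
      then show ?thesis unfolding carleson_const_def
        using stopping_carleson[where S = U and f = g and \<A> = "L ` \<K>", OF finD lam finX D_sub D_ne U g ps(2)] LD K by auto
    qed
    show "(\<Sum>y\<in>\<eta> ` \<K>. W y) \<le> 2 * (carleson_const p * (\<Sum>t\<in>X. S t * f t powr p))"
    proof -
      \<comment> \<open>Let P be the stopping set of \<open>f\<close>. If P is larger than R i, it
        contains L i and lies inside the stopping set of \<open>g\<close>, so \<open>g\<close> has
        the same key at P as at L i. If P = R i, then \<open>injR\<close> makes \<open>V P\<close>
        the parent of this one pair, again between L i and the stopping set of \<open>g\<close>.
        These are the two candidates.\<close>
      define V where "V P = \<Union>{L j \<union> R j |j. j \<in> J \<and> R j = P}" for P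
      have "(\<Sum>y\<in>\<eta> ` \<K>. W y) \<le> 2 * (\<Sum>z\<in>\<zeta> ` \<K>. 2 powr (p * of_int (fst z)) * sum S (snd z))"
        unfolding W_def
      proof (rule sum_fibre_le[OF finK c0, where a = "\<lambda>z. stopping_key D U g (V (snd z))" and
            b = "\<lambda>z. stopping_key D U g (snd z)"])
        fix i assume i: "i \<in> \<K>"
        then have iJ: "i \<in> J" using K by blast
        note between = stopping_eq_between(1)[OF finD lam LD[OF iJ] D_ne[OF LD[OF iJ]], of U g]
        have "snd (\<zeta> i) \<in> D" "R i \<subseteq> snd (\<zeta> i)" using stopf[OF i] by (auto simp: \<zeta>_def stopping_key_def)
        then consider "snd (\<zeta> i) = R i" | "L i \<union> R i \<subseteq> snd (\<zeta> i)" using splitR[OF iJ] by blast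
        then show "\<eta> i = stopping_key D U g (V (snd (\<zeta> i))) \<or> \<eta> i = stopping_key D U g (snd (\<zeta> i))"
        proof cases
          case 1
          then have "V (snd (\<zeta> i)) = L i \<union> R i" using injR iJ by (auto simp: V_def dest: inj_onD)
          moreover have "\<eta> i = stopping_key D U g (L i \<union> R i)"
            unfolding \<eta>_def using between[of "L i \<union> R i"] K(2)[OF i] UD[OF iJ] sub(1)[OF i]
            by (simp add: \<eta>_def stopping_key_def)
          ultimately show ?thesis by simp
        next
          case 2
          then have "\<eta> i = stopping_key D U g (snd (\<zeta> i))"
            unfolding \<eta>_def using between[of "snd (\<zeta> i)"] K(2)[OF i] sub(2)[OF i] \<open>snd (\<zeta> i) \<in> D\<close>
            by (simp add: \<eta>_def stopping_key_def)
          then show ?thesis by simp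
        qed
      qed auto
      also have "\<zeta> ` \<K> = stopping_key D S f ` R ` \<K>" by (auto simp: \<zeta>_def)
      also have "(\<Sum>z\<in>stopping_key D S f ` R ` \<K>. 2 powr (p * of_int (fst z)) * sum S (snd z)) \<le>
          carleson_const p * (\<Sum>t\<in>X. S t * f t powr p)"
        unfolding carleson_const_def
        using stopping_carleson[where S = S and f = f and \<A> = "R ` \<K>", OF finD lam finX D_sub D_ne S f ps(1)] RD K by auto
      finally show ?thesis by simp
    qed
    show "0 \<le> (\<Sum>y\<in>\<eta> ` \<K>. 2 powr (s * of_int (fst y)) * sum U (snd y))"
      using S0 stopg by (intro sum_nonneg) (auto simp: \<eta>_def stopping_key_def)
    show "0 \<le> (\<Sum>y\<in>\<eta> ` \<K>. W y)" unfolding W_def using c0 by (intro sum_nonneg) auto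
  qed (use ps T0 in auto)
  also have "\<dots> = 4 * T * (carleson_const s powr (1 / s) * (\<Sum>t\<in>X. U t * g t powr s) powr (1 / s) *
      ((2 * carleson_const p) powr (1 / p) * (\<Sum>t\<in>X. S t * f t powr p) powr (1 / p)))"
  proof -
    have "0 \<le> (\<Sum>t\<in>X. U t * g t powr s)" "0 \<le> (\<Sum>t\<in>X. S t * f t powr p)"
      using U S by (auto intro!: sum_nonneg mult_nonneg_nonneg intro: less_imp_le)
    then show ?thesis
      using carleson_const_pos[OF ps(1)] carleson_const_pos[OF ps(2)]
      by (simp add: powr_mult mult.assoc[symmetric])
  qed
  finally show ?thesis by (simp add: T_def mult_ac)
qed

end

text \<open>The summand 1 pays for \<open>edge_part\<close>, the two testing constants for
  \<open>nested_part\<close> and its mirror image.\<close>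

definition dyadic_const :: "real \<Rightarrow> real \<Rightarrow> real \<Rightarrow> real" where
  "dyadic_const \<alpha> q r =
     4 * (1 + testing_const \<alpha> q r + testing_const \<alpha> r q) *
       (2 * carleson_const (r / (r - 1))) powr ((r - 1) / r) *
       (2 * carleson_const (q / (q - 1))) powr ((q - 1) / q)"

context weighted_pairs
begin

text \<open>When both stopping sets are the halves themselves, no larger interval is available for
  \<open>testing\<close>. But then distinct pairs have distinct keys, so \<open>char\<close> can be
  spent on each pair separately, and Hoelder with the two Carleson sums finishes.\<close>

lemma edge_part:
  fixes f g :: "'a \<Rightarrow> real"
  defines "p \<equiv> r / (r - 1)" and "s \<equiv> q / (q - 1)"
  assumes f: "\<And>t. t \<in> X \<Longrightarrow> 0 \<le> f t" and g: "\<And>t. t \<in> X \<Longrightarrow> 0 \<le> g t"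
    and K: "\<K> \<subseteq> J" "\<And>i. i \<in> \<K> \<Longrightarrow> 0 < ancestor_max D S f (R i) \<and> 0 < ancestor_max D U g (L i)"
    and edge: "\<And>i. i \<in> \<K> \<Longrightarrow> stopping_set D S f (R i) = R i \<and> stopping_set D U g (L i) = L i"
  shows "(\<Sum>i\<in>\<K>. pair_term f g i) \<le>
     4 * \<kappa> * carleson_const p powr (1 / p) * carleson_const s powr (1 / s) *
     (\<Sum>t\<in>X. S t * f t powr p) powr (1 / p) * (\<Sum>t\<in>X. U t * g t powr s) powr (1 / s)"
proof -
  have ps: "1 < p" "1 < s" using q r by (auto simp: p_def s_def less_divide_eq)
  have inv_p: "1 / p = 1 - 1 / r" and inv_s: "1 / s = 1 - 1 / q"
    using q r by (auto simp: p_def s_def field_simps)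
  have finK: "finite \<K>" using K finJ finite_subset by blast
  define F where "F i = 2 powr (p * of_int (stopping_level D S f (R i))) * sum S (R i)" for i
  define G where "G i = 2 powr (s * of_int (stopping_level D U g (L i))) * sum U (L i)" for i
  have SU: "0 < sum S (R i)" "0 < sum U (L i)" if "i \<in> \<K>" for i
    using sum_pos_mem(2)[OF RD[OF subsetD[OF K(1) that]]] sum_pos_mem(1)[OF LD[OF subsetD[OF K(1) that]]] by auto
  have FG0: "0 \<le> F i" "0 \<le> G i" if "i \<in> \<K>" for i
    using SU[OF that] by (auto simp: F_def G_def)
  have "(\<Sum>i\<in>\<K>. pair_term f g i) \<le>
      (\<Sum>i\<in>\<K>. 4 * \<kappa> * (F i powr (1 / p) * G i powr (1 / s)))"
  proof (rule sum_mono)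
    fix i assume i: "i \<in> \<K>"
    then have iJ: "i \<in> J" using K by auto
    let ?k = "2 powr real_of_int (stopping_level D S f (R i))"
    let ?l = "2 powr real_of_int (stopping_level D U g (L i))"
    have 1: "(\<Sum>t\<in>L i. U t * g t) \<le> 2 * ?l * sum U (L i)"
      using sum_le_stopping[OF LD[OF iJ], of U g] K(2)[OF i] U by auto
    have 2: "(\<Sum>t\<in>R i. S t * f t) \<le> 2 * ?k * sum S (R i)"
      using sum_le_stopping[OF RD[OF iJ], of S f] K(2)[OF i] S by auto
    have UgSf: "0 \<le> U t * g t" "0 \<le> S t * f t" if "t \<in> X" for t
      using U[OF that] S[OF that] f[OF that] g[OF that] by simp_all
    have 3: "0 \<le> (\<Sum>t\<in>L i. U t * g t)" "0 \<le> (\<Sum>t\<in>R i. S t * f t)"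
      using D_sub[OF LD[OF iJ]] D_sub[OF RD[OF iJ]] by (intro sum_nonneg UgSf; blast)+
    have "pair_term f g i \<le>
        2 powr ((\<alpha> - 1) * of_int (n i)) * (2 * ?k * sum S (R i)) * (2 * ?l * sum U (L i))"
      using SU[OF i] by (intro mult_mono 1 2 3) auto
    also have "\<dots> = 4 * (F i powr (1 / p) * G i powr (1 / s)) *
        (2 powr ((\<alpha> - 1) * of_int (n i)) * (sum U (L i) powr (1 / q) * sum S (R i) powr (1 / r)))"
    proof -
      have 1: "sum S (R i) = sum S (R i) powr (1 / p) * sum S (R i) powr (1 / r)"
        and 2: "sum U (L i) = sum U (L i) powr (1 / s) * sum U (L i) powr (1 / q)"
        using SU[OF i] by (simp_all add: powr_add[symmetric] inv_p inv_s)
      have "F i powr (1 / p) = ?k * sum S (R i) powr (1 / p)" "G i powr (1 / s) = ?l * sum U (L i) powr (1 / s)"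
        using SU[OF i] ps by (simp_all add: F_def G_def powr_mult powr_powr)
      then show ?thesis by (subst 1, subst 2) (simp add: mult_ac)
    qed
    also have "\<dots> \<le> 4 * (F i powr (1 / p) * G i powr (1 / s)) *
        (2 powr ((\<alpha> - 1) * of_int (n i)) * (\<kappa> * (2 powr of_int (n i)) powr (1 - \<alpha>)))"
      using char[OF iJ] by (intro mult_left_mono) auto
    also have "2 powr ((\<alpha> - 1) * of_int (n i)) * (\<kappa> * (2 powr of_int (n i)) powr (1 - \<alpha>)) = \<kappa>"
      by (simp add: powr_powr powr_add[symmetric] algebra_simps)
    finally show "pair_term f g i \<le>
        4 * \<kappa> * (F i powr (1 / p) * G i powr (1 / s))" by (simp add: mult_ac)
  qed
  also have "\<dots> = 4 * \<kappa> * (\<Sum>i\<in>\<K>. F i powr (1 / p) * G i powr (1 / s))"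
    by (simp add: sum_distrib_left)
  also have "\<dots> \<le> 4 * \<kappa> * ((\<Sum>i\<in>\<K>. F i) powr (1 / p) * (\<Sum>i\<in>\<K>. G i) powr (1 / s))"
  proof (intro mult_left_mono sum_powr_mult_powr_le)
    show "1 \<le> 1 / p + 1 / s" using qr \<alpha> by (simp add: inv_s inv_p)
  qed (use finK ps \<kappa> FG0 in auto)
  also have "\<dots> \<le> 4 * \<kappa> * ((carleson_const p * (\<Sum>t\<in>X. S t * f t powr p)) powr (1 / p) *
      (carleson_const s * (\<Sum>t\<in>X. U t * g t powr s)) powr (1 / s))"
  proof (intro mult_left_mono mult_mono powr_mono2)
    have "inj_on (\<lambda>i. stopping_key D S f (R i)) \<K>"
    proof (rule inj_onI)
      fix i j assume ij: "i \<in> \<K>" "j \<in> \<K>" "stopping_key D S f (R i) = stopping_key D S f (R j)"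
      then have "R i = R j" using edge[of i] edge[of j] by (simp add: stopping_key_def)
      then show "i = j" using inj_onD[OF injR] ij K(1) by blast
    qed
    then have "sum F \<K> = (\<Sum>z\<in>stopping_key D S f ` R ` \<K>. 2 powr (p * of_int (fst z)) * sum S (snd z))"
      unfolding image_image by (subst sum.reindex) (auto simp: F_def stopping_key_def edge intro!: sum.cong)
    also have "\<dots> \<le> carleson_const p * (\<Sum>t\<in>X. S t * f t powr p)"
      unfolding carleson_const_def
      using stopping_carleson[where S = S and f = f and \<A> = "R ` \<K>", OF finD lam finX D_sub D_ne S f ps(1)] RD K by auto
    finally show "sum F \<K> \<le> carleson_const p * (\<Sum>t\<in>X. S t * f t powr p)" .
    have "inj_on (\<lambda>i. stopping_key D U g (L i)) \<K>"
    proof (rule inj_onI)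
      fix i j assume ij: "i \<in> \<K>" "j \<in> \<K>" "stopping_key D U g (L i) = stopping_key D U g (L j)"
      then have "L i = L j" using edge[of i] edge[of j] by (simp add: stopping_key_def)
      then show "i = j" using inj_onD[OF injL] ij K(1) by blast
    qed
    then have "sum G \<K> = (\<Sum>z\<in>stopping_key D U g ` L ` \<K>. 2 powr (s * of_int (fst z)) * sum U (snd z))"
      unfolding image_image by (subst sum.reindex) (auto simp: G_def stopping_key_def edge intro!: sum.cong)
    also have "\<dots> \<le> carleson_const s * (\<Sum>t\<in>X. U t * g t powr s)"
      unfolding carleson_const_def
      using stopping_carleson[where S = U and f = g and \<A> = "L ` \<K>", OF finD lam finX D_sub D_ne U g ps(2)] LD K by auto
    finally show "sum G \<K> \<le> carleson_const s * (\<Sum>t\<in>X. U t * g t powr s)" .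
  qed (use ps \<kappa> FG0 in \<open>auto intro: sum_nonneg\<close>)
  also have "\<dots> = 4 * \<kappa> * (carleson_const p powr (1 / p) * (\<Sum>t\<in>X. S t * f t powr p) powr (1 / p) *
      (carleson_const s powr (1 / s) * (\<Sum>t\<in>X. U t * g t powr s) powr (1 / s)))"
  proof -
    have "0 \<le> (\<Sum>t\<in>X. U t * g t powr s)" "0 \<le> (\<Sum>t\<in>X. S t * f t powr p)"
      using U S by (auto intro!: sum_nonneg mult_nonneg_nonneg intro: less_imp_le)
    then show ?thesis
      using carleson_const_pos[OF ps(1)] carleson_const_pos[OF ps(2)]
      by (simp add: powr_mult mult.assoc[symmetric])
  qed
  finally show ?thesis by (simp add: mult_ac)
qed

theorem dyadic_bound:
  fixes f g :: "'a \<Rightarrow> real"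
  defines "p \<equiv> r / (r - 1)" and "s \<equiv> q / (q - 1)"
  assumes f: "\<And>t. t \<in> X \<Longrightarrow> 0 \<le> f t" and g: "\<And>t. t \<in> X \<Longrightarrow> 0 \<le> g t" and \<kappa>1: "1 \<le> \<kappa>"
  shows "(\<Sum>i\<in>J. pair_term f g i) \<le>
     dyadic_const \<alpha> q r * \<kappa> powr (max q r * (1 - \<alpha>)) *
     (\<Sum>t\<in>X. S t * f t powr p) powr (1 / p) * (\<Sum>t\<in>X. U t * g t powr s) powr (1 / s)"
proof -
  interpret sw: weighted_pairs D J R L n X S U \<alpha> r q \<kappa> by (rule swap_weighted)
  have ps: "1 < p" "1 < s" using q r by (auto simp: p_def s_def less_divide_eq)
  have inv: "1 / p = (r - 1) / r" "1 / s = (q - 1) / q" by (auto simp: p_def s_def)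
  define \<phi> where "\<phi> i = pair_term f g i" for i
  define N where "N = (\<Sum>t\<in>X. S t * f t powr p) powr (1 / p) * (\<Sum>t\<in>X. U t * g t powr s) powr (1 / s)"
  define B where "B = \<kappa> powr (max q r * (1 - \<alpha>))"
  define cp where "cp = carleson_const p powr (1 / p)"
  define cs where "cs = carleson_const s powr (1 / s)"
  define cp2 where "cp2 = (2 * carleson_const p) powr (1 / p)"
  define cs2 where "cs2 = (2 * carleson_const s) powr (1 / s)"
  have cmono: "cp \<le> cp2" "cs \<le> cs2" "0 \<le> cp" "0 \<le> cs" "0 \<le> cp2" "0 \<le> cs2"
    using carleson_const_pos[OF ps(1)] carleson_const_pos[OF ps(2)] ps
    by (auto simp: cp_def cp2_def cs_def cs2_def intro!: powr_mono2)
  have N0: "0 \<le> N" "0 \<le> B" by (auto simp: N_def B_def)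
  define P where "P i = stopping_set D S f (R i)" for i
  define Q where "Q i = stopping_set D U g (L i)" for i
  \<comment> \<open>Outside \<open>J'\<close> one of the largest averages is not positive and the
    stopping level has no meaning; there the term vanishes because \<open>f\<close> and
    \<open>g\<close> are nonnegative.\<close>
  define J' where "J' = {i\<in>J. 0 < ancestor_max D S f (R i) \<and> 0 < ancestor_max D U g (L i)}"
  define E where "E = {i\<in>J'. P i = R i \<and> Q i = L i}"
  define \<A> where "\<A> = {i\<in>J'. L i \<union> R i \<subseteq> Q i \<and> P i \<subseteq> Q i}"
  define \<B> where "\<B> = {i\<in>J'. L i \<union> R i \<subseteq> P i \<and> Q i \<subseteq> P i}"
  have "J' \<subseteq> J" by (auto simp: J'_def)
  have ints: "0 \<le> (\<Sum>t\<in>L i. U t * g t)" "0 \<le> (\<Sum>t\<in>R i. S t * f t)" if iJ: "i \<in> J" for i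
  proof -
    have UgSf: "0 \<le> U t * g t" "0 \<le> S t * f t" if "t \<in> X" for t
      using U[OF that] S[OF that] f[OF that] g[OF that] by simp_all
    show "0 \<le> (\<Sum>t\<in>L i. U t * g t)" "0 \<le> (\<Sum>t\<in>R i. S t * f t)"
      using D_sub[OF LD[OF iJ]] D_sub[OF RD[OF iJ]] by (intro sum_nonneg UgSf; blast)+
  qed
  have \<phi>0: "0 \<le> \<phi> i" if "i \<in> J" for i
    using ints[OF that] by (simp add: \<phi>_def)
  have zero: "\<phi> i = 0" if i: "i \<in> J - J'" for i
  proof -
    have iJ: "i \<in> J" using i by simp
    have "ancestor_max D S f (R i) \<le> 0 \<or> ancestor_max D U g (L i) \<le> 0" using i by (auto simp: J'_def)
    then have "wavg S f (R i) \<le> 0 \<or> wavg U g (L i) \<le> 0"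
      using wavg_le_ancestor_max[OF finD lam RD[OF iJ], of "R i" S f] wavg_le_ancestor_max[OF finD lam LD[OF iJ], of "L i" U g] by auto
    then have "(\<Sum>t\<in>R i. S t * f t) \<le> 0 \<or> (\<Sum>t\<in>L i. U t * g t) \<le> 0"
      using sum_pos_mem(2)[OF RD[OF iJ]] sum_pos_mem(1)[OF LD[OF iJ]] by (auto simp: wavg_def divide_le_0_iff)
    then show ?thesis using ints[OF iJ] by (auto simp: \<phi>_def)
  qed
  \<comment> \<open>A stopping set is the half itself or contains the parent. If only one contains
    the parent, it also contains the other stopping set, which is a half. If both do, they meet, and
    laminarity makes them comparable.\<close>
  have cover: "J' \<subseteq> E \<union> \<A> \<union> \<B>"
  proof
    fix i assume i: "i \<in> J'"
    then have iJ: "i \<in> J" by (simp add: J'_def)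
    have P: "P i \<in> D" "R i \<subseteq> P i" and Q: "Q i \<in> D" "L i \<subseteq> Q i"
      using stopping_set_mem[OF finD lam RD[OF iJ] D_ne[OF RD[OF iJ]], of S f]
        stopping_set_mem[OF finD lam LD[OF iJ] D_ne[OF LD[OF iJ]], of U g] i
      by (auto simp: P_def Q_def J'_def)
    have "P i = R i \<or> L i \<union> R i \<subseteq> P i" "Q i = L i \<or> L i \<union> R i \<subseteq> Q i"
      using splitR[OF iJ P] splitL[OF iJ Q] by auto
    moreover have "P i \<subseteq> Q i \<or> Q i \<subseteq> P i" if "L i \<union> R i \<subseteq> P i" "L i \<union> R i \<subseteq> Q i"
      using lam P(1) Q(1) that D_ne[OF LD[OF iJ]] unfolding laminar_def by blast
    ultimately show "i \<in> E \<union> \<A> \<union> \<B>" using i by (auto simp: E_def \<A>_def \<B>_def)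
  qed
  \<comment> \<open>This is where 1 \<le> \<kappa> is needed: the exponents 1, \<open>rho\<close>
    and its mirror image are all raised to the largest one.\<close>
  have \<kappa>_le: "\<kappa> \<le> B" "\<kappa> powr rho \<le> B" "\<kappa> powr sw.rho \<le> B"
  proof -
    have m: "rho \<le> max q r * (1 - \<alpha>)" "sw.rho \<le> max q r * (1 - \<alpha>)"
      using rho(3) by (auto simp: rho_def sw.rho_def intro!: mult_right_mono)
    show "\<kappa> powr rho \<le> B" "\<kappa> powr sw.rho \<le> B" unfolding B_def using \<kappa>1 m by (auto intro: powr_mono)
    have "\<kappa> powr 1 \<le> B" unfolding B_def using \<kappa>1 m rho(2) by (intro powr_mono) auto
    then show "\<kappa> \<le> B" using \<kappa>1 by simp
  qed
  have tc: "0 \<le> testing_const \<alpha> q r" "0 \<le> testing_const \<alpha> r q"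
    using hedberg_const_pos by (auto simp: testing_const_def)
  have "(\<Sum>i\<in>E. \<phi> i) \<le> 4 * \<kappa> * cp * cs * N"
  proof -
    have "(\<Sum>i\<in>E. \<phi> i) \<le> 4 * \<kappa> * carleson_const p powr (1 / p) * carleson_const s powr (1 / s) *
        (\<Sum>t\<in>X. S t * f t powr p) powr (1 / p) * (\<Sum>t\<in>X. U t * g t powr s) powr (1 / s)"
      unfolding \<phi>_def p_def s_def
      by (rule edge_part) (use f g in \<open>auto simp: E_def J'_def P_def Q_def\<close>)
    then show ?thesis by (simp add: N_def cp_def cs_def mult_ac)
  qed
  also have "\<dots> \<le> 4 * B * cp2 * cs2 * N"
    using cmono N0 \<kappa>_le \<kappa> by (intro mult_mono mult_nonneg_nonneg) auto
  finally have sumE: "(\<Sum>i\<in>E. \<phi> i) \<le> 4 * B * cp2 * cs2 * N" .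
  have "(\<Sum>i\<in>\<A>. \<phi> i) \<le> 4 * testing_const \<alpha> q r * \<kappa> powr rho * cp2 * cs * N"
  proof -
    have "(\<Sum>i\<in>\<A>. \<phi> i) \<le> 4 * testing_const \<alpha> q r * \<kappa> powr rho * (2 * carleson_const p) powr (1 / p) *
        carleson_const s powr (1 / s) * (\<Sum>t\<in>X. S t * f t powr p) powr (1 / p) * (\<Sum>t\<in>X. U t * g t powr s) powr (1 / s)"
      unfolding \<phi>_def p_def s_def
      by (rule nested_part) (use f g in \<open>auto simp: \<A>_def J'_def P_def Q_def stopping_key_def\<close>)
    then show ?thesis by (simp add: N_def cp2_def cs_def mult_ac)
  qed
  also have "\<dots> \<le> 4 * testing_const \<alpha> q r * B * cp2 * cs2 * N"
    using cmono N0 \<kappa>_le tc by (intro mult_mono mult_nonneg_nonneg) auto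
  finally have sumA: "(\<Sum>i\<in>\<A>. \<phi> i) \<le> 4 * testing_const \<alpha> q r * B * cp2 * cs2 * N" .
  have "(\<Sum>i\<in>\<B>. \<phi> i) \<le> 4 * testing_const \<alpha> r q * \<kappa> powr sw.rho * cs2 * cp * N"
  proof -
    have "(\<Sum>i\<in>\<B>. 2 powr ((\<alpha> - 1) * of_int (n i)) * (\<Sum>t\<in>L i. U t * g t) * (\<Sum>t\<in>R i. S t * f t)) \<le>
        4 * testing_const \<alpha> r q * \<kappa> powr sw.rho * (2 * carleson_const s) powr (1 / s) *
        carleson_const p powr (1 / p) * (\<Sum>t\<in>X. U t * g t powr s) powr (1 / s) * (\<Sum>t\<in>X. S t * f t powr p) powr (1 / p)"
      unfolding p_def s_def
      by (rule sw.nested_part) (use f g in \<open>auto simp: \<B>_def J'_def P_def Q_def stopping_key_def\<close>)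
    then show ?thesis by (simp add: N_def \<phi>_def cs2_def cp_def mult_ac)
  qed
  also have "\<dots> \<le> 4 * testing_const \<alpha> r q * B * cs2 * cp2 * N"
    using cmono N0 \<kappa>_le tc by (intro mult_mono mult_nonneg_nonneg) auto
  finally have sumB: "(\<Sum>i\<in>\<B>. \<phi> i) \<le> 4 * testing_const \<alpha> r q * B * cs2 * cp2 * N" .
  have sub: "E \<subseteq> J" "\<A> \<subseteq> J" "\<B> \<subseteq> J" by (auto simp: E_def \<A>_def \<B>_def J'_def)
  have fin: "finite E" "finite \<A>" "finite \<B>" using sub finJ finite_subset by blast+
  have un: "sum \<phi> (A \<union> B) \<le> sum \<phi> A + sum \<phi> B" if "finite A" "finite B" "A \<subseteq> J" for A B
  proof -
    have "0 \<le> sum \<phi> (A \<inter> B)" using that \<phi>0 by (intro sum_nonneg) auto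
    then show ?thesis using sum.union_inter[OF that(1,2), of \<phi>] by linarith
  qed
  have "(\<Sum>i\<in>J. \<phi> i) = (\<Sum>i\<in>J'. \<phi> i)"
    using finJ \<open>J' \<subseteq> J\<close> zero by (intro sum.mono_neutral_right) auto
  also have "\<dots> \<le> (\<Sum>i\<in>E \<union> \<A> \<union> \<B>. \<phi> i)"
    using cover fin sub \<phi>0 by (intro sum_mono2) auto
  also have "\<dots> \<le> (\<Sum>i\<in>E \<union> \<A>. \<phi> i) + (\<Sum>i\<in>\<B>. \<phi> i)"
    by (rule un) (use fin sub in auto)
  also have "(\<Sum>i\<in>E \<union> \<A>. \<phi> i) \<le> (\<Sum>i\<in>E. \<phi> i) + (\<Sum>i\<in>\<A>. \<phi> i)"
    by (rule un) (use fin sub in auto)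
  finally have "(\<Sum>i\<in>J. \<phi> i) \<le> (4 * B * cp2 * cs2 * N + 4 * testing_const \<alpha> q r * B * cp2 * cs2 * N)
      + 4 * testing_const \<alpha> r q * B * cs2 * cp2 * N"
    using sumE sumA sumB by linarith
  also have "\<dots> = 4 * (1 + testing_const \<alpha> q r + testing_const \<alpha> r q) * cp2 * cs2 * B * N"
    by (simp add: algebra_simps)
  finally show ?thesis
    by (simp add: \<phi>_def N_def B_def cp2_def cs2_def dyadic_const_def inv p_def[symmetric] s_def[symmetric] mult_ac)
qed

end

subsection \<open>Dyadic intervals of integers\<close>

definition dyad :: "nat \<Rightarrow> int \<Rightarrow> int set" where
  "dyad m k = {t. t div 2 ^ m = k}"

lemma dyad_eq: "dyad m k = {k * 2 ^ m..<k * 2 ^ m + 2 ^ m}"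
proof -
  have "t div 2 ^ m = k \<longleftrightarrow> k * 2 ^ m \<le> t \<and> t < k * 2 ^ m + 2 ^ m" for t :: int
  proof
    assume "t div 2 ^ m = k"
    then have "t = k * 2 ^ m + t mod 2 ^ m" by (metis div_mult_mod_eq)
    moreover have "0 \<le> t mod 2 ^ m" "t mod 2 ^ m < 2 ^ m" by auto
    ultimately show "k * 2 ^ m \<le> t \<and> t < k * 2 ^ m + 2 ^ m" by linarith
  next
    assume t: "k * 2 ^ m \<le> t \<and> t < k * 2 ^ m + 2 ^ m"
    have "(t - k * 2 ^ m + k * 2 ^ m) div 2 ^ m = k + (t - k * 2 ^ m) div 2 ^ m"
      by (rule div_mult_self1) simp
    moreover have "(t - k * 2 ^ m) div 2 ^ m = 0"
      by (rule div_pos_pos_trivial) (use t in linarith)+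
    ultimately show "t div 2 ^ m = k" by simp
  qed
  then show ?thesis
    unfolding dyad_def by (intro set_eqI) (simp only: mem_Collect_eq atLeastLessThan_iff)
qed

lemma finite_dyad: "finite (dyad m k)" and card_dyad: "card (dyad m k) = 2 ^ m"
  and dyad_nonempty: "dyad m k \<noteq> {}"
proof -
  have "(1::int) \<le> 2 ^ m" by simp
  then show "finite (dyad m k)" "dyad m k \<noteq> {}" by (auto simp: dyad_eq simp del: one_le_power)
  have "nat (2 ^ m) = 2 ^ m" by (simp add: nat_power_eq)
  then show "card (dyad m k) = 2 ^ m" by (simp add: dyad_eq)
qed

lemma dyad_subset:
  assumes "m \<le> m'" and "t \<in> dyad m k" and "t \<in> dyad m' k'"
  shows "dyad m k \<subseteq> dyad m' k'"
proof
  have div: "u div 2 ^ m' = u div 2 ^ m div 2 ^ (m' - m)" for u :: int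
    using assms(1) by (simp add: zdiv_zmult2_eq[symmetric] power_add[symmetric])
  fix u assume "u \<in> dyad m k"
  then have "u div 2 ^ m = t div 2 ^ m" using assms by (simp add: dyad_def)
  then show "u \<in> dyad m' k'" using assms by (simp add: dyad_def div)
qed

lemma dyad_Suc: "dyad (Suc m) k = dyad m (2 * k) \<union> dyad m (2 * k + 1)"
proof -
  have "t div 2 ^ Suc m = t div 2 ^ m div 2" for t :: int
    by (simp add: zdiv_zmult2_eq[symmetric] mult.commute)
  then show ?thesis unfolding dyad_def by auto
qed

lemma dyad_inj:
  assumes "dyad m k = dyad m' k'" shows "m = m' \<and> k = k'"
proof -
  have "(2::nat) ^ m = 2 ^ m'" using card_dyad[of m k] card_dyad[of m' k'] assms by simp
  then have "m = m'" by simp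
  moreover obtain t where "t \<in> dyad m k" using dyad_nonempty[of m k] by blast
  ultimately show ?thesis using assms by (auto simp: dyad_def)
qed

definition dyads :: "nat \<Rightarrow> int set set" where
  "dyads l = {A. \<exists>m k. A = dyad m k \<and> m \<le> l \<and> A \<subseteq> {0..<2 ^ l}}"

text \<open>A pair is indexed by its parent: the two halves of \<open>dyad (Suc m) k\<close> are
  \<open>dyad m (2 * k)\<close> and \<open>dyad m (2 * k + 1)\<close>.\<close>

definition dyad_pairs :: "nat \<Rightarrow> (nat \<times> int) set" where
  "dyad_pairs l = {(m, k). m < l \<and> dyad (Suc m) k \<subseteq> {0..<2 ^ l}}"

lemma finite_dyad_pairs: "finite (dyad_pairs l)"
proof (rule finite_subset)
  show "dyad_pairs l \<subseteq> {..<l} \<times> {0..<2 ^ l}"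
  proof (safe, goal_cases)
    case (1 m k)
    then show ?case by (simp add: dyad_pairs_def)
  next
    case (2 m k)
    have "k * 2 ^ Suc m \<in> dyad (Suc m) k" by (simp add: dyad_def)
    then have "k * 2 ^ Suc m \<in> {0..<2 ^ l}" using 2 by (auto simp: dyad_pairs_def)
    then have "0 \<le> k * 2 ^ Suc m" "k * 2 ^ Suc m < 2 ^ l" by auto
    then have "0 \<le> k" by (simp add: zero_le_mult_iff)
    moreover have "k * 1 \<le> k * 2 ^ Suc m" using \<open>0 \<le> k\<close> by (intro mult_left_mono one_le_power) auto
    ultimately show ?case using \<open>k * 2 ^ Suc m < 2 ^ l\<close> by auto
  qed
qed simp

interpretation dyad: dyadic_pairs "dyads l" "dyad_pairs l"
  "\<lambda>(m, k). dyad m (2 * k)" "\<lambda>(m, k). dyad m (2 * k + 1)" "\<lambda>(m, k). int m" "{0..<2 ^ l}" for l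
proof
  have split: "Q = dyad m j \<or> dyad (Suc m) k \<subseteq> Q"
    if "Q \<in> dyads l" "dyad m j \<subseteq> Q" "dyad m j \<subseteq> dyad (Suc m) k" for Q m j k
  proof -
    obtain m' k' where Q: "Q = dyad m' k'" using \<open>Q \<in> dyads l\<close> by (auto simp: dyads_def)
    obtain t where t: "t \<in> dyad m j" using dyad_nonempty[of m j] by blast
    have "(2::nat) ^ m \<le> 2 ^ m'"
      using card_mono[OF finite_dyad that(2)[unfolded Q]] by (simp add: card_dyad)
    then have "m \<le> m'" by simp
    then consider "m' = m" | "Suc m \<le> m'" by linarith
    then show ?thesis
    proof cases
      case 1
      then show ?thesis using t that(2) Q by (auto simp: dyad_def)
    next
      case 2
      then show ?thesis using dyad_subset[OF 2] t that Q by blast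
    qed
  qed
  show "finite {0..<2 ^ l :: int}" by simp
  show "finite (dyad_pairs l)" by (rule finite_dyad_pairs)
  show "A \<subseteq> {0..<2 ^ l}" if "A \<in> dyads l" for A using that by (auto simp: dyads_def)
  show "A \<noteq> {}" if "A \<in> dyads l" for A using that dyad_nonempty by (auto simp: dyads_def)
  show "laminar (dyads l)"
  proof -
    have "dyad m k \<subseteq> dyad m' k' \<or> dyad m' k' \<subseteq> dyad m k \<or> dyad m k \<inter> dyad m' k' = {}" for m m' k k'
    proof (cases "dyad m k \<inter> dyad m' k' = {}")
      case False
      then obtain t where "t \<in> dyad m k" "t \<in> dyad m' k'" by blast
      then show ?thesis using dyad_subset[of m m' t k k'] dyad_subset[of m' m t k' k] by (cases "m \<le> m'") auto
    qed simp
    then show ?thesis unfolding laminar_def dyads_def by blast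
  qed
  fix i assume i: "i \<in> dyad_pairs l"
  obtain m k where mk: "i = (m, k)" by (cases i)
  have ml: "m < l" "dyad (Suc m) k \<subseteq> {0..<2 ^ l}" using i by (auto simp: mk dyad_pairs_def)
  show "(case i of (m, k) \<Rightarrow> dyad m (2 * k)) \<in> dyads l"
    using ml unfolding mk dyad_Suc by (auto simp: dyads_def intro!: exI[of _ m])
  show "(case i of (m, k) \<Rightarrow> dyad m (2 * k + 1)) \<in> dyads l"
    using ml unfolding mk dyad_Suc by (auto simp: dyads_def intro!: exI[of _ m])
  show "(case i of (m, k) \<Rightarrow> dyad m (2 * k)) \<union> (case i of (m, k) \<Rightarrow> dyad m (2 * k + 1)) \<in> dyads l"
    using ml unfolding mk prod.case dyad_Suc[symmetric] by (auto simp: dyads_def intro!: exI[of _ "Suc m"])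
  show "(case i of (m, k) \<Rightarrow> dyad m (2 * k)) \<inter> (case i of (m, k) \<Rightarrow> dyad m (2 * k + 1)) = {}"
    by (auto simp: mk dyad_def)
  show "Q = (case i of (m, k) \<Rightarrow> dyad m (2 * k)) \<or>
      (case i of (m, k) \<Rightarrow> dyad m (2 * k)) \<union> (case i of (m, k) \<Rightarrow> dyad m (2 * k + 1)) \<subseteq> Q"
    if "Q \<in> dyads l" "(case i of (m, k) \<Rightarrow> dyad m (2 * k)) \<subseteq> Q" for Q
    using split[of Q m "2 * k" k] that unfolding mk prod.case dyad_Suc by blast
  show "Q = (case i of (m, k) \<Rightarrow> dyad m (2 * k + 1)) \<or>
      (case i of (m, k) \<Rightarrow> dyad m (2 * k)) \<union> (case i of (m, k) \<Rightarrow> dyad m (2 * k + 1)) \<subseteq> Q"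
    if "Q \<in> dyads l" "(case i of (m, k) \<Rightarrow> dyad m (2 * k + 1)) \<subseteq> Q" for Q
    using split[of Q m "2 * k + 1" k] that unfolding mk prod.case dyad_Suc by blast
  show "real (card (case i of (m, k) \<Rightarrow> dyad m (2 * k))) = 2 powr of_int (case i of (m, k) \<Rightarrow> int m)"
    "real (card (case i of (m, k) \<Rightarrow> dyad m (2 * k + 1))) = 2 powr of_int (case i of (m, k) \<Rightarrow> int m)"
    by (auto simp: mk card_dyad powr_realpow)
next
  show "inj_on (\<lambda>(m, k). dyad m (2 * k)) (dyad_pairs l)"
    "inj_on (\<lambda>(m, k). dyad m (2 * k + 1)) (dyad_pairs l)"
    by (auto simp: inj_on_def dest!: dyad_inj)
qed (auto simp: dyad_def)

text \<open>The smallest dyadic block containing both points has them in different halves, and i < j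
  decides which point is on the left. The given \<open>e\<close> only serves to bound the size of
  that block.\<close>

lemma dyad_pair_exists:
  assumes ij: "0 \<le> i" "i < j" "j < 2 ^ l" and e: "i div 2 ^ e = j div 2 ^ e"
  obtains m k where "(m, k) \<in> dyad_pairs l" "i \<in> dyad m (2 * k)" "j \<in> dyad m (2 * k + 1)" "m < e"
proof -
  define e0 where "e0 = (LEAST e. i div 2 ^ e = j div 2 ^ e)"
  have e0: "i div 2 ^ e0 = j div 2 ^ e0" unfolding e0_def by (rule LeastI[of _ e]) (rule e)
  have "i div 2 ^ l = j div 2 ^ l" using ij by simp
  then have "e0 \<le> l" "e0 \<le> e" unfolding e0_def using e by (auto intro: Least_le)
  have "e0 \<noteq> 0" using e0 ij by (cases e0) auto
  then obtain m where m: "e0 = Suc m" by (cases e0) auto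
  have ne: "i div 2 ^ m \<noteq> j div 2 ^ m" using not_less_Least[of m "\<lambda>e. i div 2 ^ e = j div 2 ^ e"] m e0_def by simp
  define k where "k = i div 2 ^ Suc m"
  have mem: "i \<in> dyad (Suc m) k" "j \<in> dyad (Suc m) k" using e0 m by (auto simp: dyad_def k_def)
  have "i div 2 ^ m \<le> j div 2 ^ m" using ij by (intro zdiv_mono1) auto
  then have "i \<in> dyad m (2 * k)" "j \<in> dyad m (2 * k + 1)"
    using mem ne unfolding dyad_Suc by (auto simp: dyad_def)
  moreover have "dyad (Suc m) k \<subseteq> dyad l 0"
    using ij \<open>e0 \<le> l\<close> m mem by (intro dyad_subset[of "Suc m" l i]) (auto simp: dyad_def)
  then have "(m, k) \<in> dyad_pairs l" using \<open>e0 \<le> l\<close> m by (auto simp: dyad_pairs_def dyad_eq[of l 0])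
  ultimately show ?thesis using that \<open>e0 \<le> e\<close> m by auto
qed

text \<open>
  If both grids separated \<open>i\<close> and \<open>j\<close> at scale \<open>2 ^ e\<close>, then \<open>s\<close> would be within \<open>j - i - 1\<close> of a multiple
  of \<open>2 ^ e\<close>, which \<open>3 * s \<equiv> - 1\<close> excludes.
\<close>

lemma one_third_shift:
  fixes i j s :: int
  assumes s: "3 * s + 1 = 2 ^ l" and el: "e \<le> l" and ij: "i < j" and d: "3 * (j - i) \<le> 2 ^ e"
  shows "i div 2 ^ e = j div 2 ^ e \<or> (i + s) div 2 ^ e = (j + s) div 2 ^ e"
proof (rule ccontr)
  assume neg: "\<not> ?thesis"
  \<comment> \<open>If u and v lie in different blocks, the block of v starts after u, so the offset
    of v in it is at most v - u - 1.\<close>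
  have mod_less: "v mod 2 ^ e \<le> v - u - 1" if "u < v" "u div 2 ^ e \<noteq> v div 2 ^ e" for u v :: int
  proof -
    have "u div 2 ^ e \<le> v div 2 ^ e" using that by (intro zdiv_mono1) auto
    then have "u div 2 ^ e + 1 \<le> v div 2 ^ e" using that by linarith
    then have "(u div 2 ^ e + 1) * 2 ^ e \<le> v div 2 ^ e * 2 ^ e" by (intro mult_right_mono) auto
    then have "u div 2 ^ e * 2 ^ e + 2 ^ e \<le> v div 2 ^ e * 2 ^ e" by (simp add: distrib_right)
    moreover have "u div 2 ^ e * 2 ^ e + u mod 2 ^ e = u" "v div 2 ^ e * 2 ^ e + v mod 2 ^ e = v" by (rule div_mult_mod_eq)+
    moreover have "u mod 2 ^ e < 2 ^ e" by simp
    ultimately show ?thesis by linarith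
  qed
  define a where "a = j mod 2 ^ e"
  define b where "b = (j + s) mod 2 ^ e"
  have a: "0 \<le> a" "a \<le> j - i - 1" using mod_less[of i j] ij neg by (auto simp: a_def)
  have b: "0 \<le> b" "b \<le> j - i - 1" using mod_less[of "i + s" "j + s"] ij neg by (auto simp: b_def)
  have "(2::int) ^ e dvd (j + s) - b" "(2::int) ^ e dvd j - a"
    by (auto simp: a_def b_def minus_mod_eq_mult_div)
  then have "(2::int) ^ e dvd 3 * (((j + s) - b) - (j - a))" by (rule dvd_mult[OF dvd_diff])
  moreover have "(2::int) ^ e dvd 3 * s + 1" unfolding s using el by (simp add: le_imp_power_dvd)
  ultimately have "(2::int) ^ e dvd (3 * s + 1) - 3 * (((j + s) - b) - (j - a))" by (rule dvd_diff[rotated])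
  then have "(2::int) ^ e dvd 3 * (b - a) + 1" by (simp add: algebra_simps)
  \<comment> \<open>A multiple of 2^e that is nonzero, being 1 modulo 3, and, by the bounds on
    \<open>a\<close> and \<open>b\<close>, smaller than 2^e in absolute value: the
    contradiction.\<close>
  moreover have "3 * (b - a) + 1 \<noteq> 0" by arith
  ultimately have "\<bar>2 ^ e :: int\<bar> \<le> \<bar>3 * (b - a) + 1\<bar>" by (intro dvd_imp_le_int)
  moreover have "3 * (b - a) + 1 < P" "- (3 * (b - a) + 1) < P" if "3 * (j - i) \<le> P" for P
    using a b that by (simp_all add: algebra_simps)
  note this[OF d]
  ultimately show False by simp
qed

text \<open>The least e with 3 (j - i) <= 2^e satisfies 2^e < 6 (j - i). By
  \<open>one_third_shift\<close> the points share a block of length 2^e in one of the grids, so some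
  pair with 2^m <= 3 (j - i) separates them, and the factor 3 absorbs 3^(1 - \<alpha>). If e exceeds
  l, the whole interval of length 2^l serves instead.\<close>

lemma dyadic_kernel_bound:
  fixes i j s :: int and \<alpha> :: real and l :: nat
  defines "w \<equiv> \<lambda>u v. (\<Sum>(m, k)\<in>dyad_pairs l.
      if u \<in> dyad m (2 * k) \<and> v \<in> dyad m (2 * k + 1) then 2 powr ((\<alpha> - 1) * real m) else 0)"
  assumes \<alpha>: "0 < \<alpha>" "\<alpha> < 1" and s: "3 * s + 1 = 2 ^ l"
    and ij: "0 \<le> i" "i < j" "j + s < 2 ^ l"
  shows "of_int (j - i) powr (\<alpha> - 1) \<le> 3 * (w i j + w (i + s) (j + s))"
proof -
  have "(0::int) < 2 ^ l" by simp
  then have s0: "0 \<le> s" using s by linarith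
  have w0: "0 \<le> w u v" for u v unfolding w_def by (intro sum_nonneg) auto
  have w_ge: "of_int (j - i) powr (\<alpha> - 1) \<le> 3 * w u v"
    if uv: "0 \<le> u" "u < v" "v < 2 ^ l" "u div 2 ^ e = v div 2 ^ e" and e: "2 ^ e < 6 * (j - i)" for u v e
  proof -
    obtain m k where mk: "(m, k) \<in> dyad_pairs l" "u \<in> dyad m (2 * k)" "v \<in> dyad m (2 * k + 1)" "m < e"
      using dyad_pair_exists[OF uv] .
    have "2 powr ((\<alpha> - 1) * real m) \<le> w u v"
      unfolding w_def using finite_dyad_pairs mk
      by (intro order_trans[OF _ member_le_sum[of "(m, k)"]]) (auto split: prod.splits)
    moreover have "(3 * real_of_int (j - i)) powr (\<alpha> - 1) \<le> (2 ^ m) powr (\<alpha> - 1)"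
    proof (rule powr_mono2')
      have "(2::int) * 2 ^ m \<le> 2 ^ e" using power_increasing[of "Suc m" e "2::int"] mk(4) by simp
      then have "2 ^ m \<le> 3 * (j - i)" using e by linarith
      then have "real_of_int (2 ^ m) \<le> real_of_int (3 * (j - i))" by linarith
      then show "2 ^ m \<le> 3 * real_of_int (j - i)" by simp
    qed (use \<alpha> in auto)
    moreover have "(2 ^ m) powr (\<alpha> - 1) = 2 powr ((\<alpha> - 1) * real m)"
      by (simp add: powr_realpow[symmetric] powr_powr mult.commute)
    moreover have "of_int (j - i) powr (\<alpha> - 1) \<le> 3 * (3 * real_of_int (j - i)) powr (\<alpha> - 1)"
    proof -
      have "3 powr (-1) \<le> 3 powr (\<alpha> - 1)" using \<alpha> by (intro powr_mono) auto
      then have "1 \<le> 3 * 3 powr (\<alpha> - 1)" by (simp add: powr_minus_divide)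
      then have "1 * of_int (j - i) powr (\<alpha> - 1) \<le> (3 * 3 powr (\<alpha> - 1)) * of_int (j - i) powr (\<alpha> - 1)"
        by (intro mult_right_mono) auto
      then show ?thesis using ij by (subst powr_mult) (auto simp: mult.assoc)
    qed
    ultimately show ?thesis by simp
  qed
  define e where "e = (LEAST e. 3 * (j - i) \<le> 2 ^ e)"
  have "\<exists>e. 3 * (j - i) \<le> 2 ^ e"
  proof
    have "3 * (j - i) \<le> int (nat (3 * (j - i)))" by simp
    also have "\<dots> \<le> 2 ^ nat (3 * (j - i))"
      using less_exp[of "nat (3 * (j - i))"] by (metis less_imp_le of_nat_le_iff of_nat_numeral of_nat_power)
    finally show "3 * (j - i) \<le> 2 ^ nat (3 * (j - i))" .
  qed
  then have e1: "3 * (j - i) \<le> 2 ^ e" unfolding e_def by (rule LeastI_ex)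
  have e2: "2 ^ e < 6 * (j - i)"
  proof (cases e)
    case 0
    then show ?thesis using e1 ij by simp
  next
    case (Suc e')
    then have "\<not> 3 * (j - i) \<le> 2 ^ e'" unfolding e_def by (intro not_less_Least) auto
    then show ?thesis using Suc by simp
  qed
  consider "l \<le> e" | "e \<le> l" "i div 2 ^ e = j div 2 ^ e" | "e \<le> l" "(i + s) div 2 ^ e = (j + s) div 2 ^ e"
    using one_third_shift[OF s _ ij(2) e1] by linarith
  then show ?thesis
  proof cases
    case 1
    then have "(2::int) ^ l \<le> 2 ^ e" by (intro power_increasing) auto
    then have "(2::int) ^ l < 6 * (j - i)" using e2 by (rule le_less_trans)
    then have "of_int (j - i) powr (\<alpha> - 1) \<le> 3 * w i j"
      using ij s0 by (intro w_ge[where e = l]) auto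
    then show ?thesis using w0[of "i + s" "j + s"] by simp
  next
    case 2
    then have "of_int (j - i) powr (\<alpha> - 1) \<le> 3 * w i j"
      using ij s0 e2 by (intro w_ge[where e = e]) auto
    then show ?thesis using w0[of "i + s" "j + s"] by simp
  next
    case 3
    then have "of_int (j - i) powr (\<alpha> - 1) \<le> 3 * w (i + s) (j + s)"
      using ij s0 e2 by (intro w_ge[where e = e]) auto
    then show ?thesis using w0[of i j] by simp
  qed
qed

subsection \<open>The inequality for sequences\<close>

text \<open>Brings the form into the shape of a double sum with a kernel, so that
  \<open>dyadic_kernel_bound\<close> can be compared with it entry by entry.\<close>

lemma sum_dyadic_kernel:
  fixes f g :: "int \<Rightarrow> real" and \<alpha> :: real
  shows "(\<Sum>(m, k)\<in>dyad_pairs l. 2 powr ((\<alpha> - 1) * real m) * (\<Sum>t\<in>dyad m (2 * k + 1). f t) * (\<Sum>t\<in>dyad m (2 * k). g t)) =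
    (\<Sum>i\<in>{0..<2 ^ l}. \<Sum>j\<in>{0..<2 ^ l}. g i * f j * (\<Sum>(m, k)\<in>dyad_pairs l.
      if i \<in> dyad m (2 * k) \<and> j \<in> dyad m (2 * k + 1) then 2 powr ((\<alpha> - 1) * real m) else 0))"
proof -
  let ?X = "{0..<2 ^ l} :: int set"
  have pair: "2 powr ((\<alpha> - 1) * real m) * (\<Sum>t\<in>dyad m (2 * k + 1). f t) * (\<Sum>t\<in>dyad m (2 * k). g t) =
      (\<Sum>i\<in>?X. \<Sum>j\<in>?X. g i * f j *
        (if i \<in> dyad m (2 * k) \<and> j \<in> dyad m (2 * k + 1) then 2 powr ((\<alpha> - 1) * real m) else 0))"
    if "(m, k) \<in> dyad_pairs l" for m k
  proof -
    have sub: "dyad m (2 * k) \<subseteq> ?X" "dyad m (2 * k + 1) \<subseteq> ?X"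
      using that by (auto simp: dyad_pairs_def dyad_Suc)
    have F: "(\<Sum>t\<in>dyad m (2 * k + 1). f t) = (\<Sum>j\<in>?X. if j \<in> dyad m (2 * k + 1) then f j else 0)"
      using sub by (simp add: sum.inter_restrict[symmetric] Int_absorb1)
    have G: "(\<Sum>t\<in>dyad m (2 * k). g t) = (\<Sum>i\<in>?X. if i \<in> dyad m (2 * k) then g i else 0)"
      using sub by (simp add: sum.inter_restrict[symmetric] Int_absorb1)
    have "2 powr ((\<alpha> - 1) * real m) * (\<Sum>t\<in>dyad m (2 * k + 1). f t) * (\<Sum>t\<in>dyad m (2 * k). g t) =
        2 powr ((\<alpha> - 1) * real m) * ((\<Sum>t\<in>dyad m (2 * k). g t) * (\<Sum>t\<in>dyad m (2 * k + 1). f t))"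
      by (simp add: mult_ac)
    also have "\<dots> = (\<Sum>i\<in>?X. \<Sum>j\<in>?X. 2 powr ((\<alpha> - 1) * real m) *
          ((if i \<in> dyad m (2 * k) then g i else 0) * (if j \<in> dyad m (2 * k + 1) then f j else 0)))"
      unfolding F G unfolding sum_product by (simp only: sum_distrib_left)
    also have "\<dots> = (\<Sum>i\<in>?X. \<Sum>j\<in>?X. g i * f j *
        (if i \<in> dyad m (2 * k) \<and> j \<in> dyad m (2 * k + 1) then 2 powr ((\<alpha> - 1) * real m) else 0))"
      by (intro sum.cong refl) auto
    finally show ?thesis .
  qed
  have "(\<Sum>(m, k)\<in>dyad_pairs l. 2 powr ((\<alpha> - 1) * real m) * (\<Sum>t\<in>dyad m (2 * k + 1). f t) * (\<Sum>t\<in>dyad m (2 * k). g t)) =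
      (\<Sum>(m, k)\<in>dyad_pairs l. \<Sum>i\<in>?X. \<Sum>j\<in>?X. g i * f j *
        (if i \<in> dyad m (2 * k) \<and> j \<in> dyad m (2 * k + 1) then 2 powr ((\<alpha> - 1) * real m) else 0))"
    by (intro sum.cong refl) (auto simp: pair)
  also have "\<dots> = (\<Sum>i\<in>?X. \<Sum>j\<in>?X. \<Sum>(m, k)\<in>dyad_pairs l. g i * f j *
        (if i \<in> dyad m (2 * k) \<and> j \<in> dyad m (2 * k + 1) then 2 powr ((\<alpha> - 1) * real m) else 0))"
    unfolding case_prod_unfold
    by (subst sum.swap, intro sum.cong refl, subst sum.swap, intro sum.cong refl)
  finally show ?thesis by (simp add: sum_distrib_left case_prod_unfold)
qed

text \<open>\<open>char\<close> ranges over adjacent blocks at every position, so it survives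
  translation. This allows the shifted grid to be treated as the standard grid for translated
  weights.\<close>

locale discrete_weights =
  fixes U S :: "int \<Rightarrow> real" and \<alpha> q r \<kappa> :: real
  assumes \<alpha>: "0 < \<alpha>" and q: "1 < q" and r: "1 < r" and qr: "1 / q + 1 / r = 1 - \<alpha>"
    and U: "0 < U t" and S: "0 < S t"
    and balance: "1 \<le> U t powr (1 / q) * S t powr (1 / r)"
    and char: "0 < m \<Longrightarrow> sum U {a..<a + m} powr (1 / q) * sum S {a + m..<a + 2 * m} powr (1 / r) \<le>
      \<kappa> * of_int m powr (1 - \<alpha>)"
    and \<kappa>: "1 \<le> \<kappa>"
begin

lemma alpha_less_1: "\<alpha> < 1"
  using qr q r by (smt (verit) divide_pos_pos)

lemma dyadic_form_bound:
  fixes f g :: "int \<Rightarrow> real"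
  assumes f: "\<And>t. 0 \<le> f t" and g: "\<And>t. 0 \<le> g t"
  shows "(\<Sum>i\<in>{0..<2 ^ l}. \<Sum>j\<in>{0..<2 ^ l}. (U (i - s) * g (i - s)) * (S (j - s) * f (j - s)) * (\<Sum>(m, k)\<in>dyad_pairs l.
      if i \<in> dyad m (2 * k) \<and> j \<in> dyad m (2 * k + 1) then 2 powr ((\<alpha> - 1) * real m) else 0)) \<le>
     dyadic_const \<alpha> q r * \<kappa> powr (max q r * (1 - \<alpha>)) *
     (\<Sum>t\<in>{0..<2 ^ l}. S (t - s) * f (t - s) powr (r / (r - 1))) powr (1 / (r / (r - 1))) *
     (\<Sum>t\<in>{0..<2 ^ l}. U (t - s) * g (t - s) powr (q / (q - 1))) powr (1 / (q / (q - 1)))"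
proof -
  have \<kappa>1: "1 \<le> \<kappa>" by (rule \<kappa>)
  interpret weighted_pairs "dyads l" "dyad_pairs l"
    "\<lambda>(m, k). dyad m (2 * k)" "\<lambda>(m, k). dyad m (2 * k + 1)" "\<lambda>(m, k). int m" "{0..<2 ^ l}"
    "\<lambda>t. U (t - s)" "\<lambda>t. S (t - s)" \<alpha> q r \<kappa>
  proof
    fix i assume "i \<in> dyad_pairs l"
    obtain m k where mk: "i = (m, k)" by (cases i)
    have shift: "(\<Sum>t\<in>{a..<b}. h (t - s)) = sum h {a - s..<b - s}" for h :: "int \<Rightarrow> real" and a b
      by (rule sum.reindex_bij_witness[of _ "\<lambda>t. t + s" "\<lambda>t. t - s"]) auto
    have "dyad m (2 * k) = {2 * k * 2 ^ m..<2 * k * 2 ^ m + 2 ^ m}"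
      "dyad m (2 * k + 1) = {2 * k * 2 ^ m + 2 ^ m..<2 * k * 2 ^ m + 2 * 2 ^ m}"
      by (simp_all add: dyad_eq distrib_right add_ac)
    then show "sum (\<lambda>t. U (t - s)) (case i of (m, k) \<Rightarrow> dyad m (2 * k)) powr (1 / q) *
        sum (\<lambda>t. S (t - s)) (case i of (m, k) \<Rightarrow> dyad m (2 * k + 1)) powr (1 / r)
        \<le> \<kappa> * (2 powr of_int (case i of (m, k) \<Rightarrow> int m)) powr (1 - \<alpha>)"
      using char[of "2 ^ m" "2 * k * 2 ^ m - s"]
      by (simp add: mk shift powr_realpow algebra_simps)
  qed (use \<alpha> q r qr U S balance \<kappa> in auto)
  have "(\<Sum>i\<in>dyad_pairs l. 2 powr ((\<alpha> - 1) * of_int (case i of (m, k) \<Rightarrow> int m)) *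
      (\<Sum>t\<in>(case i of (m, k) \<Rightarrow> dyad m (2 * k + 1)). S (t - s) * f (t - s)) *
      (\<Sum>t\<in>(case i of (m, k) \<Rightarrow> dyad m (2 * k)). U (t - s) * g (t - s))) \<le>
      dyadic_const \<alpha> q r * \<kappa> powr (max q r * (1 - \<alpha>)) *
     (\<Sum>t\<in>{0..<2 ^ l}. S (t - s) * f (t - s) powr (r / (r - 1))) powr (1 / (r / (r - 1))) *
     (\<Sum>t\<in>{0..<2 ^ l}. U (t - s) * g (t - s) powr (q / (q - 1))) powr (1 / (q / (q - 1)))"
    by (rule dyadic_bound) (use f g \<kappa>1 in auto)
  then show ?thesis unfolding sum_dyadic_kernel[symmetric] by (simp only: case_prod_unfold of_int_of_nat_eq)
qed

lemma bilinear_bound: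
  fixes f g :: "int \<Rightarrow> real"
  defines "p \<equiv> r / (r - 1)" and "q' \<equiv> q / (q - 1)"
  assumes f: "\<And>t. 0 \<le> f t" and g: "\<And>t. 0 \<le> g t" and c: "1 \<le> c"
  shows "(\<Sum>i\<in>{0..<2 ^ (2 * c - 1)}. U i * g i * (\<Sum>j\<in>{i<..<2 ^ (2 * c - 1)}. of_int (j - i) powr (\<alpha> - 1) * (S j * f j))) \<le>
    6 * dyadic_const \<alpha> q r * \<kappa> powr (max q r * (1 - \<alpha>)) *
     (\<Sum>t\<in>{0..<2 ^ (2 * c - 1)}. S t * f t powr p) powr (1 / p) *
     (\<Sum>t\<in>{0..<2 ^ (2 * c - 1)}. U t * g t powr q') powr (1 / q')"
proof -
  \<comment> \<open>An even l makes 2^l = 4^c congruent to 1 modulo 3, so that s = (2^l - 1) / 3 is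
    an integer. Only the first half [0, H) carries the sequences, which leaves room for the shift by
    s <= H.\<close>
  define l where "l = 2 * c"
  define H where "H = (2::int) ^ (2 * c - 1)"
  define K where "K = dyadic_const \<alpha> q r * \<kappa> powr (max q r * (1 - \<alpha>))"
  define B where "B = K * (\<Sum>t\<in>{0..<H}. S t * f t powr p) powr (1 / p) * (\<Sum>t\<in>{0..<H}. U t * g t powr q') powr (1 / q')"
  have H: "2 * H = 2 ^ l" "1 \<le> H"
  proof -
    have "2 * c = Suc (2 * c - 1)" using c by simp
    then show "2 * H = 2 ^ l" unfolding H_def l_def by (metis power_Suc)
  qed (simp add: H_def)
  have "(2 ^ l :: int) mod 3 = 1"
  proof -
    have "(2 ^ l :: int) mod 3 = (4 mod 3) ^ c mod 3" by (simp only: l_def power_mult power_mod) simp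
    then show ?thesis by simp
  qed
  then obtain s where s: "3 * s + 1 = (2::int) ^ l" by (metis mult_div_mod_eq)
  have sH: "0 \<le> s" "s \<le> H" using s H by linarith+
  define w where "w = (\<lambda>u v. (\<Sum>(m, k)\<in>dyad_pairs l.
      if u \<in> dyad m (2 * k) \<and> v \<in> dyad m (2 * k + 1) then 2 powr ((\<alpha> - 1) * real m) else 0))"
  have w0: "0 \<le> w u v" for u v unfolding w_def by (intro sum_nonneg) auto
  define f' where "f' t = (if t \<in> {0..<H} then f t else 0)" for t
  define g' where "g' t = (if t \<in> {0..<H} then g t else 0)" for t
  have fg': "0 \<le> f' t" "0 \<le> g' t" for t using f g by (auto simp: f'_def g'_def)
  have ps: "1 < p" "1 < q'" using q r by (auto simp: p_def q'_def less_divide_eq)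
  have norm: "(\<Sum>t\<in>{0..<2 ^ l}. W (t - \<sigma>) * (if t - \<sigma> \<in> {0..<H} then h (t - \<sigma>) else 0) powr e) = (\<Sum>t\<in>{0..<H}. W t * h t powr e)"
    if "\<sigma> \<in> {0, s}" "0 < e" for \<sigma> e and W h :: "int \<Rightarrow> real"
  proof -
    have "{\<sigma>..<H + \<sigma>} \<subseteq> {0..<2 ^ l}" using that sH H by auto
    then have "(\<Sum>t\<in>{0..<2 ^ l}. W (t - \<sigma>) * (if t - \<sigma> \<in> {0..<H} then h (t - \<sigma>) else 0) powr e) =
        (\<Sum>t\<in>{\<sigma>..<H + \<sigma>}. W (t - \<sigma>) * (if t - \<sigma> \<in> {0..<H} then h (t - \<sigma>) else 0) powr e)"
      by (intro sum.mono_neutral_right) auto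
    also have "\<dots> = (\<Sum>t\<in>{0..<H}. W t * h t powr e)"
      by (rule sum.reindex_bij_witness[of _ "\<lambda>t. t + \<sigma>" "\<lambda>t. t - \<sigma>"]) auto
    finally show ?thesis .
  qed
  have grid: "(\<Sum>i\<in>{0..<H}. \<Sum>j\<in>{0..<H}. (U i * g i) * (S j * f j) * w (i + \<sigma>) (j + \<sigma>)) \<le> B"
    if \<sigma>: "\<sigma> \<in> {0, s}" for \<sigma>
  proof -
    have sub: "{\<sigma>..<H + \<sigma>} \<subseteq> {0..<2 ^ l}" using \<sigma> sH H by auto
    have "(\<Sum>i\<in>{0..<H}. \<Sum>j\<in>{0..<H}. (U i * g i) * (S j * f j) * w (i + \<sigma>) (j + \<sigma>)) =
      (\<Sum>i\<in>{\<sigma>..<H + \<sigma>}. \<Sum>j\<in>{\<sigma>..<H + \<sigma>}. (U (i - \<sigma>) * g' (i - \<sigma>)) * (S (j - \<sigma>) * f' (j - \<sigma>)) * w i j)"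
      by (rule sum.reindex_bij_witness[of _ "\<lambda>t. t - \<sigma>" "\<lambda>t. t + \<sigma>"], simp, simp, simp, simp,
          rule sum.reindex_bij_witness[of _ "\<lambda>t. t + \<sigma>" "\<lambda>t. t - \<sigma>"]) (auto simp: f'_def g'_def)
    also have "\<dots> = (\<Sum>i\<in>{\<sigma>..<H + \<sigma>}. \<Sum>j\<in>{0..<2 ^ l}. (U (i - \<sigma>) * g' (i - \<sigma>)) * (S (j - \<sigma>) * f' (j - \<sigma>)) * w i j)"
      using sub by (intro sum.cong refl sum.mono_neutral_left) (auto simp: f'_def)
    also have "\<dots> = (\<Sum>i\<in>{0..<2 ^ l}. \<Sum>j\<in>{0..<2 ^ l}. (U (i - \<sigma>) * g' (i - \<sigma>)) * (S (j - \<sigma>) * f' (j - \<sigma>)) * w i j)"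
      using sub by (intro sum.mono_neutral_left) (auto simp: g'_def)
    also have "\<dots> \<le> B"
      unfolding w_def
      using dyadic_form_bound[where f = f' and g = g' and l = l and s = \<sigma>, OF fg']
        norm[OF \<sigma>, of p S f] norm[OF \<sigma>, of q' U g] ps
      by (simp add: f'_def g'_def B_def K_def p_def[symmetric] q'_def[symmetric] cong: if_cong)
    finally show ?thesis .
  qed
  have "(\<Sum>i\<in>{0..<H}. U i * g i * (\<Sum>j\<in>{i<..<H}. of_int (j - i) powr (\<alpha> - 1) * (S j * f j))) \<le>
      (\<Sum>i\<in>{0..<H}. \<Sum>j\<in>{0..<H}. 3 * ((U i * g i) * (S j * f j) * w (i + 0) (j + 0) + (U i * g i) * (S j * f j) * w (i + s) (j + s)))"
  proof (intro sum_mono)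
    fix i assume i: "i \<in> {0..<H}"
    have Ug: "0 \<le> U t * g t" "0 \<le> S t * f t" for t using U[of t] S[of t] f[of t] g[of t] by auto
    have "U i * g i * (\<Sum>j\<in>{i<..<H}. of_int (j - i) powr (\<alpha> - 1) * (S j * f j)) \<le>
        U i * g i * (\<Sum>j\<in>{i<..<H}. 3 * (w i j + w (i + s) (j + s)) * (S j * f j))"
    proof (intro mult_left_mono sum_mono mult_right_mono)
      fix j assume "j \<in> {i<..<H}"
      then show "of_int (j - i) powr (\<alpha> - 1) \<le> 3 * (w i j + w (i + s) (j + s))"
        unfolding w_def using i sH H s by (intro dyadic_kernel_bound \<alpha> alpha_less_1) auto
    qed (use Ug in auto)
    also have "\<dots> = (\<Sum>j\<in>{i<..<H}. 3 * ((U i * g i) * (S j * f j) * w (i + 0) (j + 0) + (U i * g i) * (S j * f j) * w (i + s) (j + s)))"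
      unfolding sum_distrib_left by (intro sum.cong refl) (simp add: algebra_simps)
    also have "\<dots> \<le> (\<Sum>j\<in>{0..<H}. 3 * ((U i * g i) * (S j * f j) * w (i + 0) (j + 0) + (U i * g i) * (S j * f j) * w (i + s) (j + s)))"
    proof (rule sum_mono2)
      show "{i<..<H} \<subseteq> {0..<H}" using i by auto
      show "0 \<le> 3 * ((U i * g i) * (S j * f j) * w (i + 0) (j + 0) + (U i * g i) * (S j * f j) * w (i + s) (j + s))" for j
        by (intro mult_nonneg_nonneg add_nonneg_nonneg Ug w0) simp
    qed simp
    finally show "U i * g i * (\<Sum>j\<in>{i<..<H}. of_int (j - i) powr (\<alpha> - 1) * (S j * f j)) \<le>
      (\<Sum>j\<in>{0..<H}. 3 * ((U i * g i) * (S j * f j) * w (i + 0) (j + 0) + (U i * g i) * (S j * f j) * w (i + s) (j + s)))" .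
  qed
  also have "\<dots> = 3 * ((\<Sum>i\<in>{0..<H}. \<Sum>j\<in>{0..<H}. (U i * g i) * (S j * f j) * w (i + 0) (j + 0)) +
      (\<Sum>i\<in>{0..<H}. \<Sum>j\<in>{0..<H}. (U i * g i) * (S j * f j) * w (i + s) (j + s)))"
    by (simp only: sum.distrib sum_distrib_left[symmetric])
  also have "\<dots> \<le> 3 * (B + B)" by (intro mult_left_mono add_mono grid) auto
  finally show ?thesis by (simp add: B_def K_def H_def mult_ac)
qed

text \<open>Duality: inserting g = T^(q - 1) into \<open>bilinear_bound\<close> yields Y on the left
  and Y^((q - 1) / q) on the right. All sums are finite, so that power can be cancelled.\<close>

theorem operator_bound:
  fixes f :: "int \<Rightarrow> real"
  defines "p \<equiv> r / (r - 1)"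
  assumes f: "\<And>t. 0 \<le> f t" and c: "1 \<le> c"
  shows "(\<Sum>i\<in>{0..<2 ^ (2 * c - 1)}. U i * (\<Sum>j\<in>{i<..<2 ^ (2 * c - 1)}. of_int (j - i) powr (\<alpha> - 1) * (S j * f j)) powr q) \<le>
    (6 * dyadic_const \<alpha> q r * \<kappa> powr (max q r * (1 - \<alpha>))) powr q *
     (\<Sum>t\<in>{0..<2 ^ (2 * c - 1)}. S t * f t powr p) powr (q / p)"
proof -
  define T where "T i = (\<Sum>j\<in>{i<..<2 ^ (2 * c - 1)}. of_int (j - i) powr (\<alpha> - 1) * (S j * f j))" for i
  define Y where "Y = (\<Sum>i\<in>{0..<2 ^ (2 * c - 1)}. U i * T i powr q)"
  define F where "F = (\<Sum>t\<in>{0..<2 ^ (2 * c - 1)}. S t * f t powr p)"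
  define K where "K = 6 * dyadic_const \<alpha> q r * \<kappa> powr (max q r * (1 - \<alpha>))"
  have T0: "0 \<le> T i" for i
    unfolding T_def using f S by (intro sum_nonneg mult_nonneg_nonneg) (auto intro: less_imp_le)
  have Y0: "0 \<le> Y" unfolding Y_def using U by (intro sum_nonneg mult_nonneg_nonneg) (auto intro: less_imp_le)
  have inv: "1 / (q / (q - 1)) = (q - 1) / q" by simp
  have K0: "0 \<le> K"
    using testing_const_nonneg[OF \<alpha> alpha_less_1] unfolding K_def dyadic_const_def
    by (intro mult_nonneg_nonneg add_nonneg_nonneg) auto
  have "Y = (\<Sum>i\<in>{0..<2 ^ (2 * c - 1)}. U i * T i powr (q - 1) * T i)"
    unfolding Y_def using T0 q by (intro sum.cong refl) (simp add: powr_diff less_le)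
  also have "\<dots> \<le> K * F powr (1 / p) * (\<Sum>t\<in>{0..<2 ^ (2 * c - 1)}. U t * (T t powr (q - 1)) powr (q / (q - 1))) powr (1 / (q / (q - 1)))"
    unfolding T_def K_def F_def p_def by (rule bilinear_bound) (use f c in auto)
  also have "(\<Sum>t\<in>{0..<2 ^ (2 * c - 1)}. U t * (T t powr (q - 1)) powr (q / (q - 1))) = Y"
    unfolding Y_def using q by (simp add: powr_powr)
  finally have main: "Y \<le> K * F powr (1 / p) * Y powr ((q - 1) / q)" unfolding inv .
  have "Y \<le> K powr q * F powr (q / p)"
  proof (cases "Y = 0")
    case True
    then show ?thesis by simp
  next
    case False
    then have Y: "0 < Y" using Y0 by simp
    have "Y = Y powr (1 / q) * Y powr ((q - 1) / q)"
      using Y q by (simp add: powr_add[symmetric] add_divide_distrib[symmetric])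
    with main have "Y powr (1 / q) * Y powr ((q - 1) / q) \<le> K * F powr (1 / p) * Y powr ((q - 1) / q)" by metis
    then have "Y powr (1 / q) \<le> K * F powr (1 / p)" by (rule mult_right_le_imp_le) (use Y in simp)
    then have "(Y powr (1 / q)) powr q \<le> (K * F powr (1 / p)) powr q"
      using q by (intro powr_mono2) auto
    also have "\<dots> = K powr q * F powr (q / p)" using K0 by (simp add: powr_mult powr_powr)
    finally show ?thesis using Y q by (simp add: powr_powr)
  qed
  then show ?thesis by (simp add: Y_def T_def K_def F_def)
qed

end

subsection \<open>Powers of extended nonnegative reals\<close>

lemma ennpowr_ennreal: "0 \<le> x \<Longrightarrow> ennpowr (ennreal x) a = ennreal (x powr a)"
  by (simp add: ennpowr_def)

lemma ennpowr_top: "ennpowr \<infinity> a = \<infinity>" "ennpowr top a = \<infinity>"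
  by (auto simp: ennpowr_def)

lemma ennpowr_0: "ennpowr 0 a = 0"
  by (simp add: ennpowr_def)

lemma ennpowr_mono:
  assumes "x \<le> y" and "0 \<le> a" shows "ennpowr x a \<le> ennpowr y a"
proof (cases "y = \<infinity>")
  case False
  then have "x \<noteq> \<infinity>" using assms(1) by (metis infinity_ennreal_def neq_top_trans)
  then show ?thesis using False assms
    by (auto simp: ennpowr_def intro!: ennreal_leI powr_mono2 enn2real_mono simp: less_top)
qed (simp add: ennpowr_top)

lemma ennpowr_ennpowr:
  assumes "0 < a" shows "ennpowr (ennpowr x a) b = ennpowr x (a * b)"
  by (cases x) (simp_all add: ennpowr_ennreal powr_powr ennpowr_top)

lemma ennpowr_1: "ennpowr x 1 = x"
  by (cases x) (simp_all add: ennpowr_ennreal ennpowr_top)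

lemma ennpowr_le_iff:
  assumes "0 < a" shows "ennpowr x a \<le> y \<longleftrightarrow> x \<le> ennpowr y (1 / a)"
proof
  assume "ennpowr x a \<le> y"
  then have "ennpowr (ennpowr x a) (1 / a) \<le> ennpowr y (1 / a)" using assms by (intro ennpowr_mono) auto
  then show "x \<le> ennpowr y (1 / a)" using assms by (simp add: ennpowr_ennpowr ennpowr_1)
next
  assume "x \<le> ennpowr y (1 / a)"
  then have "ennpowr x a \<le> ennpowr (ennpowr y (1 / a)) a" using assms by (intro ennpowr_mono) auto
  then show "ennpowr x a \<le> y" using assms by (simp add: ennpowr_ennpowr ennpowr_1)
qed

text \<open>By \<open>ennpowr_le_iff\<close> the power is an order isomorphism with inverse 1 / a,
  hence commutes with suprema.\<close>

lemma ennpowr_SUP: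
  assumes "0 < a" shows "ennpowr (SUP i\<in>I. Y i) a = (SUP i\<in>I. ennpowr (Y i) a)"
proof (rule antisym)
  have "Y i \<le> ennpowr (SUP i\<in>I. ennpowr (Y i) a) (1 / a)" if "i \<in> I" for i
    unfolding ennpowr_le_iff[OF assms, symmetric] by (rule SUP_upper[OF that])
  then show "ennpowr (SUP i\<in>I. Y i) a \<le> (SUP i\<in>I. ennpowr (Y i) a)"
    unfolding ennpowr_le_iff[OF assms] by (rule SUP_least)
  show "(SUP i\<in>I. ennpowr (Y i) a) \<le> ennpowr (SUP i\<in>I. Y i) a"
    using assms by (intro SUP_least ennpowr_mono SUP_upper) auto
qed

text \<open>The case split guards against 0 times infinity: if one integral vanishes, the integrand
  on the left vanishes almost everywhere; if none vanishes but one is infinite, so is the right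
  side. Otherwise Young's inequality is applied to the normalised functions.\<close>

lemma nn_integral_holder:
  fixes F G :: "'a \<Rightarrow> real"
  assumes [measurable]: "F \<in> borel_measurable M" "G \<in> borel_measurable M"
    and nn: "\<And>x. 0 \<le> F x" "\<And>x. 0 \<le> G x" and ab: "0 < a" "0 < b" "a + b = 1"
  shows "(\<integral>\<^sup>+x. ennreal (F x powr a * G x powr b) \<partial>M) \<le>
    ennpowr (\<integral>\<^sup>+x. ennreal (F x) \<partial>M) a * ennpowr (\<integral>\<^sup>+x. ennreal (G x) \<partial>M) b"
proof -
  define A where "A = (\<integral>\<^sup>+x. ennreal (F x) \<partial>M)"
  define B where "B = (\<integral>\<^sup>+x. ennreal (G x) \<partial>M)"
  have pos: "ennpowr z c \<noteq> 0" if "z \<noteq> 0" for z c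
    using that by (cases z) (auto simp: ennpowr_top ennpowr_ennreal ennreal_eq_0_iff)
  consider "A = 0 \<or> B = 0" | "A \<noteq> 0" "B \<noteq> 0" "A = \<infinity> \<or> B = \<infinity>" | "A \<noteq> 0" "B \<noteq> 0" "A \<noteq> \<infinity>" "B \<noteq> \<infinity>" by blast
  then show ?thesis
  proof cases
    case 1
    then have "(AE x in M. ennreal (F x) = 0) \<or> (AE x in M. ennreal (G x) = 0)"
      by (auto simp: A_def B_def nn_integral_0_iff_AE)
    then have "AE x in M. ennreal (F x powr a * G x powr b) = 0"
    proof
      assume "AE x in M. ennreal (F x) = 0"
      then show ?thesis
      proof eventually_elim
        case (elim x)
        then have "F x = 0" using nn(1)[of x] by (simp add: ennreal_eq_0_iff)
        then show ?case by simp
      qed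
    next
      assume "AE x in M. ennreal (G x) = 0"
      then show ?thesis
      proof eventually_elim
        case (elim x)
        then have "G x = 0" using nn(2)[of x] by (simp add: ennreal_eq_0_iff)
        then show ?case by simp
      qed
    qed
    then have "(\<integral>\<^sup>+x. ennreal (F x powr a * G x powr b) \<partial>M) = 0" by (simp add: nn_integral_0_iff_AE)
    then show ?thesis by simp
  next
    case 2
    then have "ennpowr A a * ennpowr B b = \<infinity>"
      using pos[of A a] pos[of B b] by (auto simp: ennpowr_top ennreal_mult_top ennreal_top_mult)
    then show ?thesis by (simp add: A_def B_def)
  next
    case 3
    then obtain s t where st: "A = ennreal s" "0 < s" "B = ennreal t" "0 < t"
      by (metis ennreal_0 ennreal_cases infinity_ennreal_def less_eq_real_def)
    have pt: "F x powr a * G x powr b \<le> s powr a * t powr b * (a / s * F x + b / t * G x)" for x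
    proof (cases "F x = 0 \<or> G x = 0")
      case True
      have "0 \<le> s powr a * t powr b * (a / s * F x + b / t * G x)"
        using st nn ab by (intro mult_nonneg_nonneg add_nonneg_nonneg) auto
      then show ?thesis using True by auto
    next
      case False
      then have "0 < F x / s" "0 < G x / t" using nn[of x] st by (auto simp: less_le)
      then have "(F x / s) powr a * (G x / t) powr b \<le> a * (F x / s) + b * (G x / t)"
        using ab by (intro Youngs_inequality_0) auto
      then have "s powr a * t powr b * ((F x / s) powr a * (G x / t) powr b) \<le> s powr a * t powr b * (a * (F x / s) + b * (G x / t))"
        by (intro mult_left_mono) auto
      then show ?thesis using st nn by (simp add: powr_divide)
    qed
    have "(\<integral>\<^sup>+x. ennreal (F x powr a * G x powr b) \<partial>M) \<le>
        (\<integral>\<^sup>+x. ennreal (s powr a * t powr b) * (ennreal (a / s) * ennreal (F x) + ennreal (b / t) * ennreal (G x)) \<partial>M)"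
      using st nn ab pt
      by (intro nn_integral_mono)
        (simp add: ennreal_mult[symmetric] ennreal_plus[symmetric] ennreal_leI del: ennreal_plus)
    also have "\<dots> = ennreal (s powr a * t powr b) * (ennreal (a / s) * A + ennreal (b / t) * B)"
      by (simp add: nn_integral_cmult nn_integral_add A_def B_def)
    also have "\<dots> = ennreal (s powr a * t powr b)"
      using st ab by (simp add: ennreal_mult[symmetric] ennreal_plus[symmetric] del: ennreal_plus)
    also have "\<dots> = ennpowr A a * ennpowr B b"
      using st by (simp add: ennpowr_ennreal ennreal_mult)
    finally show ?thesis by (simp add: A_def B_def)
  qed
qed

section \<open>Measures with a density\<close>

definition wmeas :: "(real \<Rightarrow> real) \<Rightarrow> real set \<Rightarrow> ennreal" where
  "wmeas v A = (\<integral>\<^sup>+ x\<in>A. ennreal (v x) \<partial>lebesgue)"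

lemma wmeas_mono: "A \<subseteq> B \<Longrightarrow> wmeas v A \<le> wmeas v B"
  unfolding wmeas_def by (intro nn_integral_mono) (auto split: split_indicator)

lemma borel_measurable_weight:
  assumes "weight w" shows "w \<in> borel_measurable lebesgue"
proof (rule borel_measurable_LIMSEQ_real)
  show "(\<lambda>x. indicat_real {- real n..real n} x *\<^sub>R w x) \<in> borel_measurable lebesgue" for n
    using assms unfolding weight_def set_integrable_def absolutely_integrable_on_def by blast
  show "(\<lambda>n. indicat_real {- real n..real n} x *\<^sub>R w x) \<longlonglongrightarrow> w x" for x
  proof (rule tendsto_eventually, rule eventually_sequentiallyI)
    fix n assume "nat \<lceil>\<bar>x\<bar>\<rceil> \<le> n"
    then have "\<bar>x\<bar> \<le> real n" by linarith
    then show "indicat_real {- real n..real n} x *\<^sub>R w x = w x" by (auto simp: abs_le_iff)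
  qed
qed

lemma wmeas_pos:
  assumes v: "v \<in> borel_measurable lebesgue" "AE x in lebesgue. 0 < v x"
    and A: "A \<in> sets lebesgue" "emeasure lebesgue A \<noteq> 0"
  shows "0 < wmeas v A"
proof (rule ccontr)
  assume "\<not> 0 < wmeas v A"
  then have "wmeas v A = 0" by (simp add: zero_less_iff_neq_zero)
  then have "AE x in lebesgue. ennreal (v x) * indicator A x = 0"
    unfolding wmeas_def using v A by (subst (asm) nn_integral_0_iff_AE) auto
  with v(2) have "AE x in lebesgue. x \<notin> A"
    by eventually_elim (auto simp: ennreal_eq_0_iff split: split_indicator_asm)
  then have "emeasure lebesgue A = 0" using A(1) AE_iff_measurable[of A lebesgue "\<lambda>x. x \<notin> A"] by auto
  then show False using A by simp
qed

subsection \<open>Discretization of the Weyl operator\<close>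

definition cell :: "nat \<Rightarrow> real \<Rightarrow> int" where
  "cell n x = \<lfloor>2 ^ n * x\<rfloor>"

definition cells :: "nat \<Rightarrow> int \<Rightarrow> int \<Rightarrow> real set" where
  "cells n a b = {x. a \<le> cell n x \<and> cell n x < b}"

lemma cells_eq: "cells n a b = {of_int a / 2 ^ n..<of_int b / 2 ^ n}"
  by (auto simp: cells_def cell_def le_floor_iff floor_less_iff field_simps)

lemma cells_borel [measurable]: "cells n a b \<in> sets borel"
  by (simp add: cells_eq)

lemma cells_lebesgue [measurable]: "cells n a b \<in> sets lebesgue"
  by (simp add: cells_eq)

lemma emeasure_cells: "a \<le> b \<Longrightarrow> emeasure lborel (cells n a b) = ennreal (of_int (b - a) / 2 ^ n)"
  by (simp add: cells_eq divide_right_mono diff_divide_distrib)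

lemma cells_subset: "cells n a b \<subseteq> {of_int a / 2 ^ n..of_int b / 2 ^ n}"
  by (auto simp: cells_eq)

lemma sum_indicator_cells:
  "(\<Sum>i\<in>{a..<b}. indicator (cells n i (i + 1)) x) = (indicator (cells n a b) x :: ennreal)"
proof -
  have "(\<Sum>i\<in>{a..<b}. indicator (cells n i (i + 1)) x) = (\<Sum>i\<in>{a..<b}. if i = cell n x then 1 else (0::ennreal))"
    by (intro sum.cong refl) (auto simp: cells_def split: split_indicator)
  then show ?thesis by (auto simp: cells_def split: split_indicator)
qed

lemma sum_wmeas_cells:
  assumes v: "v \<in> borel_measurable lebesgue"
  shows "(\<Sum>i\<in>{a..<b}. wmeas v (cells n i (i + 1))) = wmeas v (cells n a b)"
proof -
  have "(\<Sum>i\<in>{a..<b}. wmeas v (cells n i (i + 1))) =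
      (\<integral>\<^sup>+x. (\<Sum>i\<in>{a..<b}. ennreal (v x) * indicator (cells n i (i + 1)) x) \<partial>lebesgue)"
    unfolding wmeas_def using v by (subst nn_integral_sum) auto
  also have "\<dots> = wmeas v (cells n a b)"
    unfolding wmeas_def by (simp add: sum_distrib_left[symmetric] sum_indicator_cells)
  finally show ?thesis .
qed

section \<open>One-sided weights on the cells of a grid\<close>

locale Apq_weight =
  fixes \<alpha> p q :: real and w :: "real \<Rightarrow> real"
  assumes \<alpha>: "0 < \<alpha>" "\<alpha> < 1" and p: "1 < p" "p < 1 / \<alpha>" and q: "q = p / (1 - \<alpha> * p)"
    and w: "w \<in> Apq_plus p q"
begin

definition p' where "p' = conj_exp p"
definition u where "u x = w x powr q"
definition \<sigma> where "\<sigma> x = w x powr (- p')"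
definition K where "K = enn2real (Apq_plus_char p q w)"

lemma exponents: "1 < q" "1 < p'" "1 / q + 1 / p' = 1 - \<alpha>" "p' / (p' - 1) = p" "1 / p + 1 / p' = 1" "p < q"
proof -
  have ap: "0 < 1 - \<alpha> * p" "\<alpha> * p < 1" using \<alpha> p by (auto simp: field_simps)
  show "p < q" using ap p \<alpha> by (auto simp: q less_divide_eq)
  then show "1 < q" using p by simp
  have p'_eq: "p' = p / (p - 1)" by (simp add: p'_def conj_exp_def)
  show "1 < p'" using p by (simp add: p'_eq less_divide_eq)
  show sum1: "1 / p + 1 / p' = 1" using p by (simp add: p'_eq field_simps)
  have "1 / q = 1 / p - \<alpha>" using ap p by (simp add: q field_simps)
  then show "1 / q + 1 / p' = 1 - \<alpha>" using sum1 by simp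
  show "p' / (p' - 1) = p" using p by (simp add: p'_eq field_simps)
qed

lemma weight_w: "weight w" and char_finite: "Apq_plus_char p q w = ennreal K"
  using w by (auto simp: Apq_plus_def K_def less_top)

lemma K_nonneg: "0 \<le> K"
  by (simp add: K_def)

lemma w_measurable [measurable]: "w \<in> borel_measurable lebesgue"
  by (rule borel_measurable_weight[OF weight_w])

lemma u_measurable [measurable]: "u \<in> borel_measurable lebesgue"
  unfolding u_def by measurable

lemma \<sigma>_measurable [measurable]: "\<sigma> \<in> borel_measurable lebesgue"
  unfolding \<sigma>_def by measurable

lemma w_pos: "AE x in lebesgue. 0 < w x"
  using weight_w by (simp add: weight_def)

lemma u\<sigma>_pos: "AE x in lebesgue. 0 < u x" "AE x in lebesgue. 0 < \<sigma> x"
  using w_pos by (eventually_elim, simp add: u_def \<sigma>_def)+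

lemma char_bound:
  assumes "0 < h"
  shows "(ennreal (1 / h) * wmeas u {x - h..x}) * ennpowr (ennreal (1 / h) * wmeas \<sigma> {x..x + h}) (q / p') \<le> ennreal K"
  unfolding char_finite[symmetric] Apq_plus_char_def wmeas_def u_def \<sigma>_def p'_def[symmetric]
  by (rule order_trans[OF _ SUP_upper[of "(x, h)"]]) (use assms in auto)

lemma interval_pos:
  assumes "a < b" shows "0 < wmeas u {a..b}" "0 < wmeas \<sigma> {a..b}"
  using assms u\<sigma>_pos by (auto intro!: wmeas_pos)

lemma ennpowr_pos: "0 < x \<Longrightarrow> 0 < ennpowr x a"
  by (cases x) (auto simp: ennpowr_ennreal ennpowr_top)

text \<open>A weight is locally integrable, but u and \<sigma> are other powers of it. Their local
  integrability comes from the finite characteristic: the mass of one on an interval is multiplied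
  by a positive mass of the other on the adjacent interval.\<close>

lemma interval_finite:
  assumes "a < b" shows "wmeas u {a..b} < \<infinity>" "wmeas \<sigma> {a..b} < \<infinity>"
proof -
  define h where "h = b - a"
  have h: "0 < h" using assms by (simp add: h_def)
  have fin: "x < \<infinity>" if "(ennreal (1 / h) * x) * ennpowr (ennreal (1 / h) * y) (q / p') \<le> ennreal K" "0 < y" for x y
  proof (rule ccontr)
    assume "\<not> x < \<infinity>"
    then have "x = \<infinity>" using top.not_eq_extremum[of x] by simp
    moreover have "0 < ennpowr (ennreal (1 / h) * y) (q / p')"
      using h that(2) by (intro ennpowr_pos) (auto simp: ennreal_zero_less_mult_iff)
    ultimately have "(ennreal (1 / h) * x) * ennpowr (ennreal (1 / h) * y) (q / p') = \<infinity>"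
      using h by (auto simp: ennreal_mult_top ennreal_top_mult)
    then show False using that(1) by (simp add: top_unique)
  qed
  have fin': "y < \<infinity>" if "(ennreal (1 / h) * x) * ennpowr (ennreal (1 / h) * y) (q / p') \<le> ennreal K" "0 < x" for x y
  proof (rule ccontr)
    assume "\<not> y < \<infinity>"
    then have "y = \<infinity>" using top.not_eq_extremum[of y] by simp
    then have "(ennreal (1 / h) * x) * ennpowr (ennreal (1 / h) * y) (q / p') = \<infinity>"
      using h that(2) by (auto simp: ennreal_mult_top ennpowr_top)
    then show False using that(1) by (simp add: top_unique)
  qed
  show "wmeas u {a..b} < \<infinity>"
    using char_bound[OF h, of b] interval_pos(2)[of b "b + h"] h by (intro fin) (auto simp: h_def)
  show "wmeas \<sigma> {a..b} < \<infinity>"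
    using char_bound[OF h, of a] interval_pos(1)[of "a - h" a] h by (intro fin') (auto simp: h_def)
qed

definition Uc where "Uc n a b = enn2real (wmeas u (cells n a b))"
definition Sc where "Sc n a b = enn2real (wmeas \<sigma> (cells n a b))"

lemma cells_finite_pos:
  assumes "a < b"
  shows "wmeas u (cells n a b) = ennreal (Uc n a b)" "wmeas \<sigma> (cells n a b) = ennreal (Sc n a b)"
    "0 < Uc n a b" "0 < Sc n a b"
proof -
  have lt: "real_of_int a / 2 ^ n < real_of_int b / 2 ^ n" using assms by (simp add: divide_strict_right_mono)
  have fin: "wmeas u (cells n a b) < \<infinity>" "wmeas \<sigma> (cells n a b) < \<infinity>"
    using le_less_trans[OF wmeas_mono[OF cells_subset] interval_finite(1)[OF lt]]
      le_less_trans[OF wmeas_mono[OF cells_subset] interval_finite(2)[OF lt]] by simp_all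
  then show "wmeas u (cells n a b) = ennreal (Uc n a b)" "wmeas \<sigma> (cells n a b) = ennreal (Sc n a b)"
    by (auto simp: Uc_def Sc_def less_top)
  have "emeasure lebesgue (cells n a b) \<noteq> 0" using assms by (simp add: emeasure_cells)
  then have "0 < wmeas u (cells n a b)" "0 < wmeas \<sigma> (cells n a b)"
    using u\<sigma>_pos by (auto intro!: wmeas_pos)
  then show "0 < Uc n a b" "0 < Sc n a b" using fin by (auto simp: Uc_def Sc_def enn2real_positive_iff)
qed

lemma sum_cells: "sum (\<lambda>i. Uc n i (i + 1)) {a..<b} = Uc n a b" "sum (\<lambda>i. Sc n i (i + 1)) {a..<b} = Sc n a b"
proof -
  have "ennreal (sum (\<lambda>i. Uc n i (i + 1)) {a..<b}) = wmeas u (cells n a b)"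
    using cells_finite_pos sum_wmeas_cells[OF u_measurable, of n a b]
    by (subst sum_ennreal[symmetric]) (auto intro: less_imp_le)
  then have "Uc n a b = enn2real (ennreal (sum (\<lambda>i. Uc n i (i + 1)) {a..<b}))" by (simp add: Uc_def)
  also have "\<dots> = sum (\<lambda>i. Uc n i (i + 1)) {a..<b}"
    by (intro enn2real_ennreal sum_nonneg) (simp add: Uc_def)
  finally show "sum (\<lambda>i. Uc n i (i + 1)) {a..<b} = Uc n a b" by simp
  have "ennreal (sum (\<lambda>i. Sc n i (i + 1)) {a..<b}) = wmeas \<sigma> (cells n a b)"
    using cells_finite_pos sum_wmeas_cells[OF \<sigma>_measurable, of n a b]
    by (subst sum_ennreal[symmetric]) (auto intro: less_imp_le)
  then have "Sc n a b = enn2real (ennreal (sum (\<lambda>i. Sc n i (i + 1)) {a..<b}))" by (simp add: Sc_def)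
  also have "\<dots> = sum (\<lambda>i. Sc n i (i + 1)) {a..<b}"
    by (intro enn2real_ennreal sum_nonneg) (simp add: Sc_def)
  finally show "sum (\<lambda>i. Sc n i (i + 1)) {a..<b} = Sc n a b" by simp
qed

lemma char_cells:
  assumes "0 < m"
  shows "(2 ^ n / of_int m * Uc n a (a + m)) powr (1 / q) * (2 ^ n / of_int m * Sc n (a + m) (a + 2 * m)) powr (1 / p') \<le> K powr (1 / q)"
proof -
  define h where "h = real_of_int m / 2 ^ n"
  have h: "0 < h" "1 / h = 2 ^ n / of_int m" using assms by (auto simp: h_def)
  define x where "x = real_of_int (a + m) / 2 ^ n"
  have sub: "cells n a (a + m) \<subseteq> {x - h..x}" "cells n (a + m) (a + 2 * m) \<subseteq> {x..x + h}"
  proof -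
    have "x - h = real_of_int a / 2 ^ n" "x + h = real_of_int (a + 2 * m) / 2 ^ n"
      by (simp_all add: x_def h_def field_simps)
    then show "cells n a (a + m) \<subseteq> {x - h..x}" "cells n (a + m) (a + 2 * m) \<subseteq> {x..x + h}"
      using cells_subset[of n a "a + m"] cells_subset[of n "a + m" "a + 2 * m"] by (simp_all only: x_def)
  qed
  have e: "0 < q / p'" "0 < 1 / q" using exponents by auto
  have UV: "0 < Uc n a (a + m)" "0 < Sc n (a + m) (a + 2 * m)" using cells_finite_pos assms by auto
  have "(ennreal (1 / h) * ennreal (Uc n a (a + m))) * ennpowr (ennreal (1 / h) * ennreal (Sc n (a + m) (a + 2 * m))) (q / p') \<le>
      (ennreal (1 / h) * wmeas u {x - h..x}) * ennpowr (ennreal (1 / h) * wmeas \<sigma> {x..x + h}) (q / p')"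
    using wmeas_mono[OF sub(1), of u] wmeas_mono[OF sub(2), of \<sigma>] assms e
    by (intro mult_mono ennpowr_mono mult_left_mono) (auto simp: cells_finite_pos)
  also have "\<dots> \<le> ennreal K" by (rule char_bound[OF h(1)])
  finally have bound: "(ennreal (1 / h) * ennreal (Uc n a (a + m))) * ennpowr (ennreal (1 / h) * ennreal (Sc n (a + m) (a + 2 * m))) (q / p') \<le> ennreal K" .
  have "(ennreal c * ennreal x) * ennpowr (ennreal c * ennreal y) e = ennreal ((c * x) * (c * y) powr e)"
    if "0 \<le> c" "0 \<le> x" "0 \<le> y" for c x y e
    using that by (simp add: ennreal_mult[symmetric] ennpowr_ennreal)
  from this[of "1 / h" "Uc n a (a + m)" "Sc n (a + m) (a + 2 * m)" "q / p'"] bound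
  have "ennreal ((1 / h * Uc n a (a + m)) * (1 / h * Sc n (a + m) (a + 2 * m)) powr (q / p')) \<le> ennreal K"
    using h(1) UV by (simp only: less_imp_le zero_le_divide_1_iff)
  then have le: "(1 / h * Uc n a (a + m)) * (1 / h * Sc n (a + m) (a + 2 * m)) powr (q / p') \<le> K"
    using K_nonneg by (simp add: ennreal_le_iff)
  have "((1 / h * Uc n a (a + m)) * (1 / h * Sc n (a + m) (a + 2 * m)) powr (q / p')) powr (1 / q) \<le> K powr (1 / q)"
  proof (rule powr_mono2[OF _ _ le])
    show "0 \<le> (1 / h * Uc n a (a + m)) * (1 / h * Sc n (a + m) (a + 2 * m)) powr (q / p')"
      using h(1) UV by (intro mult_nonneg_nonneg) auto
  qed (use e in auto)
  moreover have "((1 / h * Uc n a (a + m)) * (1 / h * Sc n (a + m) (a + 2 * m)) powr (q / p')) powr (1 / q) =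
     (1 / h * Uc n a (a + m)) powr (1 / q) * (1 / h * Sc n (a + m) (a + 2 * m)) powr (1 / p')"
  proof -
    have "0 \<le> 1 / h * Uc n a (a + m)" using UV h(1) by simp
    then show ?thesis using exponents by (subst powr_mult) (auto simp: powr_powr)
  qed
  ultimately show ?thesis by (simp only: h(2))
qed

text \<open>\<theta> is chosen with q \<theta> = p' (1 - \<theta>), so that u^\<theta> \<sigma>^(1 -
  \<theta>) = 1, and Hoelder bounds the length of the interval. Raising this to the power 1 / q + 1
  / p' turns \<theta> and 1 - \<theta> into 1 / q and 1 / p'.\<close>

lemma balance_cells:
  assumes "a < b"
  shows "1 \<le> (2 ^ n / of_int (b - a) * Uc n a b) powr (1 / q) * (2 ^ n / of_int (b - a) * Sc n a b) powr (1 / p')"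
proof -
  define \<delta> where "\<delta> = real_of_int (b - a) / 2 ^ n"
  define \<theta> where "\<theta> = p' / (q + p')"
  have \<delta>: "0 < \<delta>" "1 / \<delta> = 2 ^ n / of_int (b - a)" using assms by (auto simp: \<delta>_def)
  have th: "0 < \<theta>" "0 < 1 - \<theta>" "q * \<theta> = p' * (1 - \<theta>)" "\<theta> = (1 / q) / (1 / q + 1 / p')" "1 - \<theta> = (1 / p') / (1 / q + 1 / p')"
    using exponents(1,2) by (auto simp: \<theta>_def field_simps)
  define I where "I x = indicat_real (cells n a b) x" for x
  have [measurable]: "I \<in> borel_measurable lebesgue" unfolding I_def by measurable
  have I_eq: "(\<integral>\<^sup>+x. ennreal (v x * I x) \<partial>lebesgue) = wmeas v (cells n a b)" for v
    unfolding wmeas_def I_def by (intro nn_integral_cong) (auto split: split_indicator)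
  have "ennreal \<delta> = (\<integral>\<^sup>+x. indicator (cells n a b) x \<partial>lebesgue)"
    using assms by (simp add: emeasure_cells \<delta>_def)
  also have "\<dots> = (\<integral>\<^sup>+x. ennreal ((u x * I x) powr \<theta> * (\<sigma> x * I x) powr (1 - \<theta>)) \<partial>lebesgue)"
  proof (rule nn_integral_cong_AE)
    show "AE x in lebesgue. indicator (cells n a b) x = ennreal ((u x * I x) powr \<theta> * (\<sigma> x * I x) powr (1 - \<theta>))"
      using w_pos
    proof eventually_elim
      case (elim x)
      have "u x powr \<theta> * \<sigma> x powr (1 - \<theta>) = 1"
        using elim th(3) by (simp add: u_def \<sigma>_def powr_powr powr_add[symmetric] algebra_simps)
      then show ?case by (auto simp: I_def split: split_indicator)
    qed
  qed
  also have "\<dots> \<le> ennpowr (\<integral>\<^sup>+x. ennreal (u x * I x) \<partial>lebesgue) \<theta> * ennpowr (\<integral>\<^sup>+x. ennreal (\<sigma> x * I x) \<partial>lebesgue) (1 - \<theta>)"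
    using th(1,2) by (intro nn_integral_holder) (auto simp: u_def \<sigma>_def I_def)
  also have "\<dots> = ennreal (Uc n a b powr \<theta> * Sc n a b powr (1 - \<theta>))"
    unfolding I_eq using cells_finite_pos[OF assms, of n] by (simp add: ennpowr_ennreal ennreal_mult)
  finally have le: "\<delta> \<le> Uc n a b powr \<theta> * Sc n a b powr (1 - \<theta>)"
    by (simp add: ennreal_le_iff)
  have UV: "0 < Uc n a b" "0 < Sc n a b" using cells_finite_pos assms by auto
  define s where "s = 1 / q + 1 / p'"
  have s: "0 < s" using exponents(3) \<alpha> by (simp add: s_def)
  have "\<delta> powr s \<le> (Uc n a b powr \<theta> * Sc n a b powr (1 - \<theta>)) powr s"
    using le \<delta> s by (intro powr_mono2) auto
  also have "\<dots> = Uc n a b powr (1 / q) * Sc n a b powr (1 / p')"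
  proof -
    have "\<theta> * s = 1 / q" "(1 - \<theta>) * s = 1 / p'"
      using s arg_cong[OF th(4)[folded s_def], of "\<lambda>z. z * s"] arg_cong[OF th(5)[folded s_def], of "\<lambda>z. z * s"]
      by simp_all
    then show ?thesis by (simp add: powr_mult powr_powr)
  qed
  finally have "1 \<le> Uc n a b powr (1 / q) * Sc n a b powr (1 / p') / \<delta> powr s"
    using \<delta> by simp
  also have "\<dots> = (1 / \<delta> * Uc n a b) powr (1 / q) * (1 / \<delta> * Sc n a b) powr (1 / p')"
    using \<delta>(1) UV by (simp add: powr_mult powr_divide powr_add s_def)
  finally show ?thesis by (simp only: \<delta>(2))
qed

text \<open>
  If \<open>K < 1\<close>, then the mass of \<open>u\<close> grows by the factor \<open>1 / K\<close> from each cell to the next, at every scale,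
  so comparing the first \<open>2 ^ n\<close> cells with the next \<open>2 ^ n\<close> ones gives \<open>u = 0\<close> on \<open>[0, 1)\<close>.
\<close>

lemma K_ge_1: "1 \<le> K"
proof (rule ccontr)
  assume "\<not> 1 \<le> K"
  then have K1: "0 \<le> K" "K < 1" using K_nonneg by auto
  \<comment> \<open>\<open>char_cells\<close> couples u on one cell with \<sigma> on the next, and
    \<open>balance_cells\<close> couples \<sigma> with u on that next cell. The common factor
    \<open>X\<close> from \<sigma> cancels.\<close>
  have step: "Uc n a (a + 1) \<le> K * Uc n (a + 1) (a + 2)" for n a
  proof -
    have pos: "0 < Uc n a (a + 1)" "0 < Uc n (a + 1) (a + 2)" "0 < Sc n (a + 1) (a + 2)"
      using cells_finite_pos by auto
    define X where "X = (2 ^ n * Sc n (a + 1) (a + 2)) powr (1 / p')"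
    have X: "0 < X" using pos by (simp add: X_def)
    have "(2 ^ n * Uc n a (a + 1)) powr (1 / q) * X \<le> K powr (1 / q)"
      using char_cells[of 1 n a] by (simp add: X_def)
    also have "\<dots> \<le> K powr (1 / q) * ((2 ^ n * Uc n (a + 1) (a + 2)) powr (1 / q) * X)"
      using balance_cells[of "a + 1" "a + 2" n] mult_left_mono[of 1 _ "K powr (1 / q)"] by (simp add: X_def)
    finally have "(2 ^ n * Uc n a (a + 1)) powr (1 / q) \<le> K powr (1 / q) * (2 ^ n * Uc n (a + 1) (a + 2)) powr (1 / q)"
      using X by (simp add: mult.assoc[symmetric])
    also have "\<dots> = (2 ^ n * (K * Uc n (a + 1) (a + 2))) powr (1 / q)"
      using K1 pos by (simp add: powr_mult mult_ac)
    finally have "2 ^ n * Uc n a (a + 1) \<le> 2 ^ n * (K * Uc n (a + 1) (a + 2))"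
    proof (rule contrapos_pp)
      assume "\<not> 2 ^ n * Uc n a (a + 1) \<le> 2 ^ n * (K * Uc n (a + 1) (a + 2))"
      then show "\<not> (2 ^ n * Uc n a (a + 1)) powr (1 / q) \<le> (2 ^ n * (K * Uc n (a + 1) (a + 2))) powr (1 / q)"
        using K1 pos exponents powr_less_mono2[of "1 / q" "2 ^ n * (K * Uc n (a + 1) (a + 2))" "2 ^ n * Uc n a (a + 1)"]
        by (auto simp: not_le)
    qed
    then show ?thesis by simp
  qed
  have iter: "Uc n a (a + 1) \<le> K ^ j * Uc n (a + int j) (a + int j + 1)" for n a j
  proof (induction j)
    case (Suc j)
    have "K ^ j * Uc n (a + int j) (a + int j + 1) \<le> K ^ j * (K * Uc n (a + int j + 1) (a + int j + 2))"
      using step K1 by (intro mult_left_mono) auto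
    then show ?case using Suc by (simp add: algebra_simps)
  qed simp
  have "Uc n 0 (2 ^ n) \<le> K ^ (2 ^ n) * Uc n (2 ^ n) (2 * 2 ^ n)" for n
  proof -
    have "Uc n 0 (2 ^ n) = (\<Sum>i\<in>{0..<2 ^ n}. Uc n i (i + 1))" by (simp add: sum_cells)
    also have "\<dots> \<le> (\<Sum>i\<in>{0..<2 ^ n}. K ^ (2 ^ n) * Uc n (i + 2 ^ n) (i + 2 ^ n + 1))"
      using iter[where j = "2 ^ n" and n = n] by (intro sum_mono) simp
    also have "\<dots> = K ^ (2 ^ n) * (\<Sum>i\<in>{2 ^ n..<2 * 2 ^ n}. Uc n i (i + 1))"
      unfolding sum_distrib_left[symmetric]
      by (intro arg_cong2[of _ _ _ _ "(*)"] refl sum.reindex_bij_witness[of _ "\<lambda>i. i - 2 ^ n" "\<lambda>i. i + 2 ^ n"]) auto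
    finally show ?thesis by (simp add: sum_cells)
  qed
  \<comment> \<open>Both masses belong to fixed unit intervals, so only the factor K^(2^n) depends
    on n, and it tends to 0.\<close>
  moreover have "Uc n 0 (2 ^ n) = Uc 0 0 1" "Uc n (2 ^ n) (2 * 2 ^ n) = Uc 0 1 2" for n
    by (simp_all add: Uc_def cells_eq)
  ultimately have le: "Uc 0 0 1 \<le> K ^ (2 ^ n) * Uc 0 1 2" for n by simp
  have "(\<lambda>n. K ^ (2 ^ n) * Uc 0 1 2) \<longlonglongrightarrow> 0 * Uc 0 1 2"
  proof (intro tendsto_mult tendsto_const)
    have "strict_mono (\<lambda>n. 2 ^ n :: nat)" by (auto simp: strict_mono_def)
    then show "(\<lambda>n. K ^ (2 ^ n)) \<longlonglongrightarrow> 0"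
      using LIMSEQ_subseq_LIMSEQ[OF LIMSEQ_power_zero[of K]] K1 by (auto simp: o_def)
  qed
  then have "Uc 0 0 1 \<le> 0" using le by (intro LIMSEQ_le_const[where a = "Uc 0 0 1"]) auto
  then show False using cells_finite_pos(3)[of 0 1 0] by simp
qed

end

text \<open>
  Step functions increasing to \<open>(t - x) powr (\<alpha> - 1)\<close>: the distance \<open>t - x\<close> is rounded up, and both
  variables are restricted to \<open>[- 2 ^ n, 2 ^ n)\<close>.
\<close>

definition weyl_kernel :: "real \<Rightarrow> nat \<Rightarrow> real \<Rightarrow> real \<Rightarrow> real" where
  "weyl_kernel \<alpha> n x t =
    (if - (4 ^ n) \<le> cell n x \<and> cell n x < cell n t \<and> cell n t < 4 ^ n
     then (of_int (cell n t - cell n x + 1) / 2 ^ n) powr (\<alpha> - 1) else 0)"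

lemma cell_Suc: "2 * cell n x \<le> cell (Suc n) x" "cell (Suc n) x \<le> 2 * cell n x + 1"
proof -
  have "of_int (cell n x) \<le> 2 ^ n * x" "2 ^ n * x < of_int (cell n x) + 1"
    using floor_correct[of "2 ^ n * x"] by (simp_all add: cell_def)
  then have "of_int (2 * cell n x) \<le> 2 ^ Suc n * x" "2 ^ Suc n * x < of_int (2 * cell n x + 1) + 1"
    by simp_all
  then show "2 * cell n x \<le> cell (Suc n) x" "cell (Suc n) x \<le> 2 * cell n x + 1"
    unfolding cell_def[of "Suc n"] by (simp_all add: le_floor_iff floor_le_iff)
qed

lemma cell_bounds: "of_int (cell n x) / 2 ^ n \<le> x" "x < (of_int (cell n x) + 1) / 2 ^ n"
  using floor_correct[of "2 ^ n * x"] by (auto simp: cell_def field_simps)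

lemma weyl_kernel_nonneg: "0 \<le> weyl_kernel \<alpha> n x t"
  by (simp add: weyl_kernel_def)

text \<open>When cells are halved the rounded-up distance can only decrease, and the exponent
  \<alpha> - 1 is negative. Without the \<open>+ 1\<close> the rounded distance could move either
  way.\<close>

lemma weyl_kernel_mono:
  assumes "\<alpha> < 1" shows "weyl_kernel \<alpha> n x t \<le> weyl_kernel \<alpha> (Suc n) x t"
proof (cases "- (4 ^ n) \<le> cell n x \<and> cell n x < cell n t \<and> cell n t < 4 ^ n")
  case True
  have c: "2 * cell n x \<le> cell (Suc n) x" "cell (Suc n) x \<le> 2 * cell n x + 1"
    "2 * cell n t \<le> cell (Suc n) t" "cell (Suc n) t \<le> 2 * cell n t + 1" by (rule cell_Suc)+
  have True': "- (4 ^ Suc n) \<le> cell (Suc n) x \<and> cell (Suc n) x < cell (Suc n) t \<and> cell (Suc n) t < 4 ^ Suc n"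
    using True c by simp
  have "(of_int (cell n t - cell n x + 1) / 2 ^ n) powr (\<alpha> - 1) \<le> (of_int (cell (Suc n) t - cell (Suc n) x + 1) / 2 ^ Suc n) powr (\<alpha> - 1)"
  proof (rule powr_mono2')
    have "real_of_int (cell (Suc n) t - cell (Suc n) x + 1) \<le> real_of_int (2 * (cell n t - cell n x + 1))"
      using c by (simp add: algebra_simps)
    then show "real_of_int (cell (Suc n) t - cell (Suc n) x + 1) / 2 ^ Suc n \<le> real_of_int (cell n t - cell n x + 1) / 2 ^ n"
      by (simp add: divide_simps)
    show "0 < real_of_int (cell (Suc n) t - cell (Suc n) x + 1) / 2 ^ Suc n" using True' by simp
  qed (use assms in auto)
  then show ?thesis using True True' by (simp add: weyl_kernel_def)
next
  case False
  then have "weyl_kernel \<alpha> n x t = 0" by (simp only: weyl_kernel_def if_False)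
  then show ?thesis using weyl_kernel_nonneg[of \<alpha> "Suc n" x t] by simp
qed

lemma weyl_kernel_tendsto:
  assumes xt: "x < t"
  shows "(\<lambda>n. weyl_kernel \<alpha> n x t) \<longlonglongrightarrow> (t - x) powr (\<alpha> - 1)"
proof -
  define d where "d n = real_of_int (cell n t - cell n x + 1) / 2 ^ n" for n
  have half: "(\<lambda>n. (1 / 2) ^ n :: real) \<longlonglongrightarrow> 0" by (rule LIMSEQ_power_zero) simp
  have "(\<lambda>n. d n - (t - x)) \<longlonglongrightarrow> 0"
  proof (rule Lim_null_comparison)
    show "\<forall>\<^sub>F n in sequentially. norm (d n - (t - x)) \<le> 2 * (1 / 2) ^ n"
    proof (rule always_eventually, rule allI)
      fix n
      have d: "d n = real_of_int (cell n t) / 2 ^ n - real_of_int (cell n x) / 2 ^ n + 1 / 2 ^ n"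
        by (simp add: d_def add_divide_distrib diff_divide_distrib)
      have "real_of_int (cell n t) / 2 ^ n \<le> t" "t < real_of_int (cell n t) / 2 ^ n + 1 / 2 ^ n"
        "real_of_int (cell n x) / 2 ^ n \<le> x" "x < real_of_int (cell n x) / 2 ^ n + 1 / 2 ^ n"
        using cell_bounds(1)[of n t] cell_bounds(2)[of t n] cell_bounds(1)[of n x] cell_bounds(2)[of x n] by (simp_all add: add_divide_distrib)
      then have "\<bar>d n - (t - x)\<bar> \<le> 2 * (1 / 2 ^ n)" unfolding d by linarith
      then show "norm (d n - (t - x)) \<le> 2 * (1 / 2) ^ n" by (simp add: power_one_over)
    qed
    show "(\<lambda>n. 2 * (1 / 2) ^ n :: real) \<longlonglongrightarrow> 0" using tendsto_mult_right_zero[OF half, of 2] by simp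
  qed
  then have "d \<longlonglongrightarrow> t - x" by (simp add: LIM_zero_iff)
  then have lim: "(\<lambda>n. d n powr (\<alpha> - 1)) \<longlonglongrightarrow> (t - x) powr (\<alpha> - 1)"
    using xt by (intro tendsto_powr tendsto_const) auto
  have big: "\<forall>\<^sub>F n in sequentially. \<bar>y\<bar> + 1 < 2 ^ n" for y :: real
  proof -
    obtain k where k: "\<bar>y\<bar> + 1 < 2 ^ k" using real_arch_pow[of 2 "\<bar>y\<bar> + 1"] by auto
    show ?thesis
    proof (rule eventually_sequentiallyI)
      fix n assume "k \<le> n"
      then have "(2::real) ^ k \<le> 2 ^ n" by (intro power_increasing) auto
      with k show "\<bar>y\<bar> + 1 < 2 ^ n" by (rule less_le_trans)
    qed
  qed
  have "\<forall>\<^sub>F n in sequentially. 2 / (t - x) < (2 ^ n :: real)"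
    using big[of "2 / (t - x)"] by eventually_elim linarith
  then have "\<forall>\<^sub>F n in sequentially. weyl_kernel \<alpha> n x t = d n powr (\<alpha> - 1)"
    using big[of x] big[of t]
  proof eventually_elim
    case (elim n)
    have four: "(4::real) ^ n = 2 ^ n * 2 ^ n" by (simp add: power_mult_distrib[symmetric])
    have "- (2 ^ n) \<le> x" "t < 2 ^ n" using elim by linarith+
    then have "2 ^ n * - (2 ^ n) \<le> 2 ^ n * x" "2 ^ n * t < 2 ^ n * 2 ^ n"
      by (intro mult_left_mono mult_strict_left_mono; simp)+
    then have "real_of_int (- (4 ^ n)) \<le> 2 ^ n * x" "2 ^ n * t < real_of_int (4 ^ n)"
      by (simp_all add: four)
    then have "- (4 ^ n) \<le> cell n x" "cell n t < 4 ^ n"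
      unfolding cell_def by (simp_all only: le_floor_iff floor_less_iff)
    moreover have "2 < 2 ^ n * (t - x)" using elim(1) xt by (simp add: divide_less_eq)
    then have "2 ^ n * x + 2 < 2 ^ n * t" by (simp add: algebra_simps)
    then have "cell n x < cell n t" unfolding cell_def by linarith
    ultimately show ?case by (simp add: weyl_kernel_def d_def)
  qed
  then show ?thesis using lim by (simp add: tendsto_cong)
qed

section \<open>From sequences back to functions\<close>

context Apq_weight
begin

definition \<beta> where "\<beta> = (1 - \<alpha>) * max 1 (p' / q)"

definition weyl_const where "weyl_const = 6 * dyadic_const \<alpha> q p'"

lemma weyl_const_nonneg: "0 \<le> weyl_const"
  using testing_const_nonneg[OF \<alpha>] unfolding weyl_const_def dyadic_const_def
  by (intro mult_nonneg_nonneg add_nonneg_nonneg) auto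

text \<open>The factor 2^n turns cell masses into averages, the normalisation in which neither
  \<open>char\<close> nor \<open>balance\<close> depends on n.\<close>

lemma discrete_weights_cells:
  "discrete_weights (\<lambda>i. 2 ^ n * Uc n (i - s) (i - s + 1)) (\<lambda>i. 2 ^ n * Sc n (i - s) (i - s + 1)) \<alpha> q p' (K powr (1 / q))"
proof
  show "0 < 2 ^ n * Uc n (t - s) (t - s + 1)" "0 < 2 ^ n * Sc n (t - s) (t - s + 1)" for t
    using cells_finite_pos[of "t - s" "t - s + 1" n] by auto
  show "1 \<le> (2 ^ n * Uc n (t - s) (t - s + 1)) powr (1 / q) * (2 ^ n * Sc n (t - s) (t - s + 1)) powr (1 / p')" for t
    using balance_cells[of "t - s" "t - s + 1" n] by simp
  show "1 \<le> K powr (1 / q)" using K_ge_1 exponents by (intro ge_one_powr_ge_zero) auto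
  fix m a :: int assume m: "0 < m"
  have shift: "(\<Sum>t\<in>{b..<c}. 2 ^ n * h (t - s) (t - s + 1)) = 2 ^ n * (\<Sum>t\<in>{b - s..<c - s}. h t (t + 1))"
    for h :: "int \<Rightarrow> int \<Rightarrow> real" and b c
    unfolding sum_distrib_left[symmetric]
    by (intro arg_cong2[of _ _ _ _ "(*)"] refl sum.reindex_bij_witness[of _ "\<lambda>t. t + s" "\<lambda>t. t - s"]) auto
  define y where "y = 2 ^ n * Uc n (a - s) (a - s + m)"
  define z where "z = 2 ^ n * Sc n (a - s + m) (a - s + 2 * m)"
  have yz: "0 \<le> y" "0 \<le> z" by (auto simp: y_def z_def Uc_def Sc_def)
  have "(\<Sum>t\<in>{a..<a + m}. 2 ^ n * Uc n (t - s) (t - s + 1)) = y"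
    "(\<Sum>t\<in>{a + m..<a + 2 * m}. 2 ^ n * Sc n (t - s) (t - s + 1)) = z"
    unfolding shift sum_cells y_def z_def by (simp_all add: algebra_simps)
  moreover have "(y / of_int m) powr (1 / q) * (z / of_int m) powr (1 / p') \<le> K powr (1 / q)"
    using char_cells[OF m, of n "a - s"] by (simp add: y_def z_def)
  then have "y powr (1 / q) * z powr (1 / p') / (of_int m powr (1 / q) * of_int m powr (1 / p')) \<le> K powr (1 / q)"
    using yz m by (simp add: powr_divide)
  then have "y powr (1 / q) * z powr (1 / p') \<le> K powr (1 / q) * of_int m powr (1 - \<alpha>)"
    unfolding exponents(3)[symmetric] using m by (simp add: powr_add divide_le_eq)
  ultimately show "(\<Sum>t\<in>{a..<a + m}. 2 ^ n * Uc n (t - s) (t - s + 1)) powr (1 / q) *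
      (\<Sum>t\<in>{a + m..<a + 2 * m}. 2 ^ n * Sc n (t - s) (t - s + 1)) powr (1 / p')
      \<le> K powr (1 / q) * of_int m powr (1 - \<alpha>)" by simp
qed (use \<alpha> exponents in auto)

text \<open>\<phi> j stands for the integral of |f| over a cell and \<Phi> j for that of |f|^p w^p.
  The sequence inequality is applied to \<phi> / S, whose product with S is \<phi>. The powers of
  2^n cancel because q / p = 1 + \<alpha> q, which is the scale invariance of the
  inequality.\<close>

lemma truncated_bound:
  fixes \<phi> \<Phi> :: "int \<Rightarrow> real"
  assumes \<phi>: "\<And>j. 0 \<le> \<phi> j" and \<Phi>: "\<And>j. 0 \<le> \<Phi> j" "(\<Sum>j\<in>{- (4 ^ n)..<4 ^ n}. \<Phi> j) \<le> 1"
    and holder: "\<And>j. \<phi> j \<le> \<Phi> j powr (1 / p) * Sc n j (j + 1) powr (1 / p')"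
  shows "(\<Sum>i\<in>{- (4 ^ n)..<4 ^ n}. Uc n i (i + 1) *
      (\<Sum>j\<in>{i<..<4 ^ n}. (of_int (j - i + 1) / 2 ^ n) powr (\<alpha> - 1) * \<phi> j) powr q) \<le> (weyl_const * K powr \<beta>) powr q"
proof -
  define s where "s = (4::int) ^ n"
  define \<delta> where "\<delta> = 1 / (2::real) ^ n"
  have \<delta>: "0 < \<delta>" by (simp add: \<delta>_def)
  define S where "S i = Sc n (i - s) (i - s + 1)" for i
  define U where "U i = Uc n (i - s) (i - s + 1)" for i
  define f where "f j = \<phi> (j - s) / S j" for j
  have S: "0 < S j" "0 < U j" for j using cells_finite_pos[of "j - s" "j - s + 1" n] by (auto simp: S_def U_def)
  interpret dw: discrete_weights "\<lambda>i. 2 ^ n * U i" "\<lambda>i. 2 ^ n * S i" \<alpha> q p' "K powr (1 / q)"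
    unfolding U_def S_def by (rule discrete_weights_cells)
  \<comment> \<open>Shifting by s = 4^n moves [- 4^n, 4^n) to [0, 2 * 4^n), whose length is the one
    in \<open>operator_bound\<close> for c = n + 1.\<close>
  have H: "(2::int) ^ (2 * Suc n - 1) = 2 * s" by (simp add: s_def power_mult)
  have f0: "0 \<le> f t" for t using \<phi> S by (simp add: f_def less_imp_le)
  have cancel: "2 ^ n * S j * f j = 2 ^ n * \<phi> (j - s)" for j using S[of j] by (simp add: f_def)
  have Kexp: "(K powr (1 / q)) powr (max q p' * (1 - \<alpha>)) = K powr \<beta>"
  proof -
    have "1 / q * (max q p' * (1 - \<alpha>)) = \<beta>" using exponents by (auto simp: \<beta>_def max_def field_simps)
    then show ?thesis by (simp add: powr_powr)
  qed
  have op: "(\<Sum>i\<in>{0..<2 * s}. 2 ^ n * U i * (\<Sum>j\<in>{i<..<2 * s}. of_int (j - i) powr (\<alpha> - 1) * (2 ^ n * \<phi> (j - s))) powr q) \<le>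
      (weyl_const * K powr \<beta>) powr q * (\<Sum>t\<in>{0..<2 * s}. 2 ^ n * S t * f t powr p) powr (q / p)"
    using dw.operator_bound[of f "Suc n", OF f0]
    by (simp add: H[simplified] exponents(4) Kexp cancel weyl_const_def mult.assoc[symmetric])
  have Phi_le: "2 ^ n * S t * f t powr p \<le> 2 ^ n * \<Phi> (t - s)" for t
  proof -
    have "\<phi> (t - s) powr p \<le> (\<Phi> (t - s) powr (1 / p) * S t powr (1 / p')) powr p"
      using holder[of "t - s"] \<phi> p by (intro powr_mono2) (auto simp: S_def)
    also have "\<dots> = \<Phi> (t - s) * S t powr (p - 1)"
    proof -
      have "1 / p' * p = p - 1" using exponents(5) p by (simp add: field_simps)
      then show ?thesis using p \<Phi>(1)[of "t - s"] by (simp add: powr_mult powr_powr)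
    qed
    finally have "S t * f t powr p \<le> \<Phi> (t - s)"
      using S[of t] \<phi>[of "t - s"] by (simp add: f_def powr_divide powr_diff field_simps)
    then show ?thesis by simp
  qed
  have shift: "(\<Sum>t\<in>{a + s..<b + s}. h (t - s)) = (\<Sum>t\<in>{a..<b}. h t)" for h :: "int \<Rightarrow> real" and a b
    by (rule sum.reindex_bij_witness[of _ "\<lambda>t. t + s" "\<lambda>t. t - s"]) auto
  have "(\<Sum>t\<in>{0..<2 * s}. 2 ^ n * S t * f t powr p) \<le> (\<Sum>t\<in>{0..<2 * s}. 2 ^ n * \<Phi> (t - s))"
    by (intro sum_mono Phi_le)
  also have "\<dots> = 2 ^ n * (\<Sum>t\<in>{- s..<s}. \<Phi> t)"
    using shift[of \<Phi> "- s" s] by (simp add: sum_distrib_left[symmetric])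
  also have "\<dots> \<le> 2 ^ n * 1" using \<Phi>(2) by (intro mult_left_mono) (auto simp: s_def)
  finally have F: "(\<Sum>t\<in>{0..<2 * s}. 2 ^ n * S t * f t powr p) \<le> 2 ^ n" by simp
  have F0: "0 \<le> (\<Sum>t\<in>{0..<2 * s}. 2 ^ n * S t * f t powr p)" 
    using S by (intro sum_nonneg mult_nonneg_nonneg) (auto intro: less_imp_le)
  define N where "N = (2::real) ^ n"
  have N: "0 < N" by (simp add: N_def)
  define B where "B = (weyl_const * K powr \<beta>) powr q"
  define T where "T i = (\<Sum>j\<in>{i<..<s}. of_int (j - i) powr (\<alpha> - 1) * (N * \<phi> j))" for i
  have T0: "0 \<le> T i" for i unfolding T_def using N \<phi> by (intro sum_nonneg mult_nonneg_nonneg) auto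
  have op': "(\<Sum>i\<in>{- s..<s}. N * Uc n i (i + 1) * T i powr q) \<le> B * N powr (q / p)"
  proof -
    have "(\<Sum>j\<in>{i<..<2 * s}. of_int (j - i) powr (\<alpha> - 1) * (N * \<phi> (j - s))) = T (i - s)" for i
      unfolding T_def by (rule sum.reindex_bij_witness[of _ "\<lambda>t. t + s" "\<lambda>t. t - s"]) auto
    then have "(\<Sum>i\<in>{- s..<s}. N * Uc n i (i + 1) * T i powr q) =
        (\<Sum>i\<in>{0..<2 * s}. 2 ^ n * U i * (\<Sum>j\<in>{i<..<2 * s}. of_int (j - i) powr (\<alpha> - 1) * (2 ^ n * \<phi> (j - s))) powr q)"
      using shift[of "\<lambda>i. N * Uc n i (i + 1) * T i powr q" "- s" s] by (simp add: N_def U_def)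
    also have "\<dots> \<le> B * (\<Sum>t\<in>{0..<2 * s}. 2 ^ n * S t * f t powr p) powr (q / p)"
      using op by (simp add: B_def)
    also have "\<dots> \<le> B * N powr (q / p)"
      using F F0 exponents p unfolding N_def by (intro mult_left_mono powr_mono2) (auto simp: B_def)
    finally show ?thesis .
  qed
  have "(\<Sum>i\<in>{- s..<s}. Uc n i (i + 1) * (\<Sum>j\<in>{i<..<s}. (of_int (j - i + 1) / N) powr (\<alpha> - 1) * \<phi> j) powr q) \<le>
      (\<Sum>i\<in>{- s..<s}. Uc n i (i + 1) * (N powr (- \<alpha>) * T i) powr q)"
  proof -
    have "(\<Sum>j\<in>{i<..<s}. (of_int (j - i + 1) / N) powr (\<alpha> - 1) * \<phi> j) \<le>
        (\<Sum>j\<in>{i<..<s}. N powr (- \<alpha>) * (of_int (j - i) powr (\<alpha> - 1) * (N * \<phi> j)))" for i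
    proof (rule sum_mono)
      fix j assume j: "j \<in> {i<..<s}"
      have "(of_int (j - i + 1) / N) powr (\<alpha> - 1) \<le> (of_int (j - i) / N) powr (\<alpha> - 1)"
        using j N \<alpha> by (intro powr_mono2') (auto simp: divide_right_mono)
      also have "\<dots> = of_int (j - i) powr (\<alpha> - 1) * (N powr (- \<alpha>) * N)"
        using j N by (simp add: powr_divide powr_diff powr_minus field_simps)
      finally have X: "(of_int (j - i + 1) / N) powr (\<alpha> - 1) \<le> of_int (j - i) powr (\<alpha> - 1) * (N powr (- \<alpha>) * N)" .
      show "(of_int (j - i + 1) / N) powr (\<alpha> - 1) * \<phi> j \<le> N powr (- \<alpha>) * (of_int (j - i) powr (\<alpha> - 1) * (N * \<phi> j))"
        using mult_right_mono[OF X \<phi>[of j]] by (simp only: mult_ac)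
    qed
    then have 1: "(\<Sum>j\<in>{i<..<s}. (of_int (j - i + 1) / N) powr (\<alpha> - 1) * \<phi> j) \<le> N powr (- \<alpha>) * T i" for i
      by (simp add: T_def sum_distrib_left)
    have 2: "0 \<le> (\<Sum>j\<in>{i<..<s}. (of_int (j - i + 1) / N) powr (\<alpha> - 1) * \<phi> j)" for i
      using \<phi> by (intro sum_nonneg mult_nonneg_nonneg) auto
    have 3: "0 \<le> Uc n i (i + 1)" for i by (simp add: Uc_def)
    show ?thesis
      by (intro sum_mono mult_left_mono powr_mono2 1 2 3) (use exponents(1) in auto)
  qed
  also have "\<dots> = N powr (- \<alpha> * q) / N * (\<Sum>i\<in>{- s..<s}. N * Uc n i (i + 1) * T i powr q)"
    using N T0 by (simp add: sum_distrib_left powr_mult powr_powr mult_ac)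
  also have "\<dots> \<le> N powr (- \<alpha> * q) / N * (B * N powr (q / p))"
    using N by (intro mult_left_mono op') auto
  also have "\<dots> = B"
  proof -
    have "1 / q = 1 / p - \<alpha>" using exponents(3,5) by linarith
    then have "q / p = 1 + \<alpha> * q" using exponents(1) p by (simp add: field_simps)
    then show ?thesis using N by (simp add: powr_add powr_minus)
  qed
  finally show ?thesis by (simp add: s_def N_def B_def)
qed

end

lemma weyl_kernel_eq_sum:
  "weyl_kernel \<alpha> n x t =
     (\<Sum>i\<in>{- (4 ^ n)..<4 ^ n}. \<Sum>j\<in>{i<..<4 ^ n}. indicat_real (cells n i (i + 1)) x *
       ((of_int (j - i + 1) / 2 ^ n) powr (\<alpha> - 1) * indicat_real (cells n j (j + 1)) t))"
proof -
  have ind: "indicat_real (cells n i (i + 1)) y = (if i = cell n y then 1 else 0)" for i y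
    by (auto simp: cells_def split: split_indicator)
  have inner: "(\<Sum>j\<in>{i<..<4 ^ n}. y * (h j * (if j = cell n t then 1 else 0))) =
      (if i < cell n t \<and> cell n t < 4 ^ n then y * h (cell n t) else 0)" for i and y :: real and h :: "int \<Rightarrow> real"
  proof -
    have "(\<Sum>j\<in>{i<..<4 ^ n}. y * (h j * (if j = cell n t then 1 else 0))) =
        (\<Sum>j\<in>{i<..<4 ^ n}. if j = cell n t then y * h j else 0)" by (intro sum.cong) auto
    then show ?thesis by simp
  qed
  have "(\<Sum>i\<in>{- (4 ^ n)..<4 ^ n}. \<Sum>j\<in>{i<..<4 ^ n}. indicat_real (cells n i (i + 1)) x *
       ((of_int (j - i + 1) / 2 ^ n) powr (\<alpha> - 1) * indicat_real (cells n j (j + 1)) t)) =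
      (\<Sum>i\<in>{- (4 ^ n)..<4 ^ n}. if i = cell n x then
        (if i < cell n t \<and> cell n t < 4 ^ n then (of_int (cell n t - i + 1) / 2 ^ n) powr (\<alpha> - 1) else 0) else 0)"
    unfolding ind inner by (intro sum.cong) auto
  also have "\<dots> = weyl_kernel \<alpha> n x t" by (auto simp: weyl_kernel_def)
  finally show ?thesis by simp
qed

lemma weyl_kernel_measurable [measurable]: "weyl_kernel \<alpha> n x \<in> borel_measurable lebesgue"
  unfolding weyl_kernel_eq_sum[abs_def] by measurable

text \<open>The operator applied to |f|, with infinite values allowed: no convergence has to be
  known beforehand, and finiteness at x is membership in \<open>weyl_dom\<close>.\<close>

definition weyl_abs :: "real \<Rightarrow> (real \<Rightarrow> real) \<Rightarrow> real \<Rightarrow> ennreal" where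
  "weyl_abs \<alpha> f x = (\<integral>\<^sup>+ t\<in>{x<..}. ennreal (\<bar>f t\<bar> / (t - x) powr (1 - \<alpha>)) \<partial>lebesgue)"

definition weyl_trunc :: "real \<Rightarrow> nat \<Rightarrow> (real \<Rightarrow> real) \<Rightarrow> real \<Rightarrow> ennreal" where
  "weyl_trunc \<alpha> n f x = (\<integral>\<^sup>+ t. ennreal (weyl_kernel \<alpha> n x t * \<bar>f t\<bar>) \<partial>lebesgue)"

lemma weyl_trunc_mono: "\<alpha> < 1 \<Longrightarrow> incseq (\<lambda>n. weyl_trunc \<alpha> n f x)"
  unfolding weyl_trunc_def
  by (intro incseq_SucI nn_integral_mono ennreal_leI mult_right_mono weyl_kernel_mono) auto

lemma weyl_abs_eq_SUP:
  assumes \<alpha>: "\<alpha> < 1" and [measurable]: "f \<in> borel_measurable lebesgue"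
  shows "weyl_abs \<alpha> f x = (SUP n. weyl_trunc \<alpha> n f x)"
proof -
  have inc: "incseq (\<lambda>n. ennreal (weyl_kernel \<alpha> n x t * \<bar>f t\<bar>))" for t
    by (intro incseq_SucI ennreal_leI mult_right_mono weyl_kernel_mono[OF \<alpha>]) auto
  have "(SUP n. ennreal (weyl_kernel \<alpha> n x t * \<bar>f t\<bar>)) =
      ennreal (\<bar>f t\<bar> / (t - x) powr (1 - \<alpha>)) * indicator {x<..} t" for t
  proof (cases "x < t")
    case True
    have "(\<lambda>n. ennreal (weyl_kernel \<alpha> n x t * \<bar>f t\<bar>)) \<longlonglongrightarrow> ennreal ((t - x) powr (\<alpha> - 1) * \<bar>f t\<bar>)"
      by (intro tendsto_ennrealI tendsto_mult weyl_kernel_tendsto True tendsto_const)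
    moreover have "(\<lambda>n. ennreal (weyl_kernel \<alpha> n x t * \<bar>f t\<bar>)) \<longlonglongrightarrow> (SUP n. ennreal (weyl_kernel \<alpha> n x t * \<bar>f t\<bar>))"
      by (rule LIMSEQ_SUP[OF inc])
    ultimately have "(SUP n. ennreal (weyl_kernel \<alpha> n x t * \<bar>f t\<bar>)) = ennreal ((t - x) powr (\<alpha> - 1) * \<bar>f t\<bar>)"
      by (rule LIMSEQ_unique[rotated])
    moreover have "(t - x) powr (\<alpha> - 1) = 1 / (t - x) powr (1 - \<alpha>)"
      by (metis minus_diff_eq powr_minus_divide)
    ultimately show ?thesis using True by (simp add: mult.commute)
  next
    case False
    then have "cell n t \<le> cell n x" for n unfolding cell_def by (intro floor_mono) simp
    then have "weyl_kernel \<alpha> n x t = 0" for n by (simp add: weyl_kernel_def leD)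
    then show ?thesis using False by simp
  qed
  then have "weyl_abs \<alpha> f x = (\<integral>\<^sup>+ t. (SUP n. ennreal (weyl_kernel \<alpha> n x t * \<bar>f t\<bar>)) \<partial>lebesgue)"
    by (simp add: weyl_abs_def)
  also have "\<dots> = (SUP n. weyl_trunc \<alpha> n f x)"
    unfolding weyl_trunc_def
  proof (rule nn_integral_monotone_convergence_SUP)
    show "incseq (\<lambda>n t. ennreal (weyl_kernel \<alpha> n x t * \<bar>f t\<bar>))"
      using inc by (auto simp: incseq_def le_fun_def)
    show "(\<lambda>t. ennreal (weyl_kernel \<alpha> n x t * \<bar>f t\<bar>)) \<in> borel_measurable lebesgue" for n by measurable
  qed
  finally show ?thesis .
qed

lemma weyl_dom_iff:
  assumes [measurable]: "f \<in> borel_measurable lebesgue"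
  shows "x \<in> weyl_dom \<alpha> f \<longleftrightarrow> weyl_abs \<alpha> f x < \<infinity>"
proof -
  have "weyl_abs \<alpha> f x = (\<integral>\<^sup>+ t. ennreal (norm (indicator {x<..} t *\<^sub>R (f t / (t - x) powr (1 - \<alpha>)))) \<partial>lebesgue)"
    unfolding weyl_abs_def by (intro nn_integral_cong) (auto split: split_indicator)
  moreover have [measurable]: "(\<lambda>t::real. t) \<in> borel_measurable lebesgue"
    by (rule measurable_completion) simp
  moreover have "(\<lambda>t. indicator {x<..} t *\<^sub>R (f t / (t - x) powr (1 - \<alpha>))) \<in> borel_measurable lebesgue" by measurable
  ultimately show ?thesis
    by (simp add: weyl_dom_def set_integrable_def integrable_iff_bounded)
qed

lemma weyl_le_weyl_abs:
  assumes "x \<in> weyl_dom \<alpha> f" shows "ennreal \<bar>weyl \<alpha> f x\<bar> \<le> weyl_abs \<alpha> f x"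
proof -
  have "ennreal (norm (weyl \<alpha> f x)) \<le> (\<integral>\<^sup>+ t. ennreal (norm (indicator {x<..} t *\<^sub>R (f t / (t - x) powr (1 - \<alpha>)))) \<partial>lebesgue)"
    unfolding weyl_def set_lebesgue_integral_def
    by (rule integral_norm_bound_ennreal) (use assms in \<open>simp add: weyl_dom_def set_integrable_def\<close>)
  also have "\<dots> = weyl_abs \<alpha> f x"
    unfolding weyl_abs_def by (intro nn_integral_cong) (auto split: split_indicator)
  finally show ?thesis by simp
qed

context Apq_weight
begin

text \<open>The step kernel sees f only through its integrals over cells and produces a function
  that is constant on cells, so the integral is exactly the sum in \<open>truncated_bound\<close>.
  Its Hoelder hypothesis comes from |f| = (|f|^p w^p)^(1/p) \<sigma>^(1/p') on each cell.\<close>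

lemma trunc_operator_bound:
  assumes [measurable]: "f \<in> borel_measurable lebesgue"
    and f: "(\<integral>\<^sup>+ x. ennreal (\<bar>f x\<bar> powr p * w x powr p) \<partial>lebesgue) \<le> 1"
  shows "(\<lambda>x. ennpowr (weyl_trunc \<alpha> n f x) q * ennreal (u x)) \<in> borel_measurable lebesgue"
    and "(\<integral>\<^sup>+ x. ennpowr (weyl_trunc \<alpha> n f x) q * ennreal (u x) \<partial>lebesgue) \<le> ennreal ((weyl_const * K powr \<beta>) powr q)"
proof -
  define \<phi>e where "\<phi>e j = wmeas (\<lambda>x. \<bar>f x\<bar>) (cells n j (j + 1))" for j
  define \<Phi>e where "\<Phi>e j = wmeas (\<lambda>x. \<bar>f x\<bar> powr p * w x powr p) (cells n j (j + 1))" for j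
  define \<phi> where "\<phi> j = enn2real (\<phi>e j)" for j
  define \<Phi> where "\<Phi> j = enn2real (\<Phi>e j)" for j
  have \<Phi>e_le: "\<Phi>e j \<le> 1" for j
  proof -
    have "\<Phi>e j \<le> wmeas (\<lambda>x. \<bar>f x\<bar> powr p * w x powr p) UNIV" unfolding \<Phi>e_def by (rule wmeas_mono) simp
    then show ?thesis using f by (simp add: wmeas_def)
  qed
  have \<Phi>e: "\<Phi>e j = ennreal (\<Phi> j)" "0 \<le> \<Phi> j" for j
    using le_less_trans[OF \<Phi>e_le[of j], of top] by (simp_all add: \<Phi>_def)
  have S0: "0 < Sc n j (j + 1)" for j by (rule cells_finite_pos) simp
  have hold: "\<phi>e j \<le> ennreal (\<Phi> j powr (1 / p) * Sc n j (j + 1) powr (1 / p'))" for j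
  proof -
    define I where "I x = indicat_real (cells n j (j + 1)) x" for x
    have [measurable]: "I \<in> borel_measurable lebesgue" unfolding I_def by measurable
    have I_eq: "(\<integral>\<^sup>+x. ennreal (v x * I x) \<partial>lebesgue) = wmeas v (cells n j (j + 1))" for v
      unfolding wmeas_def I_def by (intro nn_integral_cong) (auto split: split_indicator)
    have "\<phi>e j = (\<integral>\<^sup>+x. ennreal ((\<bar>f x\<bar> powr p * w x powr p * I x) powr (1 / p) * (\<sigma> x * I x) powr (1 / p')) \<partial>lebesgue)"
      unfolding \<phi>e_def wmeas_def
    proof (rule nn_integral_cong_AE)
      show "AE x in lebesgue. ennreal \<bar>f x\<bar> * indicator (cells n j (j + 1)) x =
          ennreal ((\<bar>f x\<bar> powr p * w x powr p * I x) powr (1 / p) * (\<sigma> x * I x) powr (1 / p'))"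
        using w_pos
      proof eventually_elim
        case (elim x)
        have "(\<bar>f x\<bar> powr p * w x powr p) powr (1 / p) * \<sigma> x powr (1 / p') = \<bar>f x\<bar>"
        proof -
          have "\<sigma> x powr (1 / p') = 1 / w x"
            using elim exponents(2) by (simp add: \<sigma>_def powr_powr powr_neg_one)
          then show ?thesis using elim p by (simp add: powr_mult powr_powr)
        qed
        then show ?case by (auto simp: I_def split: split_indicator)
      qed
    qed
    also have "\<dots> \<le> ennpowr (\<integral>\<^sup>+x. ennreal (\<bar>f x\<bar> powr p * w x powr p * I x) \<partial>lebesgue) (1 / p) *
        ennpowr (\<integral>\<^sup>+x. ennreal (\<sigma> x * I x) \<partial>lebesgue) (1 / p')"
    proof (rule nn_integral_holder)
      show "0 < 1 / p" "0 < 1 / p'" "1 / p + 1 / p' = 1" using p exponents(2,5) by auto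
      show "0 \<le> \<bar>f x\<bar> powr p * w x powr p * I x" "0 \<le> \<sigma> x * I x" for x by (auto simp: I_def \<sigma>_def)
    qed measurable
    also have "\<dots> = ennpowr (\<Phi>e j) (1 / p) * ennpowr (ennreal (Sc n j (j + 1))) (1 / p')"
      unfolding I_eq \<Phi>e_def using cells_finite_pos(2)[of j "j + 1" n] by simp
    also have "\<dots> = ennreal (\<Phi> j powr (1 / p) * Sc n j (j + 1) powr (1 / p'))"
      using \<Phi>e[of j] S0[of j] by (simp add: ennpowr_ennreal ennreal_mult)
    finally show ?thesis .
  qed
  have \<phi>e: "\<phi>e j = ennreal (\<phi> j)" "0 \<le> \<phi> j" for j
    using le_less_trans[OF hold[of j], of top] by (simp_all add: \<phi>_def)
  have hold_real: "\<phi> j \<le> \<Phi> j powr (1 / p) * Sc n j (j + 1) powr (1 / p')" for j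
    using hold[of j] by (simp add: \<phi>e ennreal_le_iff)
  have sum\<Phi>: "(\<Sum>j\<in>{- (4 ^ n)..<4 ^ n}. \<Phi> j) \<le> 1"
  proof -
    have "ennreal (\<Sum>j\<in>{- (4 ^ n)..<4 ^ n}. \<Phi> j) = (\<Sum>j\<in>{- (4 ^ n)..<4 ^ n}. \<Phi>e j)"
      using \<Phi>e by (simp add: sum_ennreal)
    also have "\<dots> = wmeas (\<lambda>x. \<bar>f x\<bar> powr p * w x powr p) (cells n (- (4 ^ n)) (4 ^ n))"
      unfolding \<Phi>e_def by (rule sum_wmeas_cells) measurable
    also have "\<dots> \<le> wmeas (\<lambda>x. \<bar>f x\<bar> powr p * w x powr p) UNIV" by (rule wmeas_mono) simp
    also have "\<dots> \<le> 1" using f by (simp add: wmeas_def)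
    finally show ?thesis by simp
  qed
  define \<tau> where "\<tau> i = (\<Sum>j\<in>{i<..<4 ^ n}. (of_int (j - i + 1) / 2 ^ n) powr (\<alpha> - 1) * \<phi> j)" for i
  have \<tau>0: "0 \<le> \<tau> i" for i unfolding \<tau>_def using \<phi>e by (intro sum_nonneg mult_nonneg_nonneg) auto
  have trunc: "weyl_trunc \<alpha> n f x = (if cell n x \<in> {- (4 ^ n)..<4 ^ n} then ennreal (\<tau> (cell n x)) else 0)" for x
  proof (cases "cell n x \<in> {- (4 ^ n)..<4 ^ n}")
    case True
    let ?c = "\<lambda>j. (of_int (j - cell n x + 1) / 2 ^ n) powr (\<alpha> - 1)"
    have kern: "weyl_kernel \<alpha> n x t = (\<Sum>j\<in>{cell n x<..<4 ^ n}. ?c j * indicat_real (cells n j (j + 1)) t)" for t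
    proof -
      have "(\<Sum>j\<in>{cell n x<..<4 ^ n}. ?c j * indicat_real (cells n j (j + 1)) t) =
          (\<Sum>j\<in>{cell n x<..<4 ^ n}. if j = cell n t then ?c j else 0)"
        by (intro sum.cong) (auto simp: cells_def split: split_indicator)
      then show ?thesis using True by (auto simp: weyl_kernel_def)
    qed
    have "weyl_trunc \<alpha> n f x = (\<integral>\<^sup>+ t. (\<Sum>j\<in>{cell n x<..<4 ^ n}. ennreal (?c j) * (ennreal \<bar>f t\<bar> * indicator (cells n j (j + 1)) t)) \<partial>lebesgue)"
      unfolding weyl_trunc_def kern
    proof (intro nn_integral_cong)
      fix t
      have "ennreal ((\<Sum>j\<in>{cell n x<..<4 ^ n}. ?c j * indicat_real (cells n j (j + 1)) t) * \<bar>f t\<bar>) =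
          ennreal (\<Sum>j\<in>{cell n x<..<4 ^ n}. ?c j * indicat_real (cells n j (j + 1)) t * \<bar>f t\<bar>)"
        by (simp only: sum_distrib_right)
      also have "\<dots> = (\<Sum>j\<in>{cell n x<..<4 ^ n}. ennreal (?c j * indicat_real (cells n j (j + 1)) t * \<bar>f t\<bar>))"
        by (rule sum_ennreal[symmetric]) simp
      also have "\<dots> = (\<Sum>j\<in>{cell n x<..<4 ^ n}. ennreal (?c j) * (ennreal \<bar>f t\<bar> * indicator (cells n j (j + 1)) t))"
        by (intro sum.cong refl) (auto simp: ennreal_mult split: split_indicator)
      finally show "ennreal ((\<Sum>j\<in>{cell n x<..<4 ^ n}. ?c j * indicat_real (cells n j (j + 1)) t) * \<bar>f t\<bar>) =
        (\<Sum>j\<in>{cell n x<..<4 ^ n}. ennreal (?c j) * (ennreal \<bar>f t\<bar> * indicator (cells n j (j + 1)) t))" .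
    qed
    also have "\<dots> = (\<Sum>j\<in>{cell n x<..<4 ^ n}. ennreal (?c j) * \<phi>e j)"
      unfolding \<phi>e_def wmeas_def by (subst nn_integral_sum, measurable) (simp add: nn_integral_cmult)
    also have "\<dots> = (\<Sum>j\<in>{cell n x<..<4 ^ n}. ennreal (?c j * \<phi> j))"
      by (intro sum.cong refl) (simp add: \<phi>e ennreal_mult)
    also have "\<dots> = ennreal (\<tau> (cell n x))"
      unfolding \<tau>_def using \<phi>e by (intro sum_ennreal) simp
    finally show ?thesis using True by simp
  next
    case False
    then have "weyl_kernel \<alpha> n x t = 0" for t by (auto simp: weyl_kernel_def)
    then have "weyl_trunc \<alpha> n f x = 0" by (simp add: weyl_trunc_def)
    then show ?thesis by (simp only: False if_False)
  qed
  have expand: "ennpowr (weyl_trunc \<alpha> n f x) q * ennreal (u x) =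
      (\<Sum>i\<in>{- (4 ^ n)..<4 ^ n}. ennreal (\<tau> i powr q) * (ennreal (u x) * indicator (cells n i (i + 1)) x))" for x
  proof -
    have "(\<Sum>i\<in>{- (4 ^ n)..<4 ^ n}. ennreal (\<tau> i powr q) * (ennreal (u x) * indicator (cells n i (i + 1)) x)) =
        (\<Sum>i\<in>{- (4 ^ n)..<4 ^ n}. if i = cell n x then ennreal (\<tau> i powr q) * ennreal (u x) else 0)"
      by (intro sum.cong) (auto simp: cells_def split: split_indicator)
    then show ?thesis unfolding trunc using \<tau>0 by (simp add: ennpowr_ennreal ennpowr_0)
  qed
  show "(\<lambda>x. ennpowr (weyl_trunc \<alpha> n f x) q * ennreal (u x)) \<in> borel_measurable lebesgue"
    unfolding expand by measurable
  have "(\<integral>\<^sup>+ x. ennpowr (weyl_trunc \<alpha> n f x) q * ennreal (u x) \<partial>lebesgue) =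
      (\<Sum>i\<in>{- (4 ^ n)..<4 ^ n}. ennreal (\<tau> i powr q) * wmeas u (cells n i (i + 1)))"
    unfolding expand wmeas_def by (subst nn_integral_sum, measurable) (simp add: nn_integral_cmult)
  also have "\<dots> = (\<Sum>i\<in>{- (4 ^ n)..<4 ^ n}. ennreal (Uc n i (i + 1) * \<tau> i powr q))"
    by (intro sum.cong refl) (simp add: cells_finite_pos ennreal_mult' mult.commute)
  also have "\<dots> = ennreal (\<Sum>i\<in>{- (4 ^ n)..<4 ^ n}. Uc n i (i + 1) * \<tau> i powr q)"
    by (intro sum_ennreal) (simp add: Uc_def)
  also have "\<dots> \<le> ennreal ((weyl_const * K powr \<beta>) powr q)"
    unfolding \<tau>_def by (intro ennreal_leI truncated_bound[where \<Phi> = \<Phi>] \<phi>e \<Phi>e sum\<Phi> hold_real)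
  finally show "(\<integral>\<^sup>+ x. ennpowr (weyl_trunc \<alpha> n f x) q * ennreal (u x) \<partial>lebesgue) \<le> ennreal ((weyl_const * K powr \<beta>) powr q)" .
qed

text \<open>Monotone convergence passes from the step kernels to \<open>weyl_abs\<close>. The finite
  integral and u > 0 almost everywhere also give absolute convergence at almost every point, without
  which \<open>op_norm\<close> would be infinite.\<close>

theorem weyl_norm_bound: "weyl_norm \<alpha> p q w \<le> ennreal (weyl_const * K powr \<beta>)"
  unfolding weyl_norm_def op_norm_def
proof (rule SUP_least)
  fix f assume "f \<in> {f \<in> borel_measurable lebesgue. Lnorm p (\<lambda>x. w x powr p) f \<le> 1}"
  then have [measurable]: "f \<in> borel_measurable lebesgue" and norm: "Lnorm p (\<lambda>x. w x powr p) f \<le> 1" by auto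
  have f: "(\<integral>\<^sup>+ x. ennreal (\<bar>f x\<bar> powr p * w x powr p) \<partial>lebesgue) \<le> 1"
    using norm p unfolding Lnorm_def by (subst (asm) ennpowr_le_iff) (auto simp: ennpowr_def)
  define B where "B = weyl_const * K powr \<beta>"
  have B0: "0 \<le> B" using weyl_const_nonneg by (simp add: B_def)
  define Y where "Y n x = ennpowr (weyl_trunc \<alpha> n f x) q * ennreal (u x)" for n x
  have [measurable]: "Y n \<in> borel_measurable lebesgue" for n
    unfolding Y_def by (rule trunc_operator_bound(1)) (use f in measurable)
  have abs_eq: "ennpowr (weyl_abs \<alpha> f x) q * ennreal (u x) = (SUP n. Y n x)" for x
    unfolding Y_def using \<alpha> exponents(1)
    by (subst weyl_abs_eq_SUP) (auto simp: ennpowr_SUP SUP_mult_right_ennreal)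
  have "incseq Y"
    unfolding Y_def using \<alpha> exponents(1) weyl_trunc_mono
    by (auto intro!: monoI le_funI mult_right_mono ennpowr_mono simp: incseq_def)
  then have "(\<integral>\<^sup>+ x. (SUP n. Y n x) \<partial>lebesgue) = (SUP n. \<integral>\<^sup>+ x. Y n x \<partial>lebesgue)"
    by (intro nn_integral_monotone_convergence_SUP) auto
  also have "\<dots> \<le> ennreal (B powr q)"
    unfolding Y_def B_def by (intro SUP_least trunc_operator_bound(2)) (use f in measurable)
  finally have bound: "(\<integral>\<^sup>+ x. ennpowr (weyl_abs \<alpha> f x) q * ennreal (u x) \<partial>lebesgue) \<le> ennreal (B powr q)"
    by (simp add: abs_eq)
  have dom: "AE x in lebesgue. x \<in> weyl_dom \<alpha> f"
  proof -
    have "AE x in lebesgue. (SUP n. Y n x) \<noteq> \<infinity>"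
      using bound unfolding abs_eq by (intro nn_integral_PInf_AE) (auto simp: top_unique)
    then show ?thesis
      using u\<sigma>_pos(1)
    proof eventually_elim
      case (elim x)
      then have "weyl_abs \<alpha> f x \<noteq> \<infinity>" unfolding abs_eq[symmetric] by (auto simp: ennpowr_top ennreal_top_mult)
      then show ?case by (simp add: weyl_dom_iff less_top)
    qed
  qed
  have "Lnorm q (\<lambda>x. w x powr q) (weyl \<alpha> f) \<le> ennreal B"
  proof -
    have "(\<integral>\<^sup>+ x. ennreal (\<bar>weyl \<alpha> f x\<bar> powr q * w x powr q) \<partial>lebesgue) \<le>
        (\<integral>\<^sup>+ x. ennpowr (weyl_abs \<alpha> f x) q * ennreal (u x) \<partial>lebesgue)"
      using dom
    proof (intro nn_integral_mono_AE, eventually_elim)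
      case (elim x)
      have "ennreal (\<bar>weyl \<alpha> f x\<bar> powr q * w x powr q) = ennpowr (ennreal \<bar>weyl \<alpha> f x\<bar>) q * ennreal (u x)"
        by (simp add: ennpowr_ennreal ennreal_mult u_def)
      also have "\<dots> \<le> ennpowr (weyl_abs \<alpha> f x) q * ennreal (u x)"
        using exponents(1) by (intro mult_right_mono ennpowr_mono weyl_le_weyl_abs elim) auto
      finally show ?case .
    qed
    also note bound
    finally show ?thesis
      unfolding Lnorm_def using exponents(1) B0
      by (subst ennpowr_le_iff) (auto simp: ennpowr_ennreal)
  qed
  then show "(if AE x in lebesgue. x \<in> weyl_dom \<alpha> f then Lnorm q (\<lambda>x. w x powr q) (weyl \<alpha> f) else \<infinity>) \<le>
      ennreal (weyl_const * K powr \<beta>)"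
    using dom by (simp add: B_def)
qed

end

subsection \<open>Reflection\<close>

lemma uminus_measurable_lebesgue: "(uminus :: real \<Rightarrow> real) \<in> lebesgue \<rightarrow>\<^sub>M lebesgue"
  using lebesgue_affine_measurable[where c = "\<lambda>x::real. - 1" and t = "0 :: real"] by simp

lemma borel_measurable_reflect:
  fixes f :: "real \<Rightarrow> 'a :: topological_space"
  assumes "f \<in> borel_measurable lebesgue" shows "(\<lambda>x. f (- x)) \<in> borel_measurable lebesgue"
  using measurable_compose[OF uminus_measurable_lebesgue assms] .

text \<open>No measurability is needed, since reflection permutes the simple functions below the integrand.\<close>

lemma nn_integral_reflect:
  fixes g :: "real \<Rightarrow> ennreal"
  shows "(\<integral>\<^sup>+x. g (- x) \<partial>lebesgue) = (\<integral>\<^sup>+x. g x \<partial>lebesgue)"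
proof -
  have le: "(\<integral>\<^sup>+x. g x \<partial>lebesgue) \<le> (\<integral>\<^sup>+x. g (- x) \<partial>lebesgue)" for g :: "real \<Rightarrow> ennreal"
    unfolding nn_integral_def[of lebesgue g]
  proof (rule SUP_least)
    fix s assume s: "s \<in> {s. simple_function lebesgue s \<and> s \<le> g}"
    have "integral\<^sup>S lebesgue s = (\<integral>\<^sup>+x. s x \<partial>lebesgue)"
      using s by (simp add: nn_integral_eq_simple_integral)
    also have "\<dots> = (\<integral>\<^sup>+x. s (- x) \<partial>lebesgue)"
      using s nn_integral_real_affine_lebesgue[of s "- 1" 0] by (simp add: borel_measurable_simple_function)
    also have "\<dots> \<le> (\<integral>\<^sup>+x. g (- x) \<partial>lebesgue)"
      using s by (intro nn_integral_mono) (auto simp: le_fun_def)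
    finally show "integral\<^sup>S lebesgue s \<le> (\<integral>\<^sup>+x. g (- x) \<partial>lebesgue)" .
  qed
  show ?thesis using le[of g] le[of "\<lambda>x. g (- x)"] by (simp add: antisym)
qed

lemma AE_reflect: "(AE x in lebesgue. P (- x)) \<longleftrightarrow> (AE x in lebesgue. P (x :: real))"
proof -
  have dir: "AE x in lebesgue. P (- x)" if "AE x in lebesgue. P x" for P :: "real \<Rightarrow> bool"
  proof -
    from that obtain N where N: "{x \<in> space lebesgue. \<not> P x} \<subseteq> N" "emeasure lebesgue N = 0" "N \<in> sets lebesgue"
      by (rule AE_E)
    have "(\<integral>\<^sup>+x. indicator N (- x) \<partial>lebesgue) = emeasure lebesgue N"
      using N by (simp add: nn_integral_reflect)
    moreover have "(\<lambda>x. indicator N (- x) :: ennreal) \<in> borel_measurable lebesgue"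
      using N by (intro borel_measurable_reflect) auto
    ultimately have "AE x in lebesgue. indicator N (- x) = (0 :: ennreal)"
      using N by (simp add: nn_integral_0_iff_AE)
    then show ?thesis by eventually_elim (use N in \<open>auto simp: indicator_eq_0_iff\<close>)
  qed
  show ?thesis using dir[of P] dir[of "\<lambda>x. P (- x)"] unfolding minus_minus by (rule iffI[rotated])
qed

lemma weight_reflect:
  assumes "weight w" shows "weight (\<lambda>x. w (- x))"
  unfolding weight_def
proof (intro conjI allI)
  show "AE x in lebesgue. 0 < w (- x)"
    using assms unfolding AE_reflect[of "\<lambda>x. 0 < w x"] weight_def by blast
  fix a b :: real
  have "w absolutely_integrable_on {- b..- a}" using assms by (simp only: weight_def)
  then have "(\<lambda>x. w (- x)) absolutely_integrable_on {- (- a)..- (- b)}"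
    by (simp only: absolutely_integrable_reflect_real)
  then show "(\<lambda>x. w (- x)) absolutely_integrable_on {a..b}" by simp
qed

lemma set_nn_integral_reflect:
  "(\<integral>\<^sup>+t\<in>{a..b}. g (- t) \<partial>lebesgue) = (\<integral>\<^sup>+t\<in>{- b..- a :: real}. g t \<partial>lebesgue)"
proof -
  have "(\<integral>\<^sup>+t\<in>{a..b}. g (- t) \<partial>lebesgue) = (\<integral>\<^sup>+t. (\<lambda>s. g s * indicator {- b..- a} s) (- t) \<partial>lebesgue)"
    by (intro nn_integral_cong) (auto split: split_indicator)
  also have "\<dots> = (\<integral>\<^sup>+t\<in>{- b..- a}. g t \<partial>lebesgue)" by (rule nn_integral_reflect)
  finally show ?thesis .
qed

lemma Apq_char_reflect: "Apq_plus_char p q (\<lambda>x. w (- x)) = Apq_minus_char p q w"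
proof -
  have "{- x..- (x - h)} = {- x..- x + h}" "{- (x + h)..- x} = {- x - h..- x}" for x h :: real by auto
  then have eq: "(\<integral>\<^sup>+t\<in>{x - h..x}. ennreal (w (- t) powr q) \<partial>lebesgue) = (\<integral>\<^sup>+t\<in>{- x..- x + h}. ennreal (w t powr q) \<partial>lebesgue)"
    "(\<integral>\<^sup>+t\<in>{x..x + h}. ennreal (w (- t) powr - conj_exp p) \<partial>lebesgue) = (\<integral>\<^sup>+t\<in>{- x - h..- x}. ennreal (w t powr - conj_exp p) \<partial>lebesgue)" for x h
    by (simp_all only: set_nn_integral_reflect[where g = "\<lambda>t. ennreal (w t powr q)"]
        set_nn_integral_reflect[where g = "\<lambda>t. ennreal (w t powr - conj_exp p)"])
  show ?thesis
    unfolding Apq_plus_char_def Apq_minus_char_def eq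
  proof (rule SUP_eq)
    fix i :: "real \<times> real" assume "i \<in> UNIV \<times> {0<..}"
    then show "\<exists>j\<in>UNIV \<times> {0<..}. (case i of (x, h) \<Rightarrow>
        ennreal (1 / h) * (\<integral>\<^sup>+t\<in>{- x..- x + h}. ennreal (w t powr q) \<partial>lebesgue) *
        ennpowr (ennreal (1 / h) * (\<integral>\<^sup>+t\<in>{- x - h..- x}. ennreal (w t powr - conj_exp p) \<partial>lebesgue)) (q / conj_exp p)) \<le>
      (case j of (x, h) \<Rightarrow> ennreal (1 / h) * (\<integral>\<^sup>+t\<in>{x..x + h}. ennreal (w t powr q) \<partial>lebesgue) *
        ennpowr (ennreal (1 / h) * (\<integral>\<^sup>+t\<in>{x - h..x}. ennreal (w t powr - conj_exp p) \<partial>lebesgue)) (q / conj_exp p))"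
      by (intro bexI[of _ "(- fst i, snd i)"]) (auto simp: case_prod_unfold add.commute)
  next
    fix j :: "real \<times> real" assume "j \<in> UNIV \<times> {0<..}"
    then show "\<exists>i\<in>UNIV \<times> {0<..}.
      (case j of (x, h) \<Rightarrow> ennreal (1 / h) * (\<integral>\<^sup>+t\<in>{x..x + h}. ennreal (w t powr q) \<partial>lebesgue) *
        ennpowr (ennreal (1 / h) * (\<integral>\<^sup>+t\<in>{x - h..x}. ennreal (w t powr - conj_exp p) \<partial>lebesgue)) (q / conj_exp p)) \<le> 
      (case i of (x, h) \<Rightarrow>
        ennreal (1 / h) * (\<integral>\<^sup>+t\<in>{- x..- x + h}. ennreal (w t powr q) \<partial>lebesgue) *
        ennpowr (ennreal (1 / h) * (\<integral>\<^sup>+t\<in>{- x - h..- x}. ennreal (w t powr - conj_exp p) \<partial>lebesgue)) (q / conj_exp p))"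
      by (intro bexI[of _ "(- fst j, snd j)"]) (auto simp: case_prod_unfold add.commute)
  qed
qed

lemma Apq_reflect: "(\<lambda>x. w (- x)) \<in> Apq_plus p q \<longleftrightarrow> w \<in> Apq_minus p q"
  using weight_reflect[of w] weight_reflect[of "\<lambda>x. w (- x)"]
  by (auto simp: Apq_plus_def Apq_minus_def Apq_char_reflect)

lemma riemann_liouville_dom_reflect: "- x \<in> riemann_liouville_dom \<alpha> f \<longleftrightarrow> x \<in> weyl_dom \<alpha> (\<lambda>t. f (- t))"
  and riemann_liouville_reflect: "riemann_liouville \<alpha> f (- x) = weyl \<alpha> (\<lambda>t. f (- t)) x"
proof -
  define F where "F t = indicat_real {..<- x} t *\<^sub>R (f t / (- x - t) powr (1 - \<alpha>))" for t
  have F: "F (0 + - 1 * t) = indicat_real {x<..} t *\<^sub>R (f (- t) / (t - x) powr (1 - \<alpha>))" for t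
    by (auto simp: F_def split: split_indicator)
  show "- x \<in> riemann_liouville_dom \<alpha> f \<longleftrightarrow> x \<in> weyl_dom \<alpha> (\<lambda>t. f (- t))"
    unfolding riemann_liouville_dom_def weyl_dom_def set_integrable_def mem_Collect_eq F_def[symmetric] F[symmetric]
    using lebesgue_integrable_real_affine_iff[of "- 1" F 0] by simp
  show "riemann_liouville \<alpha> f (- x) = weyl \<alpha> (\<lambda>t. f (- t)) x"
    unfolding riemann_liouville_def weyl_def set_lebesgue_integral_def F_def[symmetric] F[symmetric]
    using lebesgue_integral_real_affine[of "- 1" F 0] by simp
qed

text \<open>It is applied to images under the operator, whose measurability is never established;
  hence \<open>nn_integral_reflect\<close> for arbitrary integrands.\<close>

lemma Lnorm_reflect: "Lnorm r (\<lambda>x. v (- x)) (\<lambda>x. f (- x)) = Lnorm r v f"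
  unfolding Lnorm_def using nn_integral_reflect[of "\<lambda>x. ennreal (\<bar>f x\<bar> powr r * v x)"] by simp

lemma weyl_norm_reflect: "weyl_norm \<alpha> p q (\<lambda>x. w (- x)) = riemann_liouville_norm \<alpha> p q w"
proof -
  have eq: "(if AE x in lebesgue. x \<in> weyl_dom \<alpha> (\<lambda>t. f (- t)) then Lnorm q (\<lambda>x. w (- x) powr q) (weyl \<alpha> (\<lambda>t. f (- t))) else \<infinity>) =
      (if AE x in lebesgue. x \<in> riemann_liouville_dom \<alpha> f then Lnorm q (\<lambda>x. w x powr q) (riemann_liouville \<alpha> f) else \<infinity>)" for f
    using AE_reflect[of "\<lambda>x. x \<in> riemann_liouville_dom \<alpha> f"]
      Lnorm_reflect[of q "\<lambda>x. w x powr q" "riemann_liouville \<alpha> f"]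
    by (simp add: riemann_liouville_dom_reflect riemann_liouville_reflect)
  have norm: "Lnorm p (\<lambda>x. w (- x) powr p) (\<lambda>t. f (- t)) = Lnorm p (\<lambda>x. w x powr p) f" for f
    by (rule Lnorm_reflect[of p "\<lambda>x. w x powr p" f])
  show ?thesis
    unfolding weyl_norm_def riemann_liouville_norm_def op_norm_def
  proof (rule SUP_eq)
    fix f assume f: "f \<in> {f \<in> borel_measurable lebesgue. Lnorm p (\<lambda>x. w (- x) powr p) f \<le> 1}"
    show "\<exists>g\<in>{f \<in> borel_measurable lebesgue. Lnorm p (\<lambda>x. w x powr p) f \<le> 1}.
        (if AE x in lebesgue. x \<in> weyl_dom \<alpha> f then Lnorm q (\<lambda>x. w (- x) powr q) (weyl \<alpha> f) else \<infinity>) \<le>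
        (if AE x in lebesgue. x \<in> riemann_liouville_dom \<alpha> g then Lnorm q (\<lambda>x. w x powr q) (riemann_liouville \<alpha> g) else \<infinity>)"
      using f eq[of "\<lambda>t. f (- t)"] norm[of "\<lambda>t. f (- t)"]
      by (intro bexI[of _ "\<lambda>t. f (- t)"]) (auto intro: borel_measurable_reflect)
  next
    fix f assume f: "f \<in> {f \<in> borel_measurable lebesgue. Lnorm p (\<lambda>x. w x powr p) f \<le> 1}"
    show "\<exists>g\<in>{f \<in> borel_measurable lebesgue. Lnorm p (\<lambda>x. w (- x) powr p) f \<le> 1}.
        (if AE x in lebesgue. x \<in> riemann_liouville_dom \<alpha> f then Lnorm q (\<lambda>x. w x powr q) (riemann_liouville \<alpha> f) else \<infinity>) \<le>
        (if AE x in lebesgue. x \<in> weyl_dom \<alpha> g then Lnorm q (\<lambda>x. w (- x) powr q) (weyl \<alpha> g) else \<infinity>)"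
      using f eq[of f] norm[of f]
      by (intro bexI[of _ "\<lambda>t. f (- t)"]) (auto intro: borel_measurable_reflect)
  qed
qed

subsection \<open>Sharpness\<close>

lemma ident_measurable_lebesgue [measurable]: "(\<lambda>x::real. x) \<in> borel_measurable lebesgue"
  by (rule measurable_completion) simp

lemma abs_powr_measurable [measurable]: "(\<lambda>x::real. \<bar>x\<bar> powr e) \<in> borel_measurable lebesgue"
  by (rule measurable_completion) simp

lemma abs_powr_indicator_measurable:
  "A \<in> sets lebesgue \<Longrightarrow> (\<lambda>x::real. ennreal (\<bar>x\<bar> powr e) * indicator A x) \<in> borel_measurable lebesgue"
  by (intro borel_measurable_times_ennreal measurable_compose[OF abs_powr_measurable measurable_ennreal]
      borel_measurable_indicator)

lemma nn_integral_powr: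
  assumes "- 1 < e" and "0 \<le> b"
  shows "(\<integral>\<^sup>+t\<in>{0..b}. ennreal (\<bar>t\<bar> powr e) \<partial>lebesgue) = ennreal (b powr (e + 1) / (e + 1))"
    and "(\<integral>\<^sup>+t\<in>{- b..0}. ennreal (\<bar>t\<bar> powr e) \<partial>lebesgue) = ennreal (b powr (e + 1) / (e + 1))"
proof -
  have "(\<integral>\<^sup>+t\<in>{0..b}. ennreal (\<bar>t\<bar> powr e) \<partial>lebesgue) = (\<integral>\<^sup>+t\<in>{0..b}. ennreal (t powr e) \<partial>lborel)"
    unfolding nn_integral_completion by (intro nn_integral_cong) (auto split: split_indicator)
  also have "\<dots> = ennreal (b powr (e + 1) / (e + 1))"
    by (rule nn_integral_has_integral_lebesgue'[OF _ has_integral_powr_from_0[OF assms]]) auto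
  finally show *: "(\<integral>\<^sup>+t\<in>{0..b}. ennreal (\<bar>t\<bar> powr e) \<partial>lebesgue) = ennreal (b powr (e + 1) / (e + 1))" .
  show "(\<integral>\<^sup>+t\<in>{- b..0}. ennreal (\<bar>t\<bar> powr e) \<partial>lebesgue) = ennreal (b powr (e + 1) / (e + 1))"
    using set_nn_integral_reflect[where a = 0 and b = b and g = "\<lambda>t. ennreal (\<bar>t\<bar> powr e)"] * by simp
qed

lemma set_nn_integral_le_const:
  assumes "\<And>t. t \<in> {a..b} \<Longrightarrow> g t \<le> c" and "a \<le> b"
  shows "(\<integral>\<^sup>+t\<in>{a..b}. g t \<partial>lebesgue) \<le> c * ennreal (b - a)"
proof -
  have "(\<integral>\<^sup>+t\<in>{a..b}. g t \<partial>lebesgue) \<le> (\<integral>\<^sup>+t. c * indicator {a..b} t \<partial>lebesgue)"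
    using assms by (intro nn_integral_mono) (auto split: split_indicator)
  then show ?thesis using assms by (simp add: nn_integral_cmult_indicator)
qed

lemma set_nn_integral_ge_const:
  assumes "\<And>t. t \<in> {a..b} \<Longrightarrow> c \<le> g t" and "a \<le> b"
  shows "c * ennreal (b - a) \<le> (\<integral>\<^sup>+t\<in>{a..b}. g t \<partial>lebesgue)"
proof -
  have "(\<integral>\<^sup>+t. c * indicator {a..b} t \<partial>lebesgue) \<le> (\<integral>\<^sup>+t\<in>{a..b}. g t \<partial>lebesgue)"
    using assms by (intro nn_integral_mono) (auto split: split_indicator)
  then show ?thesis using assms by (simp add: nn_integral_cmult_indicator)
qed

text \<open>Let y = |x| + h. If y <= 3 h, the interval is enlarged to [- y, y], of mass 2 y^d / d,
  which explains 6 = 2 * 3. Otherwise it stays at distance at least y / 3 from the singularity,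
  where the power is comparable with y^(d - 1).\<close>

lemma singular_average_le:
  assumes d: "0 < d" "d < 1" and h: "0 < h" and x: "x \<in> {a..a + h}"
  shows "ennreal (1 / h) * (\<integral>\<^sup>+t\<in>{a..a + h}. ennreal (\<bar>t\<bar> powr (d - 1)) \<partial>lebesgue) \<le>
    ennreal (6 / d * (\<bar>x\<bar> + h) powr (d - 1))"
proof -
  define y where "y = \<bar>x\<bar> + h"
  have y: "0 < y" using h by (simp add: y_def)
  have "(\<integral>\<^sup>+t\<in>{a..a + h}. ennreal (\<bar>t\<bar> powr (d - 1)) \<partial>lebesgue) \<le> ennreal (h * (6 / d * y powr (d - 1)))"
  proof (cases "y \<le> 3 * h")
    case True
    have "(\<integral>\<^sup>+t\<in>{a..a + h}. ennreal (\<bar>t\<bar> powr (d - 1)) \<partial>lebesgue) \<le>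
        (\<integral>\<^sup>+t. ennreal (\<bar>t\<bar> powr (d - 1)) * indicator {0..y} t + ennreal (\<bar>t\<bar> powr (d - 1)) * indicator {- y..0} t \<partial>lebesgue)"
      using x h by (intro nn_integral_mono) (auto simp: y_def split: split_indicator)
    also have "\<dots> = ennreal (y powr d / d) + ennreal (y powr d / d)"
      using d y by (subst nn_integral_add) (simp_all add: nn_integral_powr abs_powr_indicator_measurable)
    also have "\<dots> = ennreal (2 * (y * y powr (d - 1)) / d)"
      using d y by (simp add: ennreal_plus[symmetric] powr_diff del: ennreal_plus)
    also have "\<dots> \<le> ennreal (2 * (3 * h * y powr (d - 1)) / d)"
      using True d by (intro ennreal_leI divide_right_mono mult_left_mono mult_right_mono) auto
    finally show ?thesis by (simp add: mult_ac)
  next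
    case False
    have "(\<integral>\<^sup>+t\<in>{a..a + h}. ennreal (\<bar>t\<bar> powr (d - 1)) \<partial>lebesgue) \<le> ennreal (6 / d * y powr (d - 1)) * ennreal (a + h - a)"
    proof (intro set_nn_integral_le_const ennreal_leI)
      fix t assume "t \<in> {a..a + h}"
      then have "y / 3 \<le> \<bar>t\<bar>" using False x by (auto simp: y_def)
      then have "\<bar>t\<bar> powr (d - 1) \<le> (y / 3) powr (d - 1)" using d y by (intro powr_mono2') auto
      also have "\<dots> = 3 powr (1 - d) * y powr (d - 1)"
        using y by (simp add: powr_divide powr_diff)
      also have "\<dots> \<le> 6 / d * y powr (d - 1)"
      proof (rule mult_right_mono)
        have "3 powr (1 - d) \<le> 3 powr (1::real)" using d by (intro powr_mono) auto
        also have "\<dots> \<le> 6 / d" using d by (simp add: le_divide_eq)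
        finally show "3 powr (1 - d) \<le> 6 / d" .
      qed simp
      finally show "\<bar>t\<bar> powr (d - 1) \<le> 6 / d * y powr (d - 1)" .
    qed (use h in auto)
    then show ?thesis using h d by (simp add: ennreal_mult[symmetric] mult.commute)
  qed
  then have "ennreal (1 / h) * (\<integral>\<^sup>+t\<in>{a..a + h}. ennreal (\<bar>t\<bar> powr (d - 1)) \<partial>lebesgue) \<le>
      ennreal (1 / h) * ennreal (h * (6 / d * y powr (d - 1)))" by (rule mult_left_mono) simp
  also have "\<dots> = ennreal (6 / d * y powr (d - 1))" using h d by (simp add: ennreal_mult[symmetric])
  finally show ?thesis by (simp add: y_def)
qed

lemma regular_average_le:
  assumes c: "0 \<le> c" and h: "0 < h" and x: "x \<in> {a..a + h}"
  shows "ennreal (1 / h) * (\<integral>\<^sup>+t\<in>{a..a + h}. ennreal (\<bar>t\<bar> powr c) \<partial>lebesgue) \<le> ennreal ((\<bar>x\<bar> + h) powr c)"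
proof -
  have "(\<integral>\<^sup>+t\<in>{a..a + h}. ennreal (\<bar>t\<bar> powr c) \<partial>lebesgue) \<le> ennreal ((\<bar>x\<bar> + h) powr c) * ennreal (a + h - a)"
    using x h c by (intro set_nn_integral_le_const ennreal_leI powr_mono2) auto
  then have "ennreal (1 / h) * (\<integral>\<^sup>+t\<in>{a..a + h}. ennreal (\<bar>t\<bar> powr c) \<partial>lebesgue) \<le>
      ennreal (1 / h) * (ennreal ((\<bar>x\<bar> + h) powr c) * ennreal (a + h - a))" by (rule mult_left_mono) simp
  also have "\<dots> = ennreal ((\<bar>x\<bar> + h) powr c)" using h by (simp add: ennreal_mult[symmetric])
  finally show ?thesis .
qed

lemma one_le_average:
  assumes "0 < h" and "\<And>t. t \<in> {a..a + h} \<Longrightarrow> 1 \<le> v t"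
  shows "1 \<le> ennreal (1 / h) * (\<integral>\<^sup>+t\<in>{a..a + h}. ennreal (v t) \<partial>lebesgue)"
proof -
  have "1 \<le> ennreal (v t)" if "t \<in> {a..a + h}" for t
    using ennreal_leI[OF assms(2)[OF that]] by simp
  then have "1 * ennreal (a + h - a) \<le> (\<integral>\<^sup>+t\<in>{a..a + h}. ennreal (v t) \<partial>lebesgue)"
    using assms(1) by (intro set_nn_integral_ge_const) auto
  then have "ennreal (1 / h) * (1 * ennreal (a + h - a)) \<le> ennreal (1 / h) * (\<integral>\<^sup>+t\<in>{a..a + h}. ennreal (v t) \<partial>lebesgue)"
    by (rule mult_left_mono) simp
  moreover have "ennreal (1 / h) * (1 * ennreal (a + h - a)) = 1" using assms by (simp add: ennreal_mult[symmetric])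
  ultimately show ?thesis by simp
qed

lemma weight_abs_powr:
  assumes "- 1 < e" shows "weight (\<lambda>x. \<bar>x\<bar> powr e)"
  unfolding weight_def
proof (intro conjI allI)
  have "AE x in lborel. x \<noteq> (0::real)" by (rule AE_lborel_singleton)
  then have "AE x in lebesgue. x \<noteq> (0::real)" by (rule AE_completion)
  then show "AE x in lebesgue. 0 < \<bar>x::real\<bar> powr e" by eventually_elim simp
  fix a b :: real
  define y where "y = max \<bar>a\<bar> \<bar>b\<bar>"
  have y: "0 \<le> y" "{a..b} \<subseteq> {0..y} \<union> {- y..0}" by (auto simp: y_def)
  have "(\<integral>\<^sup>+t\<in>{a..b}. ennreal (\<bar>t\<bar> powr e) \<partial>lebesgue) \<le>
      (\<integral>\<^sup>+t. ennreal (\<bar>t\<bar> powr e) * indicator {0..y} t + ennreal (\<bar>t\<bar> powr e) * indicator {- y..0} t \<partial>lebesgue)"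
    using y by (intro nn_integral_mono) (auto split: split_indicator)
  also have "\<dots> = ennreal (y powr (e + 1) / (e + 1)) + ennreal (y powr (e + 1) / (e + 1))"
    using assms y by (subst nn_integral_add) (simp_all add: nn_integral_powr abs_powr_indicator_measurable)
  finally have "(\<integral>\<^sup>+t\<in>{a..b}. ennreal (\<bar>t\<bar> powr e) \<partial>lebesgue) < \<infinity>" by (auto intro: le_less_trans)
  moreover have "(\<integral>\<^sup>+t. ennreal (norm (indicator {a..b} t *\<^sub>R \<bar>t\<bar> powr e)) \<partial>lebesgue) =
      (\<integral>\<^sup>+t\<in>{a..b}. ennreal (\<bar>t\<bar> powr e) \<partial>lebesgue)"
    by (intro nn_integral_cong) (auto split: split_indicator)
  moreover have "(\<lambda>t. indicator {a..b} t *\<^sub>R \<bar>t\<bar> powr e) \<in> borel_measurable lebesgue" by measurable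
  ultimately have "integrable lebesgue (\<lambda>t. indicator {a..b} t *\<^sub>R \<bar>t\<bar> powr e)"
    by (simp add: integrable_iff_bounded)
  then show "(\<lambda>x. \<bar>x\<bar> powr e) absolutely_integrable_on {a..b}" by (simp add: set_integrable_def)
qed

text \<open>Dividing f by A^(1/p) puts it into the unit ball. If the operator is undefined on a set
  of positive measure for this function, the norm is infinite; otherwise nonnegativity makes
  \<open>weyl\<close> and \<open>weyl_abs\<close> agree almost everywhere.\<close>

lemma weyl_norm_lower:
  assumes [measurable]: "f \<in> borel_measurable lebesgue" "w \<in> borel_measurable lebesgue"
      "G \<in> borel_measurable lebesgue" "E \<in> sets lebesgue"
    and f0: "\<And>x. 0 \<le> f x"
    and p: "0 < p" and q: "0 < q" and A: "0 < A" and B: "0 \<le> B"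
    and fA: "(\<integral>\<^sup>+x. ennreal (f x powr p * w x powr p) \<partial>lebesgue) \<le> ennreal A"
    and G0: "\<And>x. x \<in> E \<Longrightarrow> 0 \<le> G x" and G: "\<And>x. x \<in> E \<Longrightarrow> ennreal (G x) \<le> weyl_abs \<alpha> f x"
    and GB: "ennreal B \<le> (\<integral>\<^sup>+x\<in>E. ennreal (G x powr q * w x powr q) \<partial>lebesgue)"
  shows "ennreal (B powr (1 / q) / A powr (1 / p)) \<le> weyl_norm \<alpha> p q w"
proof -
  define c where "c = 1 / A powr (1 / p)"
  have c: "0 < c" using A by (simp add: c_def)
  have cp: "c powr p = 1 / A" using A p by (simp add: c_def powr_divide powr_powr)
  define g where "g x = c * f x" for x
  have g0: "0 \<le> g x" for x using c f0 by (simp add: g_def)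
  have [measurable]: "g \<in> borel_measurable lebesgue" unfolding g_def by measurable
  have unit: "Lnorm p (\<lambda>x. w x powr p) g \<le> 1"
  proof -
    have "(\<integral>\<^sup>+x. ennreal (\<bar>g x\<bar> powr p * w x powr p) \<partial>lebesgue) =
        (\<integral>\<^sup>+x. ennreal (1 / A) * ennreal (f x powr p * w x powr p) \<partial>lebesgue)"
    proof (rule nn_integral_cong)
      fix x
      have "\<bar>g x\<bar> powr p = 1 / A * f x powr p" using c f0[of x] by (simp add: g_def abs_mult powr_mult cp)
      then show "ennreal (\<bar>g x\<bar> powr p * w x powr p) = ennreal (1 / A) * ennreal (f x powr p * w x powr p)"
        using A by (simp add: ennreal_mult[symmetric])
    qed
    also have "\<dots> = ennreal (1 / A) * (\<integral>\<^sup>+x. ennreal (f x powr p * w x powr p) \<partial>lebesgue)"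
      by (rule nn_integral_cmult) measurable
    also have "\<dots> \<le> ennreal (1 / A) * ennreal A" by (intro mult_left_mono fA) simp
    also have "\<dots> = 1" using A by (simp add: ennreal_mult[symmetric])
    finally show ?thesis unfolding Lnorm_def using p by (subst ennpowr_le_iff) (auto simp: ennpowr_def)
  qed
  have "ennreal (B powr (1 / q) / A powr (1 / p)) \<le>
      (if AE x in lebesgue. x \<in> weyl_dom \<alpha> g then Lnorm q (\<lambda>x. w x powr q) (weyl \<alpha> g) else \<infinity>)"
  proof (cases "AE x in lebesgue. x \<in> weyl_dom \<alpha> g")
    case True
    have "ennreal (c powr q) * ennreal B \<le> ennreal (c powr q) * (\<integral>\<^sup>+x\<in>E. ennreal (G x powr q * w x powr q) \<partial>lebesgue)"
      by (intro mult_left_mono GB) simp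
    also have "\<dots> = (\<integral>\<^sup>+x. ennreal (c powr q) * (ennreal (G x powr q * w x powr q) * indicator E x) \<partial>lebesgue)"
      by (rule nn_integral_cmult[symmetric]) measurable
    also have "\<dots> \<le> (\<integral>\<^sup>+x. ennreal (\<bar>weyl \<alpha> g x\<bar> powr q * w x powr q) \<partial>lebesgue)"
      using True
    proof (intro nn_integral_mono_AE, eventually_elim)
      case (elim x)
      show ?case
      proof (cases "x \<in> E")
        case True
        have pt: "ennreal (indicator {x<..} t *\<^sub>R (g t / (t - x) powr (1 - \<alpha>))) = ennreal c * (ennreal (\<bar>f t\<bar> / (t - x) powr (1 - \<alpha>)) * indicator {x<..} t)" for t
          using c f0[of t] by (auto simp: g_def ennreal_mult[symmetric] split: split_indicator)
        have "ennreal (weyl \<alpha> g x) = (\<integral>\<^sup>+t. ennreal (indicator {x<..} t *\<^sub>R (g t / (t - x) powr (1 - \<alpha>))) \<partial>lebesgue)"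
          unfolding weyl_def set_lebesgue_integral_def
          using elim g0 by (intro nn_integral_eq_integral[symmetric]) (auto simp: weyl_dom_def set_integrable_def)
        also have "\<dots> = ennreal c * weyl_abs \<alpha> f x"
          unfolding pt weyl_abs_def by (rule nn_integral_cmult) measurable
        finally have "ennreal c * ennreal (G x) \<le> ennreal (weyl \<alpha> g x)"
          using mult_left_mono[OF G[OF True], of "ennreal c"] by simp
        then have "ennreal (c * G x) \<le> ennreal (weyl \<alpha> g x)" using c G0[OF True] by (simp add: ennreal_mult)
        then have "c * G x \<le> \<bar>weyl \<alpha> g x\<bar>"
          using c G0[OF True] by (cases "0 \<le> weyl \<alpha> g x") (auto simp: ennreal_le_iff ennreal_neg)
        then have "(c * G x) powr q \<le> \<bar>weyl \<alpha> g x\<bar> powr q" using c G0[OF True] q by (intro powr_mono2) auto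
        then have "c powr q * G x powr q * w x powr q \<le> \<bar>weyl \<alpha> g x\<bar> powr q * w x powr q"
          using c G0[OF True] by (intro mult_right_mono) (auto simp: powr_mult)
        then show ?thesis using True by (simp add: ennreal_mult[symmetric] ennreal_leI mult.assoc)
      qed simp
    qed
    finally have "ennreal (c powr q * B) \<le> (\<integral>\<^sup>+x. ennreal (\<bar>weyl \<alpha> g x\<bar> powr q * w x powr q) \<partial>lebesgue)"
      using B by (simp add: ennreal_mult)
    then have "ennpowr (ennreal (c powr q * B)) (1 / q) \<le> Lnorm q (\<lambda>x. w x powr q) (weyl \<alpha> g)"
      unfolding Lnorm_def using q by (intro ennpowr_mono) auto
    moreover have "(c powr q * B) powr (1 / q) = B powr (1 / q) / A powr (1 / p)"
      using B c q by (simp add: powr_mult powr_powr) (simp add: c_def)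
    ultimately show ?thesis using True B by (simp add: ennpowr_ennreal)
  qed simp
  also have "\<dots> \<le> weyl_norm \<alpha> p q w"
    unfolding weyl_norm_def op_norm_def by (rule SUP_upper) (use unit in simp)
  finally show ?thesis .
qed

lemma mult_powr_add: "0 \<le> x \<Longrightarrow> x powr a * x powr b = x powr (a + b)" for x :: real
  by (simp add: powr_add)

context
  fixes \<alpha> p q p' :: real
  assumes \<alpha>: "0 < \<alpha>" "\<alpha> < 1" and p: "1 < p" and q: "1 < q" and p': "1 < p'"
    and pp': "1 / p + 1 / p' = 1" and pq: "1 / p - 1 / q = \<alpha>" and p'_eq: "p' = conj_exp p"
begin

text \<open>The test function is t^(d - \<alpha>) on [0, 1]. Seen from - y, the integrand is at
  least t^(d - 1) / 2 for t >= y, so the image is of order 1 / d near 0. The u-mass there is also of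
  order 1 / d, and the integral of f^p w^p is at most 1 / d; the quotient has order d^(1/p - 1/q -
  1) = d^(- (1 - \<alpha>)).\<close>

lemma singular_u_family:
  assumes d: "0 < d" "d < 1"
  defines "w \<equiv> \<lambda>x::real. \<bar>x\<bar> powr ((d - 1) / q)"
  shows "w \<in> Apq_plus p q" and "1 \<le> Apq_plus_char p q w" and "Apq_plus_char p q w \<le> ennreal (6 / d)"
    and "ennreal (1 / 8 * d powr (- (1 - \<alpha>))) \<le> weyl_norm \<alpha> p q w"
proof -
  define c where "c = (1 - d) * p' / q"
  have c: "0 \<le> c" using d q p' by (simp add: c_def)
  have u: "w t powr q = \<bar>t\<bar> powr (d - 1)" for t using q by (simp add: w_def powr_powr)
  have \<sigma>: "w t powr (- p') = \<bar>t\<bar> powr c" for t by (simp add: w_def c_def powr_powr) (simp add: algebra_simps diff_divide_distrib)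
  have e: "0 < q / p'" using q p' by simp
  have wgt: "weight w" unfolding w_def
  proof (rule weight_abs_powr)
    have "(1 - d) / q < 1" using d q by (simp add: divide_less_eq)
    then show "- 1 < (d - 1) / q" by (simp add: diff_divide_distrib)
  qed
  have unfold_char: "Apq_plus_char p q w = (SUP (x, h) \<in> UNIV \<times> {0<..}.
       (ennreal (1 / h) * (\<integral>\<^sup>+ t\<in>{x - h..x}. ennreal (\<bar>t\<bar> powr (d - 1)) \<partial>lebesgue)) *
       ennpowr (ennreal (1 / h) * (\<integral>\<^sup>+ t\<in>{x..x + h}. ennreal (\<bar>t\<bar> powr c) \<partial>lebesgue)) (q / p'))"
    unfolding Apq_plus_char_def p'_eq[symmetric] u \<sigma> ..
  show char_le: "Apq_plus_char p q w \<le> ennreal (6 / d)"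
    unfolding unfold_char
  proof (rule SUP_least, safe)
    fix x h :: real assume h: "0 < h"
    have y: "0 < \<bar>x\<bar> + h" using h by simp
    have "(ennreal (1 / h) * (\<integral>\<^sup>+ t\<in>{x - h..x}. ennreal (\<bar>t\<bar> powr (d - 1)) \<partial>lebesgue)) *
       ennpowr (ennreal (1 / h) * (\<integral>\<^sup>+ t\<in>{x..x + h}. ennreal (\<bar>t\<bar> powr c) \<partial>lebesgue)) (q / p') \<le>
       ennreal (6 / d * (\<bar>x\<bar> + h) powr (d - 1)) * ennpowr (ennreal ((\<bar>x\<bar> + h) powr c)) (q / p')"
      using singular_average_le[OF d h, of x "x - h"] regular_average_le[OF c h, of x x] h e
      by (intro mult_mono ennpowr_mono) auto
    also have "\<dots> = ennreal (6 / d)"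
    proof -
      have "c * (q / p') = 1 - d" using q p' by (simp add: c_def)
      then have "((\<bar>x\<bar> + h) powr c) powr (q / p') = (\<bar>x\<bar> + h) powr (1 - d)" by (simp only: powr_powr)
      then show ?thesis using d y by (simp add: ennpowr_ennreal ennreal_mult[symmetric] mult.assoc mult_powr_add)
    qed
    finally show "(ennreal (1 / h) * (\<integral>\<^sup>+ t\<in>{x - h..x}. ennreal (\<bar>t\<bar> powr (d - 1)) \<partial>lebesgue)) *
       ennpowr (ennreal (1 / h) * (\<integral>\<^sup>+ t\<in>{x..x + h}. ennreal (\<bar>t\<bar> powr c) \<partial>lebesgue)) (q / p') \<le> ennreal (6 / d)" .
  qed
  show "w \<in> Apq_plus p q" using wgt char_le by (auto simp: Apq_plus_def intro: le_less_trans)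
  show "1 \<le> Apq_plus_char p q w"
  proof -
    have "1 * ennpowr 1 (q / p') \<le>
       (ennreal (1 / (1 / 2)) * (\<integral>\<^sup>+ t\<in>{1 / 2..1 / 2 + 1 / 2}. ennreal (\<bar>t\<bar> powr (d - 1)) \<partial>lebesgue)) *
       ennpowr (ennreal (1 / (1 / 2)) * (\<integral>\<^sup>+ t\<in>{1..1 + 1 / 2}. ennreal (\<bar>t\<bar> powr c) \<partial>lebesgue)) (q / p')"
    proof (intro mult_mono ennpowr_mono one_le_average)
      fix t :: real assume "t \<in> {1 / 2..1 / 2 + 1 / 2}"
      then have "1 powr (d - 1) \<le> \<bar>t\<bar> powr (d - 1)" using d by (intro powr_mono2') auto
      then show "1 \<le> \<bar>t\<bar> powr (d - 1)" by simp
    next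
      fix t :: real assume "t \<in> {1..1 + 1 / 2}"
      then show "1 \<le> \<bar>t\<bar> powr c" using c by (intro ge_one_powr_ge_zero) auto
    qed (use e in auto)
    also have "\<dots> \<le> Apq_plus_char p q w"
      unfolding unfold_char by (rule order_trans[OF _ SUP_upper[of "(1, 1 / 2)"]]) auto
    finally show ?thesis by (simp add: ennpowr_def)
  qed
  \<comment> \<open>For y <= a at least half of the integral of t^(d - 1) over [0, 1] lies beyond y,
    while [- a, 0] still carries half of the u-mass of [- 1, 0].\<close>
  define a where "a = (1 / 2) powr (1 / d)"
  have a: "0 < a" "a \<le> 1" "a powr d = 1 / 2"
    using d by (auto simp: a_def powr_powr intro!: powr_le1)
  define f where "f t = \<bar>t\<bar> powr (d - \<alpha>) * indicat_real {0..1} t" for t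
  have [measurable]: "f \<in> borel_measurable lebesgue" unfolding f_def by measurable
  have [measurable]: "w \<in> borel_measurable lebesgue" unfolding w_def by measurable
  have "ennreal ((1 / (2 * d) * (1 / (4 * d)) powr q) powr (1 / q) / (1 / d) powr (1 / p)) \<le> weyl_norm \<alpha> p q w"
  proof (rule weyl_norm_lower[where f = f and G = "\<lambda>_. 1 / (4 * d)" and E = "{- a..0}"])
    show "(\<integral>\<^sup>+x. ennreal (f x powr p * w x powr p) \<partial>lebesgue) \<le> ennreal (1 / d)"
    proof -
      define e where "e = (d - \<alpha>) * p + (d - 1) / q * p"
      have "p / q = 1 - \<alpha> * p" using pq p by (simp add: field_simps)
      then have e_eq: "e + 1 = d * p + d * (p / q)" by (simp add: e_def algebra_simps diff_divide_distrib)
      have e_ge: "d \<le> e + 1" unfolding e_eq using d p q by (simp add: add_increasing2)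
      have "(\<integral>\<^sup>+x. ennreal (f x powr p * w x powr p) \<partial>lebesgue) = (\<integral>\<^sup>+t\<in>{0..1}. ennreal (\<bar>t\<bar> powr e) \<partial>lebesgue)"
        by (intro nn_integral_cong) (auto simp: f_def w_def e_def powr_powr powr_add powr_mult split: split_indicator)
      also have "\<dots> = ennreal (1 / (e + 1))" using e_ge d by (subst nn_integral_powr) auto
      also have "\<dots> \<le> ennreal (1 / d)" using e_ge d by (intro ennreal_leI divide_left_mono) auto
      finally show ?thesis .
    qed
    show "ennreal (1 / (4 * d)) \<le> weyl_abs \<alpha> f x" if x: "x \<in> {- a..0}" for x
    proof -
      define y where "y = - x"
      have y: "0 \<le> y" "y \<le> a" "y \<le> 1" using x a by (auto simp: y_def)
      have yd: "y powr d \<le> 1 / 2" using powr_mono2[of d y a] y d a by simp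
      define I where "I = (\<integral>\<^sup>+t\<in>{y..1}. ennreal (\<bar>t\<bar> powr (d - 1)) \<partial>lebesgue)"
      have "ennreal (1 / d) = (\<integral>\<^sup>+t\<in>{0..1}. ennreal (\<bar>t\<bar> powr (d - 1)) \<partial>lebesgue)"
        using d by (subst nn_integral_powr) auto
      also have "\<dots> \<le> (\<integral>\<^sup>+t. ennreal (\<bar>t\<bar> powr (d - 1)) * indicator {0..y} t + ennreal (\<bar>t\<bar> powr (d - 1)) * indicator {y..1} t \<partial>lebesgue)"
        by (intro nn_integral_mono) (auto split: split_indicator)
      also have "\<dots> = ennreal (y powr d / d) + I"
        using d y by (subst nn_integral_add) (simp_all add: nn_integral_powr abs_powr_indicator_measurable I_def)
      finally have "ennreal (1 / d) \<le> ennreal (y powr d / d) + I" .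
      moreover have "ennreal (y powr d / d) \<le> ennreal (1 / (2 * d))"
        using divide_right_mono[OF yd, of d] d by (intro ennreal_leI) simp
      ultimately have "ennreal (1 / (2 * d)) + ennreal (1 / (2 * d)) \<le> ennreal (1 / (2 * d)) + I"
        using d by (simp add: ennreal_plus[symmetric] add_right_mono order_trans[OF _ add_right_mono] del: ennreal_plus)
      then have I: "ennreal (1 / (2 * d)) \<le> I" by (simp add: ennreal_add_left_cancel_le)
      have "ennreal (1 / (4 * d)) = ennreal (1 / 2) * ennreal (1 / (2 * d))"
        using d by (subst ennreal_mult[symmetric]) auto
      also have "\<dots> \<le> ennreal (1 / 2) * I" by (rule mult_left_mono[OF I]) simp
      also have "\<dots> = (\<integral>\<^sup>+t. ennreal (1 / 2) * (ennreal (\<bar>t\<bar> powr (d - 1)) * indicator {y..1} t) \<partial>lebesgue)"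
        unfolding I_def by (rule nn_integral_cmult[symmetric]) (simp add: abs_powr_indicator_measurable)
      also have "\<dots> \<le> weyl_abs \<alpha> f x"
        unfolding weyl_abs_def
      proof (intro nn_integral_mono_AE)
        have "AE t in lborel. t \<noteq> (0::real)" by (rule AE_lborel_singleton)
        then have "AE t in lebesgue. t \<noteq> (0::real)" by (rule AE_completion)
        then show "AE t in lebesgue. ennreal (1 / 2) * (ennreal (\<bar>t\<bar> powr (d - 1)) * indicator {y..1} t) \<le>
            ennreal (\<bar>f t\<bar> / (t - x) powr (1 - \<alpha>)) * indicator {x<..} t"
        proof eventually_elim
          case (elim t)
          show ?case
          proof (cases "t \<in> {y..1}")
            case True
            then have t: "0 < t" "y \<le> t" "t \<le> 1" "x < t" using elim y by (auto simp: y_def)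
            have "(t - x) powr (1 - \<alpha>) \<le> (2 * t) powr (1 - \<alpha>)"
              using t y \<alpha> by (intro powr_mono2) (auto simp: y_def)
            also have "\<dots> = 2 powr (1 - \<alpha>) * t powr (1 - \<alpha>)" using t by (simp add: powr_mult)
            also have "\<dots> \<le> 2 powr 1 * t powr (1 - \<alpha>)" using \<alpha> by (intro mult_right_mono powr_mono) auto
            finally have "(t - x) powr (1 - \<alpha>) \<le> 2 * t powr (1 - \<alpha>)" by simp
            then have "t powr (d - \<alpha>) / (2 * t powr (1 - \<alpha>)) \<le> t powr (d - \<alpha>) / (t - x) powr (1 - \<alpha>)"
              using t by (intro divide_left_mono) auto
            moreover have "t powr (d - \<alpha>) / (2 * t powr (1 - \<alpha>)) = 1 / 2 * t powr (d - 1)"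
              using t by (simp add: powr_diff)
            ultimately have "ennreal (1 / 2 * t powr (d - 1)) \<le> ennreal (t powr (d - \<alpha>) / (t - x) powr (1 - \<alpha>))"
              by (intro ennreal_leI) simp
            also have "ennreal (1 / 2 * t powr (d - 1)) = ennreal (1 / 2) * ennreal (t powr (d - 1))"
              by (rule ennreal_mult) auto
            finally show ?thesis using t y True by (simp add: f_def)
          qed simp
        qed
      qed
      finally show ?thesis .
    qed
    show "ennreal (1 / (2 * d) * (1 / (4 * d)) powr q) \<le> (\<integral>\<^sup>+x\<in>{- a..0}. ennreal ((1 / (4 * d)) powr q * w x powr q) \<partial>lebesgue)"
    proof -
      have "(\<integral>\<^sup>+x\<in>{- a..0}. ennreal ((1 / (4 * d)) powr q * w x powr q) \<partial>lebesgue) =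
          (\<integral>\<^sup>+x. ennreal ((1 / (4 * d)) powr q) * (ennreal (\<bar>x\<bar> powr (d - 1)) * indicator {- a..0} x) \<partial>lebesgue)"
        by (intro nn_integral_cong) (auto simp: u ennreal_mult split: split_indicator)
      also have "\<dots> = ennreal ((1 / (4 * d)) powr q) * ennreal (a powr d / d)"
        using a d by (subst nn_integral_cmult) (simp_all add: abs_powr_indicator_measurable nn_integral_powr)
      also have "\<dots> = ennreal (1 / (2 * d) * (1 / (4 * d)) powr q)"
        unfolding a(3) using d by (subst ennreal_mult[symmetric]) (auto simp: mult_ac)
      finally show ?thesis by simp
    qed
  qed (use p q d in \<open>auto simp: f_def\<close>)
  moreover have "1 / 8 * d powr (- (1 - \<alpha>)) \<le> (1 / (2 * d) * (1 / (4 * d)) powr q) powr (1 / q) / (1 / d) powr (1 / p)"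
  proof -
    have "(1 / (2 * d) * (1 / (4 * d)) powr q) powr (1 / q) / (1 / d) powr (1 / p) =
        1 / (2 powr (1 / q) * 4) * (d powr (1 / p) / (d powr (1 / q) * d))"
      using d q by (simp add: powr_mult powr_divide powr_powr)
    also have "d powr (1 / p) / (d powr (1 / q) * d) = d powr (- (1 - \<alpha>))"
    proof -
      have "d powr (1 / p) / (d powr (1 / q) * d powr 1) = d powr (1 / p - (1 / q + 1))"
        unfolding powr_diff powr_add ..
      then show ?thesis using d pq by (simp add: algebra_simps)
    qed
    also have "1 / (2 powr (1 / q) * 4) * d powr (- (1 - \<alpha>)) \<ge> 1 / 8 * d powr (- (1 - \<alpha>))"
    proof (intro mult_right_mono divide_left_mono)
      have "2 powr (1 / q) \<le> 2 powr (1::real)" using q by (intro powr_mono) (auto simp: divide_le_eq)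
      then show "2 powr (1 / q) * 4 \<le> (8::real)" by simp
    qed auto
    finally show ?thesis .
  qed
  ultimately show "ennreal (1 / 8 * d powr (- (1 - \<alpha>))) \<le> weyl_norm \<alpha> p q w"
    by (meson ennreal_leI order_trans)
qed

text \<open>The test function is \<sigma> on [0, 1], for which f^p w^p = \<sigma>. From - y the
  kernel on [0, y] is at least y^(\<alpha> - 1) / 2, which yields \<open>G\<close>. Then G^q u is a
  multiple of |x|^(d q / p - 1), whose integral over [- 1, 0] again has order 1 / d. The norm grows
  as in the other family, but the characteristic is now bounded by a multiple of d^(- q /
  p').\<close>

lemma singular_\<sigma>_family:
  assumes d: "0 < d" "d < 1"
  defines "w \<equiv> \<lambda>x::real. \<bar>x\<bar> powr ((1 - d) / p')"
  shows "w \<in> Apq_plus p q" and "1 \<le> Apq_plus_char p q w" and "Apq_plus_char p q w \<le> ennreal ((6 / d) powr (q / p'))"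
    and "ennreal (1 / 2 * (p / q) powr (1 / q) * d powr (- (1 - \<alpha>))) \<le> weyl_norm \<alpha> p q w"
proof -
  define c where "c = (1 - d) * q / p'"
  have c: "0 \<le> c" using d q p' by (simp add: c_def)
  have u: "w t powr q = \<bar>t\<bar> powr c" for t by (simp add: w_def c_def powr_powr)
  have \<sigma>: "w t powr (- p') = \<bar>t\<bar> powr (d - 1)" for t using p' by (simp add: w_def powr_powr)
  have e: "0 < q / p'" using q p' by simp
  have wgt: "weight w" unfolding w_def
    by (rule weight_abs_powr, rule less_le_trans[of _ 0]) (use d p' in auto)
  have unfold_char: "Apq_plus_char p q w = (SUP (x, h) \<in> UNIV \<times> {0<..}.
       (ennreal (1 / h) * (\<integral>\<^sup>+ t\<in>{x - h..x}. ennreal (\<bar>t\<bar> powr c) \<partial>lebesgue)) *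
       ennpowr (ennreal (1 / h) * (\<integral>\<^sup>+ t\<in>{x..x + h}. ennreal (\<bar>t\<bar> powr (d - 1)) \<partial>lebesgue)) (q / p'))"
    unfolding Apq_plus_char_def p'_eq[symmetric] u \<sigma> ..
  show char_le: "Apq_plus_char p q w \<le> ennreal ((6 / d) powr (q / p'))"
    unfolding unfold_char
  proof (rule SUP_least, safe)
    fix x h :: real assume h: "0 < h"
    have y: "0 < \<bar>x\<bar> + h" using h by simp
    have "(ennreal (1 / h) * (\<integral>\<^sup>+ t\<in>{x - h..x}. ennreal (\<bar>t\<bar> powr c) \<partial>lebesgue)) *
       ennpowr (ennreal (1 / h) * (\<integral>\<^sup>+ t\<in>{x..x + h}. ennreal (\<bar>t\<bar> powr (d - 1)) \<partial>lebesgue)) (q / p') \<le>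
       ennreal ((\<bar>x\<bar> + h) powr c) * ennpowr (ennreal (6 / d * (\<bar>x\<bar> + h) powr (d - 1))) (q / p')"
      using singular_average_le[OF d h, of x x] regular_average_le[OF c h, of x "x - h"] h e
      by (intro mult_mono ennpowr_mono) auto
    also have "\<dots> = ennreal ((6 / d) powr (q / p'))"
    proof -
      have "(d - 1) * (q / p') = - c" by (simp add: c_def algebra_simps diff_divide_distrib)
      then have "(6 / d * (\<bar>x\<bar> + h) powr (d - 1)) powr (q / p') = (6 / d) powr (q / p') * (\<bar>x\<bar> + h) powr (- c)"
        using d by (subst powr_mult) (auto simp: powr_powr)
      moreover have "(\<bar>x\<bar> + h) powr c * (\<bar>x\<bar> + h) powr (- c) = 1"
        using y by (simp add: powr_add[symmetric])
      ultimately show ?thesis using d y by (simp add: ennpowr_ennreal ennreal_mult[symmetric] mult.left_commute)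
    qed
    finally show "(ennreal (1 / h) * (\<integral>\<^sup>+ t\<in>{x - h..x}. ennreal (\<bar>t\<bar> powr c) \<partial>lebesgue)) *
       ennpowr (ennreal (1 / h) * (\<integral>\<^sup>+ t\<in>{x..x + h}. ennreal (\<bar>t\<bar> powr (d - 1)) \<partial>lebesgue)) (q / p') \<le> ennreal ((6 / d) powr (q / p'))" .
  qed
  show "w \<in> Apq_plus p q" using wgt char_le by (auto simp: Apq_plus_def intro: le_less_trans)
  show "1 \<le> Apq_plus_char p q w"
  proof -
    have "1 * ennpowr 1 (q / p') \<le>
       (ennreal (1 / (1 / 2)) * (\<integral>\<^sup>+ t\<in>{- 3 / 2..- 3 / 2 + 1 / 2}. ennreal (\<bar>t\<bar> powr c) \<partial>lebesgue)) *
       ennpowr (ennreal (1 / (1 / 2)) * (\<integral>\<^sup>+ t\<in>{- 1..- 1 + 1 / 2}. ennreal (\<bar>t\<bar> powr (d - 1)) \<partial>lebesgue)) (q / p')"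
    proof (intro mult_mono ennpowr_mono one_le_average)
      fix t :: real assume "t \<in> {- 1..- 1 + 1 / 2}"
      then have "1 powr (d - 1) \<le> \<bar>t\<bar> powr (d - 1)" using d by (intro powr_mono2') auto
      then show "1 \<le> \<bar>t\<bar> powr (d - 1)" by simp
    next
      fix t :: real assume "t \<in> {- 3 / 2..- 3 / 2 + 1 / 2}"
      then show "1 \<le> \<bar>t\<bar> powr c" using c by (intro ge_one_powr_ge_zero) auto
    qed (use e in auto)
    also have "\<dots> \<le> Apq_plus_char p q w"
      unfolding unfold_char by (rule order_trans[OF _ SUP_upper[of "(- 1, 1 / 2)"]]) auto
    finally show ?thesis by (simp add: ennpowr_def)
  qed
  define f where "f t = \<bar>t\<bar> powr (d - 1) * indicat_real {0..1} t" for t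
  define G where "G x = \<bar>x\<bar> powr (\<alpha> - 1 + d) / (2 * d)" for x
  have [measurable]: "f \<in> borel_measurable lebesgue" unfolding f_def by measurable
  have [measurable]: "G \<in> borel_measurable lebesgue" unfolding G_def by measurable
  have [measurable]: "w \<in> borel_measurable lebesgue" unfolding w_def by measurable
  have "ennreal ((p / (q * d) * (1 / (2 * d)) powr q) powr (1 / q) / (1 / d) powr (1 / p)) \<le> weyl_norm \<alpha> p q w"
  proof (rule weyl_norm_lower[where f = f and G = G and E = "{- 1..0}"])
    show "(\<integral>\<^sup>+x. ennreal (f x powr p * w x powr p) \<partial>lebesgue) \<le> ennreal (1 / d)"
    proof -
      have "1 - 1 / p' = 1 / p" using pp' by linarith
      then have "p - p / p' = 1" using p by (simp add: field_simps)
      moreover have "(d - 1) * p + (1 - d) / p' * p = (d - 1) * (p - p / p')"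
        by (simp add: algebra_simps diff_divide_distrib)
      ultimately have ex: "(d - 1) * p + (1 - d) / p' * p = d - 1" by simp
      have "(\<integral>\<^sup>+x. ennreal (f x powr p * w x powr p) \<partial>lebesgue) = (\<integral>\<^sup>+t\<in>{0..1}. ennreal (\<bar>t\<bar> powr ((d - 1) * p + (1 - d) / p' * p)) \<partial>lebesgue)"
        by (intro nn_integral_cong) (auto simp: f_def w_def powr_powr powr_add powr_mult split: split_indicator)
      also have "\<dots> = ennreal (1 / d)" unfolding ex using d by (subst nn_integral_powr) auto
      finally show ?thesis by simp
    qed
    show "ennreal (G x) \<le> weyl_abs \<alpha> f x" if x: "x \<in> {- 1..0}" for x
    proof (cases "x = 0")
      case True
      \<comment> \<open>Since 0 powr anything is 0, \<open>G\<close> vanishes here.\<close>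
      then show ?thesis by (simp add: G_def)
    next
      case False
      define y where "y = - x"
      have y: "0 < y" "y \<le> 1" "\<bar>x\<bar> = y" using x False by (auto simp: y_def)
      define k where "k = y powr (\<alpha> - 1) / 2"
      have "ennreal (G x) = ennreal k * ennreal (y powr d / d)"
        using y d by (simp add: G_def k_def ennreal_mult[symmetric] powr_add)
      also have "\<dots> = ennreal k * (\<integral>\<^sup>+t\<in>{0..y}. ennreal (\<bar>t\<bar> powr (d - 1)) \<partial>lebesgue)"
        using y d by (subst nn_integral_powr) auto
      also have "\<dots> = (\<integral>\<^sup>+t. ennreal k * (ennreal (\<bar>t\<bar> powr (d - 1)) * indicator {0..y} t) \<partial>lebesgue)"
        by (rule nn_integral_cmult[symmetric]) (simp add: abs_powr_indicator_measurable)
      also have "\<dots> \<le> weyl_abs \<alpha> f x"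
        unfolding weyl_abs_def
      proof (rule nn_integral_mono)
        fix t
        show "ennreal k * (ennreal (\<bar>t\<bar> powr (d - 1)) * indicator {0..y} t) \<le>
            ennreal (\<bar>f t\<bar> / (t - x) powr (1 - \<alpha>)) * indicator {x<..} t"
        proof (cases "t \<in> {0..y}")
          case True
          then have t: "0 \<le> t" "t \<le> y" "x < t" "t \<le> 1" using y by (auto simp: y_def)
          have "(t - x) powr (1 - \<alpha>) \<le> (2 * y) powr (1 - \<alpha>)"
            using t y \<alpha> by (intro powr_mono2) (auto simp: y_def)
          also have "\<dots> = 2 powr (1 - \<alpha>) * y powr (1 - \<alpha>)" using y by (simp add: powr_mult)
          also have "\<dots> \<le> 2 powr 1 * y powr (1 - \<alpha>)" using \<alpha> by (intro mult_right_mono powr_mono) auto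
          finally have "(t - x) powr (1 - \<alpha>) \<le> 2 * y powr (1 - \<alpha>)" by simp
          then have "t powr (d - 1) / (2 * y powr (1 - \<alpha>)) \<le> t powr (d - 1) / (t - x) powr (1 - \<alpha>)"
            using t y by (intro divide_left_mono) auto
          moreover have "t powr (d - 1) / (2 * y powr (1 - \<alpha>)) = k * t powr (d - 1)"
            using y by (simp add: k_def powr_diff mult_ac)
          ultimately show ?thesis using t y True
            by (simp add: f_def k_def ennreal_mult[symmetric] ennreal_leI)
        qed simp
      qed
      finally show ?thesis .
    qed
    show "ennreal (p / (q * d) * (1 / (2 * d)) powr q) \<le> (\<integral>\<^sup>+x\<in>{- 1..0}. ennreal (G x powr q * w x powr q) \<partial>lebesgue)"
    proof -
      have "(\<alpha> - 1 + d) * q + c = d * q / p - 1"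
      proof -
        have 1: "1 / p' = 1 - 1 / p" and 2: "\<alpha> = 1 / p - 1 / q" using pp' pq by linarith+
        have "(\<alpha> - 1 + d) * q + (1 - d) * q * (1 / p') = d * q * (1 / p) - 1"
          unfolding 1 2 using p q by (simp add: field_simps)
        then show ?thesis by (simp add: c_def)
      qed
      then have G: "G x powr q * \<bar>x\<bar> powr c = (1 / (2 * d)) powr q * \<bar>x\<bar> powr (d * q / p - 1)" for x
        using d by (simp add: G_def powr_divide powr_powr powr_add[symmetric])
      have dq: "0 < d * q / p" using d q p by simp
      have "(\<integral>\<^sup>+x\<in>{- 1..0}. ennreal (G x powr q * w x powr q) \<partial>lebesgue) =
          (\<integral>\<^sup>+x. ennreal ((1 / (2 * d)) powr q) * (ennreal (\<bar>x\<bar> powr (d * q / p - 1)) * indicator {- 1..0} x) \<partial>lebesgue)"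
        unfolding u G by (intro nn_integral_cong) (auto simp: ennreal_mult split: split_indicator)
      also have "\<dots> = ennreal ((1 / (2 * d)) powr q) * ennreal (1 / (d * q / p))"
        using dq by (subst nn_integral_cmult) (simp_all add: abs_powr_indicator_measurable nn_integral_powr)
      also have "\<dots> = ennreal (p / (q * d) * (1 / (2 * d)) powr q)"
        using dq d p q by (subst ennreal_mult[symmetric]) (auto simp: mult_ac)
      finally show ?thesis by simp
    qed
  qed (use p q d in \<open>auto simp: f_def G_def\<close>)
  moreover have "(p / (q * d) * (1 / (2 * d)) powr q) powr (1 / q) / (1 / d) powr (1 / p) =
      1 / 2 * (p / q) powr (1 / q) * d powr (- (1 - \<alpha>))"
  proof -
    have "(p / (q * d) * (1 / (2 * d)) powr q) powr (1 / q) / (1 / d) powr (1 / p) =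
        1 / 2 * (p / q) powr (1 / q) * (d powr (1 / p) / (d powr (1 / q) * d))"
      using d q p by (simp add: powr_mult powr_divide powr_powr)
    also have "d powr (1 / p) / (d powr (1 / q) * d) = d powr (- (1 - \<alpha>))"
    proof -
      have "d powr (1 / p) / (d powr (1 / q) * d powr 1) = d powr (1 / p - (1 / q + 1))"
        unfolding powr_diff powr_add ..
      then show ?thesis using d pq by (simp add: algebra_simps)
    qed
    finally show ?thesis .
  qed
  ultimately show "ennreal (1 / 2 * (p / q) powr (1 / q) * d powr (- (1 - \<alpha>))) \<le> weyl_norm \<alpha> p q w"
    by (simp only:)
qed

text \<open>In the family chosen according to the sign of q - p', the characteristic is at most (6 /
  d)^\<gamma> and the norm at least c d^(- (1 - \<alpha>)). As min 1 (q / p') and max 1 (p' / q) are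
  reciprocal, \<gamma> \<beta> = 1 - \<alpha>. Monotonicity of \<psi> makes the upper bound for the
  characteristic sufficient.\<close>

theorem weyl_sharp:
  assumes \<beta>: "\<beta> = (1 - \<alpha>) * max 1 (p' / q)"
  shows "\<not> (\<exists>\<psi> :: real \<Rightarrow> real.
            (\<forall>t\<ge>1. 0 < \<psi> t) \<and> mono_on {1..} \<psi> \<and> ((\<lambda>t. \<psi> t / t powr \<beta>) \<longlongrightarrow> 0) at_top \<and>
            (\<forall>w \<in> Apq_plus p q. weyl_norm \<alpha> p q w \<le> ennreal (\<psi> (enn2real (Apq_plus_char p q w)))))"
proof
  assume "\<exists>\<psi> :: real \<Rightarrow> real.
            (\<forall>t\<ge>1. 0 < \<psi> t) \<and> mono_on {1..} \<psi> \<and> ((\<lambda>t. \<psi> t / t powr \<beta>) \<longlongrightarrow> 0) at_top \<and>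
            (\<forall>w \<in> Apq_plus p q. weyl_norm \<alpha> p q w \<le> ennreal (\<psi> (enn2real (Apq_plus_char p q w))))"
  then obtain \<psi> :: "real \<Rightarrow> real" where \<psi>: "\<forall>t\<ge>1. 0 < \<psi> t" "mono_on {1..} \<psi>"
    "((\<lambda>t. \<psi> t / t powr \<beta>) \<longlongrightarrow> 0) at_top"
    "\<And>w. w \<in> Apq_plus p q \<Longrightarrow> weyl_norm \<alpha> p q w \<le> ennreal (\<psi> (enn2real (Apq_plus_char p q w)))" by blast
  define \<gamma> where "\<gamma> = min 1 (q / p')"
  have \<gamma>: "0 < \<gamma>" using q p' by (simp add: \<gamma>_def)
  have \<gamma>\<beta>: "\<gamma> * \<beta> = 1 - \<alpha>" using q p' by (auto simp: \<gamma>_def \<beta> min_def max_def field_simps)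
  define c where "c = min (1 / 8) (1 / 2 * (p / q) powr (1 / q))"
  have c: "0 < c" using p q by (simp add: c_def)
  have family: "\<exists>w\<in>Apq_plus p q. 1 \<le> Apq_plus_char p q w \<and> Apq_plus_char p q w \<le> ennreal ((6 / d) powr \<gamma>) \<and>
      ennreal (c * d powr (- (1 - \<alpha>))) \<le> weyl_norm \<alpha> p q w" if d: "0 < d" "d < 1" for d
  proof (cases "q / p' < 1")
    case True
    have "c * d powr (- (1 - \<alpha>)) \<le> 1 / 2 * (p / q) powr (1 / q) * d powr (- (1 - \<alpha>))"
      by (intro mult_right_mono) (simp_all add: c_def)
    then have "ennreal (c * d powr (- (1 - \<alpha>))) \<le> weyl_norm \<alpha> p q (\<lambda>x. \<bar>x\<bar> powr ((1 - d) / p'))"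
      using singular_\<sigma>_family(4)[OF d] by (meson ennreal_leI order_trans)
    then show ?thesis using singular_\<sigma>_family(1-3)[OF d] True by (auto simp: \<gamma>_def)
  next
    case False
    have "c * d powr (- (1 - \<alpha>)) \<le> 1 / 8 * d powr (- (1 - \<alpha>))"
      by (intro mult_right_mono) (simp_all add: c_def)
    then have "ennreal (c * d powr (- (1 - \<alpha>))) \<le> weyl_norm \<alpha> p q (\<lambda>x. \<bar>x\<bar> powr ((d - 1) / q))"
      using singular_u_family(4)[OF d] by (meson ennreal_leI order_trans)
    then show ?thesis using singular_u_family(1-3)[OF d] False d by (auto simp: \<gamma>_def min_def)
  qed
  define C where "C = 6 powr \<gamma>"
  have C: "1 \<le> C" using \<gamma> by (simp add: C_def ge_one_powr_ge_zero)
  have lower: "c / C powr \<beta> \<le> \<psi> t / t powr \<beta>" if t: "C < t" for t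
  proof -
    have t0: "0 < t" "1 \<le> t" using t C by auto
    \<comment> \<open>The solution of (6 / d)^\<gamma> = t; the assumption C < t makes it smaller
      than 1.\<close>
    define d where "d = (C / t) powr (1 / \<gamma>)"
    have d: "0 < d" "d < 1"
    proof -
      have "(C / t) powr (1 / \<gamma>) < 1 powr (1 / \<gamma>)"
        using t t0 C \<gamma> by (intro powr_less_mono2) auto
      then show "d < 1" by (simp add: d_def)
    qed (use t0 C in \<open>simp add: d_def\<close>)
    have dg: "d powr \<gamma> = C / t" using \<gamma> t0 C by (simp add: d_def powr_powr)
    have "(6 / d) powr \<gamma> = t" using d t0 C by (simp add: powr_divide dg C_def[symmetric])
    then obtain w where w: "w \<in> Apq_plus p q" "1 \<le> Apq_plus_char p q w" "Apq_plus_char p q w \<le> ennreal t"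
      "ennreal (c * d powr (- (1 - \<alpha>))) \<le> weyl_norm \<alpha> p q w"
      using family[OF d] by auto
    define k where "k = enn2real (Apq_plus_char p q w)"
    have char: "Apq_plus_char p q w = ennreal k" using le_less_trans[OF w(3), of top] by (simp add: k_def)
    have k: "1 \<le> k" "k \<le> t" using w(2,3)[unfolded char] t0 by (simp_all add: ennreal_le_iff ennreal_ge_1)
    have "ennreal (c * d powr (- (1 - \<alpha>))) \<le> ennreal (\<psi> k)" using w(4) \<psi>(4)[OF w(1)] by (simp add: k_def)
    also have "\<dots> \<le> ennreal (\<psi> t)" using \<psi>(2) k by (intro ennreal_leI) (auto simp: mono_on_def)
    finally have "c * d powr (- (1 - \<alpha>)) \<le> \<psi> t" using \<psi>(1) t0 by (simp add: ennreal_le_iff less_imp_le)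
    moreover have "d powr (- (1 - \<alpha>)) = (t / C) powr \<beta>"
    proof -
      have "d powr (- (1 - \<alpha>)) = (d powr \<gamma>) powr (- \<beta>)" by (simp add: powr_powr \<gamma>\<beta>)
      also have "\<dots> = (t / C) powr \<beta>" using t0 C by (simp add: dg powr_divide powr_minus)
      finally show ?thesis .
    qed
    ultimately have "c * (t / C) powr \<beta> \<le> \<psi> t" by simp
    then have "c * (t / C) powr \<beta> / t powr \<beta> \<le> \<psi> t / t powr \<beta>" by (intro divide_right_mono) auto
    then show ?thesis using t0 C by (simp add: powr_divide)
  qed
  have "\<forall>\<^sub>F t in at_top. c / C powr \<beta> \<le> \<psi> t / t powr \<beta>"
    using eventually_gt_at_top[of C] by eventually_elim (rule lower)
  then have "c / C powr \<beta> \<le> 0" by (rule tendsto_lowerbound[OF \<psi>(3)]) simp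
  moreover have "0 < c / C powr \<beta>" using c C by simp
  ultimately show False by simp
qed

end

theorem theorem3p7:
  fixes \<alpha> p q \<beta> :: real
  assumes "0 < \<alpha>" and "\<alpha> < 1"
    and "1 < p" and "p < 1 / \<alpha>"
    and "q = p / (1 - \<alpha> * p)"
    and "\<beta> = (1 - \<alpha>) * max 1 (conj_exp p / q)"
  shows "(\<exists>c>0. \<forall>w \<in> Apq_minus p q.
            riemann_liouville_norm \<alpha> p q w \<le> ennreal (c * enn2real (Apq_minus_char p q w) powr \<beta>))
       \<and> \<not> (\<exists>\<psi> :: real \<Rightarrow> real.
            (\<forall>t\<ge>1. 0 < \<psi> t) \<and> mono_on {1..} \<psi> \<and>
            ((\<lambda>t. \<psi> t / t powr \<beta>) \<longlongrightarrow> 0) at_top \<and>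
            (\<forall>w \<in> Apq_minus p q.
               riemann_liouville_norm \<alpha> p q w \<le> ennreal (\<psi> (enn2real (Apq_minus_char p q w)))))
       \<and> (\<exists>c>0. \<forall>w \<in> Apq_plus p q.
            weyl_norm \<alpha> p q w \<le> ennreal (c * enn2real (Apq_plus_char p q w) powr \<beta>))
       \<and> \<not> (\<exists>\<psi> :: real \<Rightarrow> real.
            (\<forall>t\<ge>1. 0 < \<psi> t) \<and> mono_on {1..} \<psi> \<and>
            ((\<lambda>t. \<psi> t / t powr \<beta>) \<longlongrightarrow> 0) at_top \<and>
            (\<forall>w \<in> Apq_plus p q.
               weyl_norm \<alpha> p q w \<le> ennreal (\<psi> (enn2real (Apq_plus_char p q w)))))"
proof -
  define p' where "p' = conj_exp p"
  have ap: "0 < 1 - \<alpha> * p" using assms(1,4) by (simp add: field_simps)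
  have "p < q" using ap assms(1,3) by (simp add: assms(5) less_divide_eq)
  then have q: "1 < q" using assms(3) by simp
  have p': "1 < p'" "1 / p + 1 / p' = 1"
    using assms(3) by (auto simp: p'_def conj_exp_def less_divide_eq field_simps)
  have pq: "1 / p - 1 / q = \<alpha>" using ap assms(3) by (simp add: assms(5) field_simps)
  \<comment> \<open>The exported locale constant does not involve the weight, so c depends on p and
    \<alpha> only. The absolute value and the 1 make it positive before any weight is fixed, where
    \<open>weyl_const_nonneg\<close> cannot be invoked.\<close>
  define c where "c = \<bar>Apq_weight.weyl_const \<alpha> p q\<bar> + 1"
  have c: "0 < c" by (simp add: c_def)
  have weyl_upper: "weyl_norm \<alpha> p q w \<le> ennreal (c * enn2real (Apq_plus_char p q w) powr \<beta>)"
    if w: "w \<in> Apq_plus p q" for w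
  proof -
    interpret Apq_weight \<alpha> p q w by unfold_locales (use assms w in auto)
    have "weyl_const * K powr local.\<beta> \<le> c * K powr local.\<beta>"
      by (intro mult_right_mono) (auto simp: c_def)
    then have "weyl_norm \<alpha> p q w \<le> ennreal (c * K powr local.\<beta>)"
      using weyl_norm_bound by (meson ennreal_leI order_trans)
    then show ?thesis by (simp add: K_def \<beta>_def p'_def assms(6))
  qed
  have rl_eq: "riemann_liouville_norm \<alpha> p q w = weyl_norm \<alpha> p q (\<lambda>x. w (- x))"
    "Apq_minus_char p q w = Apq_plus_char p q (\<lambda>x. w (- x))"
    "w \<in> Apq_minus p q \<longleftrightarrow> (\<lambda>x. w (- x)) \<in> Apq_plus p q" for w
    by (simp_all only: weyl_norm_reflect Apq_char_reflect Apq_reflect)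
  \<comment> \<open>An arbitrary F lets one equivalence transfer both the upper bound, with F k = c
    k^\<beta>, and the sharpness, with F = \<psi>.\<close>
  have all_reflect: "(\<forall>w\<in>Apq_minus p q. riemann_liouville_norm \<alpha> p q w \<le> ennreal (F (enn2real (Apq_minus_char p q w)))) \<longleftrightarrow>
      (\<forall>w\<in>Apq_plus p q. weyl_norm \<alpha> p q w \<le> ennreal (F (enn2real (Apq_plus_char p q w))))" for F :: "real \<Rightarrow> real"
  proof -
    have refl_mem: "(\<lambda>x. w (- x)) \<in> Apq_minus p q" if "w \<in> Apq_plus p q" for w
      using that by (simp add: rl_eq(3))
    show ?thesis
    proof (intro iffI ballI)
      fix w assume H: "\<forall>w\<in>Apq_minus p q. riemann_liouville_norm \<alpha> p q w \<le> ennreal (F (enn2real (Apq_minus_char p q w)))"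
        and w: "w \<in> Apq_plus p q"
      show "weyl_norm \<alpha> p q w \<le> ennreal (F (enn2real (Apq_plus_char p q w)))"
        using bspec[OF H refl_mem[OF w]] by (simp add: rl_eq(1,2))
    next
      fix w assume H: "\<forall>w\<in>Apq_plus p q. weyl_norm \<alpha> p q w \<le> ennreal (F (enn2real (Apq_plus_char p q w)))"
        and w: "w \<in> Apq_minus p q"
      show "riemann_liouville_norm \<alpha> p q w \<le> ennreal (F (enn2real (Apq_minus_char p q w)))"
        using H w by (simp add: rl_eq)
    qed
  qed
  have sharp: "\<not> (\<exists>\<psi> :: real \<Rightarrow> real.
            (\<forall>t\<ge>1. 0 < \<psi> t) \<and> mono_on {1..} \<psi> \<and> ((\<lambda>t. \<psi> t / t powr \<beta>) \<longlongrightarrow> 0) at_top \<and>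
            (\<forall>w \<in> Apq_plus p q. weyl_norm \<alpha> p q w \<le> ennreal (\<psi> (enn2real (Apq_plus_char p q w)))))"
    using assms(1-3) q p' pq p'_def by (rule weyl_sharp) (simp add: assms(6) p'_def)
  have upper: "\<exists>c>0. \<forall>w\<in>Apq_plus p q. weyl_norm \<alpha> p q w \<le> ennreal (c * enn2real (Apq_plus_char p q w) powr \<beta>)"
    using c weyl_upper by blast
  show ?thesis
    using upper sharp by (simp only: all_reflect[of "\<lambda>k. _ * k powr \<beta>"] all_reflect simp_thms)
qed

end
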